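(* Let $G$ be a connected $n$-vertex graph that is not isomorphic to any graph in $\mathcal{E}_4 = \{C_4, C_4', K_4, G_1, G_2, G_3, G_4, G_5, G_6\}$. Then \[\iota(G, C_4) \leq \left\lfloor \frac{n}{5} \right\rfloor.\] Moreover, equality holds if $G = B_{n,C_4}$.
   Context: All graphs are finite and simple. For a graph $G$ and $D \subseteq V(G)$, $N[D]$ denotes the closed neighbourhood $\bigcup_{v\in D}(\{v\}\cup N(v))$ and $G - N[D]$ the subgraph induced by $V(G)\setminus N[D]$. A set $D \subseteq V(G)$ is a $C_4$-isolating set of $G$ if $G - N[D]$ contains no subgraph isomorphic to the $4$-cycle $C_4$; $\iota(G, C_4)$ is the minimum size of a $C_4$-isolating set of $G$. $C_4'$ is the diamond graph on $\{1,2,3,4\}$ with edges $12,23,34,41,13$. The graphs $G_1,\dots,G_6$ all have vertex set $\{1,\dots,9\}$ and edge sets: $G_1$: all pairs $\{i,j\}$ with $j-i \equiv \pm1$ or $\pm 2 \pmod 9$ (the circulant $C_9(1,2)$); $G_2$: $56,58,59,54,61,67,68,12,17,19,23,28,29,34,37,38,47,49$; $G_3$: $56,57,58,54,67,68,61,71,74,82,83,43,49,12,19,23,29,39$; $G_4$: $12,13,14,15,23,26,27,36,37,45,48,49,58,59,67,69,78,89$; $G_5$: the edges of $G_4$ except $23$; $G_6$: the edges of $G_4$ except $23$ and $45$. The graph $B_{n,C_4}$ is defined as follows: if $n \leq 4$, $B_{n,C_4}$ is the path $P_n$ on $\{1,\dots,n\}$ with edges $\{i,i+1\}$. If $n \geq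 5$, let $a = \lfloor n/5 \rfloor$ and $b = n - 4a$; take vertices $\{1,\dots,b\}$ together with $a$ pairwise vertex-disjoint copies $F_1,\dots,F_a$ of $C_4$ (disjoint from $\{1,\dots,b\}$); the edges are $\{i,i+1\}$ for $1 \le i \le a-1$, $\{a,j\}$ for $a < j \leq b$, the edges of each $F_i$, and $\{i,u\}$ for every $i \in \{1,\dots,a\}$ and every $u \in V(F_i)$. *)

theory Defs
  imports Main
begin

text \<open>A finite simple graph is given by a finite vertex set V and a set E of
  2-element subsets of V.\<close>

definition sgraph :: "'a set \<Rightarrow> 'a set set \<Rightarrow> bool" where
  "sgraph V E \<longleftrightarrow> finite V \<and> (\<forall>e\<in>E. \<exists>u v. e = {u, v} \<and> u \<noteq> v \<and> u \<in> V \<and> v \<in> V)"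

definition connected_graph :: "'a set \<Rightarrow> 'a set set \<Rightarrow> bool" where
  "connected_graph V E \<longleftrightarrow> V \<noteq> {} \<and>
     (\<forall>u\<in>V. \<forall>v\<in>V. (u, v) \<in> {(x, y). {x, y} \<in> E}\<^sup>*)"

text \<open>Closed neighbourhood N[D].\<close>
definition cnbhd :: "'a set \<Rightarrow> 'a set set \<Rightarrow> 'a set \<Rightarrow> 'a set" where
  "cnbhd V E D = D \<union> {v \<in> V. \<exists>u\<in>D. {u, v} \<in> E}"

text \<open>The subgraph of G induced by S contains a subgraph isomorphic to C4.\<close>
definition contains_C4 :: "'a set \<Rightarrow> 'a set set \<Rightarrow> bool" where
  "contains_C4 S E \<longleftrightarrow> (\<exists>a b c d. a \<in> S \<and> b \<in> S \<and> c \<in> S \<and> d \<in> S \<and>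
     distinct [a, b, c, d] \<and> {a, b} \<in> E \<and> {b, c} \<in> E \<and> {c, d} \<in> E \<and> {d, a} \<in> E)"

definition C4_isolating :: "'a set \<Rightarrow> 'a set set \<Rightarrow> 'a set \<Rightarrow> bool" where
  "C4_isolating V E D \<longleftrightarrow> D \<subseteq> V \<and> \<not> contains_C4 (V - cnbhd V E D) E"

definition iota_C4 :: "'a set \<Rightarrow> 'a set set \<Rightarrow> nat" where
  "iota_C4 V E = Min {card D | D. C4_isolating V E D}"

definition graph_iso :: "'a set \<times> 'a set set \<Rightarrow> 'b set \<times> 'b set set \<Rightarrow> bool" where
  "graph_iso G H \<longleftrightarrow> (\<exists>f. bij_betw f (fst G) (fst H) \<and>
     (\<forall>u\<in>fst G. \<forall>v\<in>fst G. {u, v} \<in> snd G \<longleftrightarrow> {f u, f v} \<in> snd H))"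

definition edges_of :: "(nat \<times> nat) list \<Rightarrow> nat set set" where
  "edges_of xs = (\<lambda>(a, b). {a, b}) ` set xs"

definition C4g :: "nat set \<times> nat set set" where
  "C4g = ({1..4}, edges_of [(1,2),(2,3),(3,4),(4,1)])"

definition C4'g :: "nat set \<times> nat set set" where
  "C4'g = ({1..4}, edges_of [(1,2),(2,3),(3,4),(4,1),(1,3)])"

definition K4g :: "nat set \<times> nat set set" where
  "K4g = ({1..4}, edges_of [(1,2),(1,3),(1,4),(2,3),(2,4),(3,4)])"

definition G1g :: "nat set \<times> nat set set" where
  "G1g = ({1..9}, {{i, j} | i j. i \<in> {1..9} \<and> j \<in> {1..9} \<and>
            (int j - int i) mod 9 \<in> {1, 2, 7, 8}})"

definition G2g :: "nat set \<times> nat set set" where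
  "G2g = ({1..9}, edges_of [(5,6),(5,8),(5,9),(5,4),(6,1),(6,7),(6,8),(1,2),(1,7),(1,9),
                            (2,3),(2,8),(2,9),(3,4),(3,7),(3,8),(4,7),(4,9)])"

definition G3g :: "nat set \<times> nat set set" where
  "G3g = ({1..9}, edges_of [(5,6),(5,7),(5,8),(5,4),(6,7),(6,8),(6,1),(7,1),(7,4),
                            (8,2),(8,3),(4,3),(4,9),(1,2),(1,9),(2,3),(2,9),(3,9)])"

definition G4_edges :: "nat set set" where
  "G4_edges = edges_of [(1,2),(1,3),(1,4),(1,5),(2,3),(2,6),(2,7),(3,6),(3,7),
                        (4,5),(4,8),(4,9),(5,8),(5,9),(6,7),(6,9),(7,8),(8,9)]"

definition G4g :: "nat set \<times> nat set set" where
  "G4g = ({1..9}, G4_edges)"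

definition G5g :: "nat set \<times> nat set set" where
  "G5g = ({1..9}, G4_edges - {{2,3}})"

definition G6g :: "nat set \<times> nat set set" where
  "G6g = ({1..9}, G4_edges - {{2,3}, {4,5}})"

definition E4_family :: "(nat set \<times> nat set set) list" where
  "E4_family = [C4g, C4'g, K4g, G1g, G2g, G3g, G4g, G5g, G6g]"

text \<open>The extremal graph B_{n,C4}. For n \<ge> 5, with a = n div 5 and b = n - 4a,
  the copy F_i (1 \<le> i \<le> a) of C4 has vertices b+4(i-1)+1, ..., b+4(i-1)+4 in cyclic order.\<close>

definition B_V :: "nat \<Rightarrow> nat set" where
  "B_V n = {1..n}"

definition B_E :: "nat \<Rightarrow> nat set set" where
  "B_E n = (if n \<le> 4 then {{i, i + 1} | i. 1 \<le> i \<and> i < n}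
     else (let a = n div 5; b = n - 4 * a in
        {{i, i + 1} | i. 1 \<le> i \<and> i \<le> a - 1}
      \<union> {{a, j} | j. a < j \<and> j \<le> b}
      \<union> (\<Union>i\<in>{1..a}. let s = b + 4 * (i - 1) in
            {{s+1, s+2}, {s+2, s+3}, {s+3, s+4}, {s+4, s+1}}
          \<union> {{i, u} | u. u \<in> {s+1..s+4}})))"

end

(* Call a connected graph bad if its isolation number exceeds a fifth of its order. Let S be bad with all
   smaller bad induced subgraphs of order 4 or among the six exceptional graphs of order 9. Removing a vertex
   from such a graph H lowers its isolation number from (|H|+1)/5 to at most (|H|-4)/5, so a
   dominating set that reaches into bad components gains a lot; counting this gain shows that S has no cut
   vertex. If S has maximum degree at most 3, two successive removals of five vertices around 4-cycles force
   |S| = 4. Otherwise let v have maximum degree k. The counting shows that S - N[v] has b >= k-3 bad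
   components, that each neighbour of v sees at most one of them, and that each of them is seen by at least two
   neighbours of v. Removing a set of five or ten vertices around one of these components then forces |S| = 9.
   The bad graphs on nine vertices are found by an exhaustive search, replayed as a checked certificate. *)
theory Submission
  imports Defs
begin

section \<open>Isolation numbers of induced subgraphs\<close>

text \<open>Measure in units of a fifth. A vertex of \<open>D\<close> costs 5, a removed vertex pays
  1, and the strict inequality in badness must be covered by someone. If five vertices are removed
  per vertex of \<open>D\<close>, only a bad component left over can cover it; hence the sets of
  five or ten vertices. The removed vertices need not all be dominated: one with at most one
  surviving neighbour lies on no surviving 4-cycle. The orders 4 and 9 are both -1 mod 5, so a bad
  component costs 1 when missed and saves 4 when hit. The difference 5 is the price of one
  dominating vertex: a neighbour of \<open>v\<close> that hits one bad component breaks even, and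
  one that hits two gains. This limits how bad components attach to \<open>v\<close>. In the other
  direction, the closed neighbourhood of a vertex of degree at least 4 already pays for that vertex,
  so bad components must exist. Since there is no cut vertex, each of them attaches at two places,
  and the second place is what the local arguments exploit.\<close>

locale adjacency =
  fixes adj :: "'a \<Rightarrow> 'a \<Rightarrow> bool"
  assumes adj_sym: "adj u v \<Longrightarrow> adj v u" and adj_irrefl: "\<not> adj u u"
begin

definition has_C4 :: "'a set \<Rightarrow> bool" where
  "has_C4 S \<longleftrightarrow> (\<exists>a b c d. {a, b, c, d} \<subseteq> S \<and> distinct [a, b, c, d] \<and>
     adj a b \<and> adj b c \<and> adj c d \<and> adj d a)"

definition nbhd :: "'a set \<Rightarrow> 'a set" where
  "nbhd D = D \<union> {v. \<exists>u\<in>D. adj u v}"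

text \<open>The dominating set may use vertices outside A. This makes the isolation number monotone in
  A, and it makes no difference for A the whole vertex set.\<close>
definition iso_num :: "'a set \<Rightarrow> nat" where
  "iso_num A = (LEAST m. \<exists>D. finite D \<and> card D = m \<and> \<not> has_C4 (A - nbhd D))"

text \<open>Connectedness by cuts instead of paths: later arguments always ask for an edge that
  leaves a given proper part.\<close>

definition conn :: "'a set \<Rightarrow> bool" where
  "conn S \<longleftrightarrow> S \<noteq> {} \<and> (\<forall>A. A \<subseteq> S \<and> A \<noteq> {} \<and> A \<noteq> S \<longrightarrow> (\<exists>a\<in>A. \<exists>b\<in>S - A. adj a b))"

definition comps :: "'a set \<Rightarrow> 'a set set" where
  "comps S = {C. C \<subseteq> S \<and> conn C \<and> (\<forall>a\<in>C. \<forall>b\<in>S - C. \<not> adj a b)}"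

definition nbrs :: "'a set \<Rightarrow> 'a \<Rightarrow> 'a set" where
  "nbrs S v = {u \<in> S. adj v u}"

abbreviation deg :: "'a set \<Rightarrow> 'a \<Rightarrow> nat" where
  "deg S v \<equiv> card (nbrs S v)"

definition bad :: "'a set \<Rightarrow> bool" where
  "bad S \<longleftrightarrow> finite S \<and> conn S \<and> card S < 5 * iso_num S"

section \<open>4-cycles and closed neighbourhoods\<close>

lemma has_C4_mono: "has_C4 A \<Longrightarrow> A \<subseteq> B \<Longrightarrow> has_C4 B"
  unfolding has_C4_def by (meson subset_trans)

lemma has_C4I: "{a, b, c, d} \<subseteq> S \<Longrightarrow> distinct [a, b, c, d] \<Longrightarrow> adj a b \<Longrightarrow> adj b c \<Longrightarrow> adj c d \<Longrightarrow>
    adj d a \<Longrightarrow> has_C4 S"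
  unfolding has_C4_def by blast

lemma has_C4_card: assumes "has_C4 S" "finite S" shows "4 \<le> card S"
proof -
  obtain a b c d where "{a, b, c, d} \<subseteq> S" "distinct [a, b, c, d]"
    using assms(1) unfolding has_C4_def by blast
  then show ?thesis using card_mono[OF assms(2), of "{a,b,c,d}"] by simp
qed

text \<open>On four vertices the cycle is all of \<open>S\<close>, so it can be rotated to start at
  the chosen vertex \<open>y\<close>; \<open>p\<close> and \<open>q\<close> are its neighbours on
  the cycle and \<open>z\<close> is opposite to it.\<close>

lemma has_C4_opposite:
  assumes "has_C4 S" "card S = 4" "y \<in> S"
  obtains p q z where "S = {y, p, q, z}" "distinct [y, p, q, z]"
    "adj y p" "adj y q" "adj z p" "adj z q"
proof -
  obtain a b c d where *: "{a, b, c, d} \<subseteq> S" "distinct [a, b, c, d]"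
     "adj a b" "adj b c" "adj c d" "adj d a"
    using assms(1) unfolding has_C4_def by blast
  have S: "S = {a, b, c, d}"
    using * assms(2) card_subset_eq[of S "{a,b,c,d}"] card.infinite[of S] by fastforce
  then consider "y = a" | "y = b" | "y = c" | "y = d" using assms(3) by blast
  then show ?thesis
  proof cases
    case 1 show ?thesis by (rule that[of b d c]) (use 1 S * adj_sym in auto)
  next
    case 2 show ?thesis by (rule that[of a c d]) (use 2 S * adj_sym in auto)
  next
    case 3 show ?thesis by (rule that[of b d a]) (use 3 S * adj_sym in auto)
  next
    case 4 show ?thesis by (rule that[of a c b]) (use 4 S * adj_sym in auto)
  qed
qed

text \<open>Every vertex of a 4-cycle has two distinct neighbours on it. This is the tool for
  discarding undominated vertices.\<close>

lemma has_C4_drop: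
  assumes "has_C4 A"
    and one: "\<And>z p q. z \<in> M \<Longrightarrow> p \<in> A \<Longrightarrow> q \<in> A \<Longrightarrow> adj z p \<Longrightarrow> adj z q \<Longrightarrow> p = q"
  shows "has_C4 (A - M)"
proof -
  obtain a b c d where *: "{a, b, c, d} \<subseteq> A" "distinct [a, b, c, d]"
     "adj a b" "adj b c" "adj c d" "adj d a"
    using assms(1) unfolding has_C4_def by blast
  have "a \<notin> M" "b \<notin> M" "c \<notin> M" "d \<notin> M"
    using * one[of a b d] one[of b a c] one[of c b d] one[of d a c] adj_sym by auto
  then show ?thesis unfolding has_C4_def using * by blast
qed

lemma nbhd_Un: "nbhd (A \<union> B) = nbhd A \<union> nbhd B" and nbhd_sub: "D \<subseteq> nbhd D"
  and nbhd_insert: "nbhd (insert x A) = nbhd {x} \<union> nbhd A"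
  unfolding nbhd_def by auto

lemma in_nbhd_single: "v \<in> nbhd {u} \<longleftrightarrow> v = u \<or> adj u v"
  unfolding nbhd_def by auto

section \<open>Isolation numbers under domination\<close>

lemma iso_num_le: "finite D \<Longrightarrow> \<not> has_C4 (A - nbhd D) \<Longrightarrow> iso_num A \<le> card D"
  unfolding iso_num_def by (rule Least_le) blast

lemma iso_num_obtain:
  assumes "finite A"
  obtains D where "finite D" "card D = iso_num A" "\<not> has_C4 (A - nbhd D)"
proof -
  have "A - nbhd A = {}" using nbhd_sub by blast
  then have "\<exists>m D. finite D \<and> card D = m \<and> \<not> has_C4 (A - nbhd D)"
    using assms by (intro exI[of _ "card A"] exI[of _ A]) (auto simp: has_C4_def)
  from LeastI_ex[OF this] show ?thesis unfolding iso_num_def[symmetric] using that by blast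
qed

lemma iso_num_mono: assumes "finite B" "A \<subseteq> B" shows "iso_num A \<le> iso_num B"
proof -
  obtain D where "finite D" "card D = iso_num B" "\<not> has_C4 (B - nbhd D)" using iso_num_obtain[OF assms(1)] .
  then show ?thesis using iso_num_le[of D A] has_C4_mono[of "A - nbhd D" "B - nbhd D"] assms(2) by fastforce
qed

lemma iso_num_0: "\<not> has_C4 A \<Longrightarrow> iso_num A = 0"
  using iso_num_le[of "{}" A] has_C4_mono[of "A - nbhd {}" A] by auto

lemma iso_num_dom: assumes "finite A" "finite D" shows "iso_num A \<le> card D + iso_num (A - nbhd D)"
proof -
  obtain D' where D': "finite D'" "card D' = iso_num (A - nbhd D)" "\<not> has_C4 (A - nbhd D - nbhd D')"
    using iso_num_obtain[of "A - nbhd D"] assms(1) by blast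
  have "A - nbhd (D \<union> D') = A - nbhd D - nbhd D'" using nbhd_Un by auto
  then have "iso_num A \<le> card (D \<union> D')" using iso_num_le[of "D \<union> D'" A] D' assms by simp
  also have "\<dots> \<le> card D + card D'" by (rule card_Un_le)
  finally show ?thesis using D'(2) by simp
qed

section \<open>Connectedness and components\<close>

lemma conn_edge:
  assumes "conn S" "A \<subseteq> S" "A \<noteq> {}" "A \<noteq> S" shows "\<exists>a\<in>A. \<exists>b\<in>S - A. adj a b"
  using assms unfolding conn_def by blast

lemma comps_D:
  assumes "C \<in> comps S"
  shows "C \<subseteq> S" "conn C" "a \<in> C \<Longrightarrow> b \<in> S \<Longrightarrow> adj a b \<Longrightarrow> b \<in> C" "C \<noteq> {}"
  using assms unfolding comps_def conn_def by auto

lemma comps_finite: "finite S \<Longrightarrow> finite (comps S)"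
  by (rule finite_subset[of _ "Pow S"]) (auto simp: comps_def)

lemma comps_sub:
  assumes "conn A" "A \<subseteq> S" "C \<in> comps S" "A \<inter> C \<noteq> {}" shows "A \<subseteq> C"
proof (rule ccontr)
  assume "\<not> A \<subseteq> C"
  then have "A \<inter> C \<noteq> A" by blast
  then obtain a b where "a \<in> A \<inter> C" "b \<in> A - (A \<inter> C)" "adj a b"
    using conn_edge[OF assms(1), of "A \<inter> C"] assms(4) by auto
  then show False using comps_D(3)[OF assms(3), of a b] assms(2) by auto
qed

lemma comps_disj: "C1 \<in> comps S \<Longrightarrow> C2 \<in> comps S \<Longrightarrow> C1 \<inter> C2 \<noteq> {} \<Longrightarrow> C1 = C2"
  using comps_sub[of C1 S C2] comps_sub[of C2 S C1] comps_D by (metis inf_commute subset_antisym)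

text \<open>The component is a smallest set that contains \<open>v\<close> and has no outgoing edge.
  A cut of it without crossing edges would make the half with \<open>v\<close> a smaller such
  set.\<close>

lemma comp_ex:
  assumes "finite S" "v \<in> S" shows "\<exists>C\<in>comps S. v \<in> C"
proof -
  let ?P = "\<lambda>A. A \<subseteq> S \<and> v \<in> A \<and> (\<forall>a\<in>A. \<forall>b\<in>S - A. \<not> adj a b)"
  have "?P S" using assms by auto
  from ex_has_least_nat[of ?P, OF this, of card]
  obtain C where C0: "?P C \<and> (\<forall>A. ?P A \<longrightarrow> card C \<le> card A)" ..
  have C: "?P C" using C0 by (rule conjunct1)
  have min: "card C \<le> card A" if "?P A" for A
    by (rule mp[OF spec[OF conjunct2[OF C0], of A] that])
  have fC: "finite C" using C assms finite_subset by blast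
  have "conn C"
    unfolding conn_def
  proof (intro conjI allI impI)
    show "C \<noteq> {}" using C by blast
    fix A assume A: "A \<subseteq> C \<and> A \<noteq> {} \<and> A \<noteq> C"
    show "\<exists>a\<in>A. \<exists>b\<in>C - A. adj a b"
    proof (rule ccontr)
      assume no: "\<not> ?thesis"
      have "?P A \<or> ?P (C - A)" using A C no adj_sym by (cases "v \<in> A") blast+
      then have "card C \<le> card A \<or> card C \<le> card (C - A)" using min by blast
      moreover have "card A < card C" "card (C - A) < card C"
        using A fC by (auto intro!: psubset_card_mono)
      ultimately show False by linarith
    qed
  qed
  then show ?thesis using C unfolding comps_def by auto
qed

lemma comps_Union: "finite S \<Longrightarrow> \<Union> (comps S) = S"
  using comp_ex comps_D(1) by blast

lemma comps_card: assumes "finite S" shows "(\<Sum>C\<in>comps S. card C) = card S"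
proof -
  have "card (\<Union> (comps S)) = (\<Sum>C\<in>comps S. card C)"
  proof (rule card_Union_disjoint)
    show "pairwise disjnt (comps S)" using comps_disj by (auto simp: pairwise_def disjnt_def)
    show "\<And>A. A \<in> comps S \<Longrightarrow> finite A" using comps_D(1) assms finite_subset by blast
  qed
  then show ?thesis using comps_Union[OF assms] by simp
qed

lemma comps_conn: assumes "conn S" "C \<in> comps S" shows "C = S"
  using comps_sub[OF assms(1) subset_refl assms(2)] comps_D[OF assms(2)] by blast

text \<open>A surviving 4-cycle cannot pass through \<open>Y\<close>: both cycle neighbours of such
  a vertex would survive, against \<open>one\<close>. So the cycle lies in \<open>S - Y\<close>,
  hence in one component, and the components can be isolated independently.\<close>

theorem iso_num_comps:
  assumes "finite S" "finite D"
    and one: "\<And>z p q. z \<in> Y - nbhd D \<Longrightarrow> p \<in> S - nbhd D \<Longrightarrow> q \<in> S - nbhd D \<Longrightarrow> adj z p \<Longrightarrow> adj z q \<Longrightarrow> p = q"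
  shows "iso_num S \<le> card D + (\<Sum>C\<in>comps (S - Y). iso_num (C - nbhd D))"
proof -
  have fin: "finite (comps (S - Y))" using comps_finite assms(1) by simp
  have "\<forall>C\<in>comps (S - Y). \<exists>d. finite d \<and> card d = iso_num (C - nbhd D) \<and> \<not> has_C4 (C - nbhd D - nbhd d)"
    using iso_num_obtain comps_D(1) assms(1) by (metis finite_Diff finite_subset)
  then obtain d where d: "\<And>C. C \<in> comps (S - Y) \<Longrightarrow>
      finite (d C) \<and> card (d C) = iso_num (C - nbhd D) \<and> \<not> has_C4 (C - nbhd D - nbhd (d C))"
    by metis
  let ?D = "D \<union> (\<Union>C\<in>comps (S - Y). d C)"
  have "\<not> has_C4 (S - nbhd ?D)"
  proof
    assume "has_C4 (S - nbhd ?D)"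
    then obtain u v w x where *: "{u, v, w, x} \<subseteq> S - nbhd ?D" "distinct [u, v, w, x]"
      "adj u v" "adj v w" "adj w x" "adj x u" unfolding has_C4_def by blast
    have S: "{u, v, w, x} \<subseteq> S - nbhd D" using *(1) nbhd_Un by auto
    have Y: "u \<notin> Y" "v \<notin> Y" "w \<notin> Y" "x \<notin> Y"
      using one[of u v x] one[of v u w] one[of w v x] one[of x u w] S * adj_sym by auto
    then have "u \<in> S - Y" using S by auto
    then obtain C where C: "C \<in> comps (S - Y)" "u \<in> C" using comp_ex assms(1) by blast
    have "v \<in> C" using comps_D(3)[OF C(1), of u v] C *(3) S Y by auto
    moreover from this have "w \<in> C" using comps_D(3)[OF C(1), of v w] *(4) S Y by auto
    moreover from this have "x \<in> C" using comps_D(3)[OF C(1), of w x] *(5) S Y by auto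
    moreover have "nbhd (d C) \<subseteq> nbhd ?D" using C unfolding nbhd_def by blast
    ultimately have "{u, v, w, x} \<subseteq> C - nbhd D - nbhd (d C)" using S *(1) C by blast
    then have "has_C4 (C - nbhd D - nbhd (d C))" unfolding has_C4_def using * by blast
    then show False using d C by blast
  qed
  moreover have "finite ?D" using assms(2) fin d by auto
  ultimately have "iso_num S \<le> card ?D" by (intro iso_num_le)
  also have "\<dots> \<le> card D + card (\<Union>C\<in>comps (S - Y). d C)" by (rule card_Un_le)
  also have "card (\<Union>C\<in>comps (S - Y). d C) \<le> (\<Sum>C\<in>comps (S - Y). card (d C))"
    by (rule card_UN_le[OF fin])
  also have "\<dots> = (\<Sum>C\<in>comps (S - Y). iso_num (C - nbhd D))" using d by simp
  finally show ?thesis by simp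
qed

text \<open>The properties of the six exceptional graphs on nine vertices that the induction needs; the
  classification is only used through them.\<close>
definition nine :: "'a set \<Rightarrow> bool" where
  "nine S \<longleftrightarrow> finite S \<and> card S = 9 \<and>
    (\<forall>y\<in>S. 3 \<le> deg S y \<and> deg S y \<le> 4) \<and>
    (\<forall>y\<in>S. \<exists>v\<in>S. v \<noteq> y \<and> \<not> adj v y \<and> deg S v = 4) \<and>
    (\<forall>v\<in>S. \<forall>x\<in>S. adj v x \<longrightarrow> (deg S v = 3 \<longrightarrow> deg S x = 4) \<and>
       (deg S v = 4 \<and> nbrs S x \<subseteq> nbhd {v} \<longrightarrow> deg S x = 4 \<and> (\<exists>w\<in>S. \<forall>s\<in>S - {v, x} - nbhd {w}.
          (\<exists>u\<in>S. adj s u \<and> u \<notin> nbhd {v}) \<and> (\<forall>t\<in>S - {v, x} - nbhd {w}. \<not> adj s t)))) \<and>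
    (\<forall>y\<in>S. deg S y = 3 \<longrightarrow> (\<exists>y'\<in>S. \<exists>w\<in>S. y' \<noteq> y \<and> nbrs S y' = nbrs S y \<and>
       S - {y, y'} \<subseteq> nbrs S y \<union> nbhd {w})) \<and>
    ((\<exists>y\<in>S. deg S y = 3) \<longrightarrow> (\<exists>u\<in>S. deg S u = 4 \<and> (\<forall>t\<in>S - nbhd {u}. deg S t = 4)))"

definition smaller_bad :: "nat \<Rightarrow> bool" where
  "smaller_bad n \<longleftrightarrow> (\<forall>C. bad C \<and> card C < n \<longrightarrow> card C = 4 \<or> nine C)"

section \<open>Bad graphs of orders 4 and 9\<close>

lemma bad_C4: assumes "bad S" shows "has_C4 S"
  using assms iso_num_0[of S] unfolding bad_def by (metis mult_0_right not_less_zero)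

lemma nine_D: assumes "nine S"
  shows "finite S" "card S = 9" "y \<in> S \<Longrightarrow> 3 \<le> deg S y" "y \<in> S \<Longrightarrow> deg S y \<le> 4"
  "y \<in> S \<Longrightarrow> \<exists>v\<in>S. v \<noteq> y \<and> \<not> adj v y \<and> deg S v = 4"
  using assms unfolding nine_def by auto

lemma nine_twin:
  assumes "nine S" "y \<in> S" "deg S y = 3"
  shows "\<exists>y'\<in>S. \<exists>w\<in>S. y' \<noteq> y \<and> nbrs S y' = nbrs S y \<and> S - {y, y'} \<subseteq> nbrs S y \<union> nbhd {w}"
proof -
  have "\<forall>y\<in>S. deg S y = 3 \<longrightarrow> (\<exists>y'\<in>S. \<exists>w\<in>S. y' \<noteq> y \<and> nbrs S y' = nbrs S y \<and>
       S - {y, y'} \<subseteq> nbrs S y \<union> nbhd {w})"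
    using assms(1) unfolding nine_def by (elim conjE) assumption
  then show ?thesis using assms(2,3) by blast
qed

lemma nine_hub:
  assumes "nine S" "y \<in> S" "deg S y = 3"
  shows "\<exists>u\<in>S. deg S u = 4 \<and> (\<forall>t\<in>S - nbhd {u}. deg S t = 4)"
proof -
  have "(\<exists>y\<in>S. deg S y = 3) \<longrightarrow> (\<exists>u\<in>S. deg S u = 4 \<and> (\<forall>t\<in>S - nbhd {u}. deg S t = 4))"
    using assms(1) unfolding nine_def by (elim conjE) assumption
  then show ?thesis using assms(2,3) by blast
qed

lemma diff_nbhd: "S - nbhd {v} = S - insert v (nbrs S v)"
  unfolding nbrs_def nbhd_def by auto

lemma card_nbhd: assumes "finite S" "v \<in> S" shows "card (S \<inter> nbhd {v}) = Suc (deg S v)"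
proof -
  have "S \<inter> nbhd {v} = insert v (nbrs S v)" "v \<notin> nbrs S v" "finite (nbrs S v)"
    using assms adj_irrefl unfolding nbrs_def nbhd_def by auto
  then show ?thesis by simp
qed

lemma card_diff_nbhd: assumes "finite S" "v \<in> S" shows "card (S - nbhd {v}) + Suc (deg S v) = card S"
  using card_nbhd[OF assms] card_Diff_subset_Int[of S "nbhd {v}"] card_mono[OF assms(1), of "S \<inter> nbhd {v}"]
    assms by simp

text \<open>In order 4, three vertices remain without \<open>y\<close>, too few for a 4-cycle. In
  order 9, a vertex of degree 4 that is not adjacent to \<open>y\<close> leaves four vertices
  undominated, and \<open>y\<close> is one of them; again three remain.\<close>

lemma bad_bounds:
  assumes "bad C" "card C = 4 \<or> nine C"
  shows "y \<in> C \<Longrightarrow> 5 * iso_num (C - {y}) + 4 \<le> card C" "5 * iso_num C \<le> card C + 1"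
proof -
  have fin: "finite C" and ne: "C \<noteq> {}" using assms unfolding bad_def conn_def by auto
  have *: "5 * iso_num (C - {y}) + 4 \<le> card C" if y: "y \<in> C" for y
    using assms(2)
  proof
    assume 4: "card C = 4"
    then have "\<not> has_C4 (C - {y})" using has_C4_card[of "C - {y}"] y fin by auto
    then show ?thesis using 4 iso_num_0 by simp
  next
    assume 9: "nine C"
    obtain v where v: "v \<in> C" "v \<noteq> y" "\<not> adj v y" "deg C v = 4" using nine_D(5)[OF 9 y] by blast
    have "card (C - nbhd {v}) = 4" using card_diff_nbhd[OF fin v(1)] nine_D(2)[OF 9] v by simp
    moreover have "y \<in> C - nbhd {v}" using v y by (auto simp: in_nbhd_single)
    ultimately have "card ((C - nbhd {v}) - {y}) = 3" using fin by simp
    moreover have "C - {y} - nbhd {v} = C - nbhd {v} - {y}" by auto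
    ultimately have "\<not> has_C4 (C - {y} - nbhd {v})" using has_C4_card[of "C - {y} - nbhd {v}"] fin by auto
    then have "iso_num (C - {y}) \<le> 1" using iso_num_le[of "{v}" "C - {y}"] by simp
    then show ?thesis using nine_D(2)[OF 9] by simp
  qed
  then show "y \<in> C \<Longrightarrow> 5 * iso_num (C - {y}) + 4 \<le> card C" .
  obtain y where y: "y \<in> C" using ne by blast
  have "iso_num C \<le> 1 + iso_num (C - nbhd {y})" using iso_num_dom[OF fin, of "{y}"] by simp
  also have "iso_num (C - nbhd {y}) \<le> iso_num (C - {y})"
    using fin by (intro iso_num_mono) (auto simp: in_nbhd_single)
  finally show "5 * iso_num C \<le> card C + 1" using *[OF y] by simp
qed

lemma good_bound: assumes "conn C" "finite C" "\<not> bad C" shows "iso_num C \<le> card C div 5"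
  using assms unfolding bad_def by (simp add: less_eq_div_iff_mult_less_eq mult.commute)

section \<open>The counting inequality\<close>

definition bad_comps :: "'a set \<Rightarrow> 'a set set" where
  "bad_comps A = {C \<in> comps A. bad C}"

lemma bad_comps_comps: "C \<in> bad_comps A \<Longrightarrow> C \<in> comps A" and bad_comps_bad: "C \<in> bad_comps A \<Longrightarrow> bad C"
  unfolding bad_comps_def by auto

lemma bad_comps_finite: "finite A \<Longrightarrow> finite (bad_comps A)"
  unfolding bad_comps_def using comps_finite by auto

text \<open>D deals with Y: a vertex of Y that D does not dominate lies on no 4-cycle of S - N[D]. The
  components of S - Y are then isolated separately. Against the budget of a fifth of its size,
  a bad component costs 1/5 too much if D misses it, but saves 4/5 if D dominates one of its
  vertices.\<close>
lemma bad_count: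
  assumes "bad S" "smaller_bad (card S)" "Y \<subseteq> S" "Y \<noteq> {}" "finite D"
    and one: "\<And>z p q. z \<in> Y - nbhd D \<Longrightarrow> p \<in> S - nbhd D \<Longrightarrow> q \<in> S - nbhd D \<Longrightarrow> adj z p \<Longrightarrow> adj z q \<Longrightarrow> p = q"
  shows "card Y + 4 * card {C \<in> bad_comps (S - Y). C \<inter> nbhd D \<noteq> {}} +
     (\<Sum>C\<in>comps (S - Y) - bad_comps (S - Y). card C mod 5) + 1
     \<le> 5 * card D + card {C \<in> bad_comps (S - Y). C \<inter> nbhd D = {}}"
proof -
  have fS: "finite S" using assms(1) unfolding bad_def by simp
  let ?K = "comps (S - Y)"
  have fK: "finite ?K" using fS comps_finite by simp
  have lt: "card C < card S" if "C \<in> ?K" for C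
    using comps_D(1)[OF that] assms(3,4) fS by (intro psubset_card_mono) auto
  have "5 * iso_num (C - nbhd D) + ((if C \<in> bad_comps (S - Y) then 0 else card C mod 5) +
      (if C \<in> bad_comps (S - Y) \<and> C \<inter> nbhd D \<noteq> {} then 4 else 0))
      \<le> card C + (if C \<in> bad_comps (S - Y) \<and> C \<inter> nbhd D = {} then 1 else 0)" (is "?l C \<le> ?r C") if C: "C \<in> ?K" for C
  proof -
    have fC: "finite C" using comps_D(1)[OF C] fS finite_subset by blast
    show ?thesis
    proof (cases "bad C")
      case True
      then have 49: "card C = 4 \<or> nine C" using assms(2) lt[OF C] unfolding smaller_bad_def by blast
      show ?thesis
      proof (cases "C \<inter> nbhd D = {}")
        case True
        then have "C - nbhd D = C" by auto
        then show ?thesis using True bad_bounds(2)[OF \<open>bad C\<close> 49] C \<open>bad C\<close> by (simp add: bad_comps_def)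
      next
        case False
        then obtain y where y: "y \<in> C" "y \<in> nbhd D" by auto
        then have "iso_num (C - nbhd D) \<le> iso_num (C - {y})" using fC by (intro iso_num_mono) auto
        then show ?thesis using False bad_bounds(1)[OF \<open>bad C\<close> 49 y(1)] C \<open>bad C\<close> by (simp add: bad_comps_def)
      qed
    next
      case False
      \<comment> \<open>A component that is not bad is charged only five times its quotient by 5, so
        the residue \<open>card C mod 5\<close> is saved.\<close>
      have "iso_num (C - nbhd D) \<le> iso_num C" using fC by (intro iso_num_mono) auto
      also have "\<dots> \<le> card C div 5" using good_bound[OF comps_D(2)[OF C] fC False] .
      finally have "5 * iso_num (C - nbhd D) + card C mod 5 \<le> card C"
        by (metis add_le_mono1 mult_div_mod_eq mult_le_mono2)
      then show ?thesis using False by (simp add: bad_comps_def)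
    qed
  qed
  then have sum: "(\<Sum>C\<in>?K. ?l C) \<le> (\<Sum>C\<in>?K. ?r C)" by (rule sum_mono)
  have sub: "bad_comps (S - Y) \<subseteq> ?K" unfolding bad_comps_def by auto
  have 1: "(\<Sum>C\<in>?K. if C \<in> bad_comps (S - Y) then 0 else card C mod 5) = (\<Sum>C\<in>?K - bad_comps (S - Y). card C mod 5)"
    by (rule sum.mono_neutral_cong_right[OF fK]) auto
  have e: "{C \<in> ?K. C \<in> bad_comps (S - Y) \<and> P C} = {C \<in> bad_comps (S - Y). P C}" for P using sub by auto
  have 2: "(\<Sum>C\<in>?K. if C \<in> bad_comps (S - Y) \<and> P C then c else 0) = c * card {C \<in> bad_comps (S - Y). P C}" for P and c :: nat
    using sum.inter_filter[OF fK, of "\<lambda>_. c" "\<lambda>C. C \<in> bad_comps (S - Y) \<and> P C"] unfolding e by (simp add: mult.commute)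
  have "(\<Sum>C\<in>?K. ?l C) = 5 * (\<Sum>C\<in>?K. iso_num (C - nbhd D)) + ((\<Sum>C\<in>?K - bad_comps (S - Y). card C mod 5) +
      4 * card {C \<in> bad_comps (S - Y). C \<inter> nbhd D \<noteq> {}})"
    unfolding sum.distrib 1 2 sum_distrib_left by simp
  moreover have "(\<Sum>C\<in>?K. ?r C) = card (S - Y) + card {C \<in> bad_comps (S - Y). C \<inter> nbhd D = {}}"
    unfolding sum.distrib 2 using comps_card[of "S - Y"] fS by simp
  moreover have "iso_num S \<le> card D + (\<Sum>C\<in>?K. iso_num (C - nbhd D))" by (rule iso_num_comps[OF fS assms(5) one])
  \<comment> \<open>The strict inequality is the source of the \<open>+ 1\<close>.\<close>
  moreover have "card S < 5 * iso_num S" using assms(1) unfolding bad_def by simp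
  moreover have "card (S - Y) + card Y = card S"
    using card_mono[OF fS assms(3)] card_Diff_subset[of Y S] assms(3) finite_subset[OF assms(3) fS] by simp
  ultimately show ?thesis using sum by linarith
qed

text \<open>When the removed set pays for \<open>D\<close>, the remaining deficit of 1 can only be
  carried by a bad component that \<open>D\<close> misses.\<close>

lemma bad_comp_exists:
  assumes "bad S" "smaller_bad (card S)" "Y \<subseteq> S" "finite D" "D \<noteq> {}" "5 * card D \<le> card Y"
    and "\<And>z p q. z \<in> Y - nbhd D \<Longrightarrow> p \<in> S - nbhd D \<Longrightarrow> q \<in> S - nbhd D \<Longrightarrow> adj z p \<Longrightarrow> adj z q \<Longrightarrow> p = q"
  shows "\<exists>C\<in>comps (S - Y). bad C \<and> C \<inter> nbhd D = {}"
proof -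
  have "Y \<noteq> {}" using assms(4-6) by (metis card.empty card_0_eq le_zero_eq mult_is_0 zero_neq_numeral)
  have "card Y + 4 * card {C \<in> bad_comps (S - Y). C \<inter> nbhd D \<noteq> {}} +
     (\<Sum>C\<in>comps (S - Y) - bad_comps (S - Y). card C mod 5) + 1
     \<le> 5 * card D + card {C \<in> bad_comps (S - Y). C \<inter> nbhd D = {}}"
    by (rule bad_count[OF assms(1-3) \<open>Y \<noteq> {}\<close> assms(4)]) (rule assms(7))
  then have "card {C \<in> bad_comps (S - Y). C \<inter> nbhd D = {}} \<noteq> 0" using assms(6) by linarith
  then have "{C \<in> bad_comps (S - Y). C \<inter> nbhd D = {}} \<noteq> {}" by force
  then show ?thesis unfolding bad_comps_def by blast
qed

section \<open>Cut vertices\<close>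

text \<open>A set and its complement have the same crossing edges, so only sets that avoid a fixed
  vertex have to be tested.\<close>

lemma conn_pivot:
  assumes "a \<in> X" and "\<And>A. A \<subseteq> X \<Longrightarrow> A \<noteq> {} \<Longrightarrow> a \<notin> A \<Longrightarrow> \<exists>u\<in>A. \<exists>w\<in>X - A. adj u w"
  shows "conn X"
  unfolding conn_def
proof (intro conjI allI impI)
  show "X \<noteq> {}" using assms(1) by blast
  fix A assume A: "A \<subseteq> X \<and> A \<noteq> {} \<and> A \<noteq> X"
  show "\<exists>u\<in>A. \<exists>w\<in>X - A. adj u w"
  proof (cases "a \<in> A")
    case True
    then obtain u w where "u \<in> X - A" "w \<in> X - (X - A)" "adj u w" using assms(2)[of "X - A"] A by blast
    then show ?thesis using adj_sym by blast
  next
    case False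
    then show ?thesis using assms(2) A by blast
  qed
qed

lemma comps_closed:
  assumes "A \<subseteq> X" "\<And>a b. a \<in> A \<Longrightarrow> b \<in> X - A \<Longrightarrow> \<not> adj a b"
  shows "comps A \<subseteq> comps X"
  using assms unfolding comps_def by blast

lemma bad_fin: "bad S \<Longrightarrow> finite S" and bad_conn: "bad S \<Longrightarrow> conn S"
  unfolding bad_def by auto

lemma bad_card: "bad S \<Longrightarrow> 4 \<le> card S"
  using has_C4_card bad_C4 bad_fin by blast

lemma smaller_bad_D: "smaller_bad n \<Longrightarrow> bad C \<Longrightarrow> card C < n \<Longrightarrow> card C = 4 \<or> nine C"
  unfolding smaller_bad_def by blast

text \<open>By connectedness every component of \<open>S - {x}\<close> is touched by
  \<open>x\<close>. The count with \<open>Y\<close> and \<open>D\<close> both equal to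
  \<open>{x}\<close> reads \<open>1 + 4 * b + r + 1 <= 5\<close>, where b is the number of bad
  components and r the sum of the residues of the others.\<close>

lemma cut_vertex_comps:
  assumes "bad S" "smaller_bad (card S)" "x \<in> S"
  shows "bad_comps (S - {x}) = {}" "(\<Sum>C\<in>comps (S - {x}). card C mod 5) \<le> 3"
proof -
  have touch: "C \<inter> nbhd {x} \<noteq> {}" if C: "C \<in> comps (S - {x})" for C
  proof -
    obtain a b where "a \<in> C" "b \<in> S - C" "adj a b"
      using conn_edge[OF bad_conn[OF assms(1)], of C] comps_D(1,4)[OF C] assms(3) by blast
    moreover from this have "b = x" using comps_D(3)[OF C] by blast
    ultimately show ?thesis using adj_sym by (auto simp: in_nbhd_single)
  qed
  then have e: "{C \<in> bad_comps (S - {x}). C \<inter> nbhd {x} \<noteq> {}} = bad_comps (S - {x})"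
    "{C \<in> bad_comps (S - {x}). C \<inter> nbhd {x} = {}} = {}"
    unfolding bad_comps_def by auto
  have s: "1 + 4 * card (bad_comps (S - {x})) + (\<Sum>C\<in>comps (S - {x}) - bad_comps (S - {x}). card C mod 5) + 1 \<le> 5"
    using bad_count[OF assms(1,2), of "{x}" "{x}"] assms(3) unfolding e by (simp add: in_nbhd_single)
  then have "card (bad_comps (S - {x})) = 0" by simp
  then show b: "bad_comps (S - {x}) = {}" using bad_comps_finite bad_fin[OF assms(1)] by simp
  show "(\<Sum>C\<in>comps (S - {x}). card C mod 5) \<le> 3" using s unfolding b by simp
qed

lemma card_mod_comps:
  assumes "finite A" shows "card A mod 5 \<le> (\<Sum>C\<in>comps A. card C mod 5)"
proof -
  have "card A mod 5 = (\<Sum>C\<in>comps A. card C mod 5) mod 5"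
    unfolding comps_card[OF assms, symmetric] by (simp add: mod_sum_eq)
  then show ?thesis by simp
qed

text \<open>A 4-cycle has no cut vertex, so a surviving cycle stays within one side together with
  \<open>x\<close>.\<close>

lemma iso_num_cut:
  assumes "finite A" "finite B" "\<And>a b. a \<in> A \<Longrightarrow> b \<in> B \<Longrightarrow> \<not> adj a b" "A \<inter> B = {}"
  shows "iso_num (insert x (A \<union> B)) \<le> iso_num (insert x A) + iso_num (insert x B)"
proof -
  obtain D where D: "finite D" "card D = iso_num (insert x A)" "\<not> has_C4 (insert x A - nbhd D)"
    using iso_num_obtain[of "insert x A"] assms by auto
  obtain D' where D': "finite D'" "card D' = iso_num (insert x B)" "\<not> has_C4 (insert x B - nbhd D')"
    using iso_num_obtain[of "insert x B"] assms by auto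
  have "\<not> has_C4 (insert x (A \<union> B) - nbhd (D \<union> D'))"
  proof
    assume "has_C4 (insert x (A \<union> B) - nbhd (D \<union> D'))"
    then obtain a b c d where *: "{a, b, c, d} \<subseteq> insert x (A \<union> B) - nbhd (D \<union> D')" "distinct [a, b, c, d]"
     "adj a b" "adj b c" "adj c d" "adj d a" unfolding has_C4_def by blast
    have sep: "\<not> (p \<in> A \<and> q \<in> B)" if "adj p q \<or> adj q p" for p q using that assms(3) adj_sym by blast
    have m: "a = x \<or> a \<in> A \<or> a \<in> B" "b = x \<or> b \<in> A \<or> b \<in> B" "c = x \<or> c \<in> A \<or> c \<in> B" "d = x \<or> d \<in> A \<or> d \<in> B"
      using *(1) by auto
    have "{a, b, c, d} \<subseteq> insert x A \<or> {a, b, c, d} \<subseteq> insert x B"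
      using m *(2) sep[of a b] sep[of b c] sep[of c d] sep[of d a]
        sep[of b a] sep[of c b] sep[of d c] sep[of a d] *(3-6) by auto
    then have "{a, b, c, d} \<subseteq> insert x A - nbhd D \<or> {a, b, c, d} \<subseteq> insert x B - nbhd D'"
      using *(1) nbhd_Un by auto
    then show False using has_C4I[OF _ *(2-6)] D(3) D'(3) by blast
  qed
  then have "iso_num (insert x (A \<union> B)) \<le> card (D \<union> D')" using iso_num_le D D' by blast
  then show ?thesis using card_Un_le[of D D'] D D' by simp
qed

text \<open>If A together with the cut vertex x is bad, then A has 3 mod 5 vertices; this residue is too
  large once x and a neighbour of x in B are removed.\<close>
lemma no_cut_vertex_aux:
  assumes S: "bad S" "smaller_bad (card S)" and x: "x \<in> S"
    and AB: "A \<union> B = S - {x}" "A \<inter> B = {}" "A \<noteq> {}" "B \<noteq> {}"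
    and no: "\<And>a b. a \<in> A \<Longrightarrow> b \<in> B \<Longrightarrow> \<not> adj a b"
  shows "5 * iso_num (insert x A) \<le> card A" "card A mod 5 \<le> 3"
proof -
  have fS: "finite S" and cS: "conn S" using S unfolding bad_def by auto
  have fA: "finite A" using AB(1) fS finite_subset[of A S] by auto
  have sub: "A \<subseteq> S - {x}" "B \<subseteq> S - {x}" using AB by auto
  have cA: "comps A \<subseteq> comps (S - {x})" by (rule comps_closed) (use AB no in auto)
  have fc: "finite (comps (S - {x}))" using fS comps_finite by simp
  have "card A mod 5 \<le> (\<Sum>C\<in>comps A. card C mod 5)" by (rule card_mod_comps[OF fA])
  also have "\<dots> \<le> (\<Sum>C\<in>comps (S - {x}). card C mod 5)" by (rule sum_mono2[OF fc cA]) simp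
  finally show m3: "card A mod 5 \<le> 3" using cut_vertex_comps(2)[OF S x] by simp
  have conn: "conn (insert x A)"
  proof (rule conn_pivot[of x])
    fix P assume P: "P \<subseteq> insert x A" "P \<noteq> {}" "x \<notin> P"
    then have "P \<subseteq> A" by blast
    obtain a b where ab: "a \<in> P" "b \<in> S - P" "adj a b"
      using conn_edge[OF cS, of P] P x sub \<open>P \<subseteq> A\<close> by blast
    then have "b \<notin> B" using no \<open>P \<subseteq> A\<close> by blast
    then show "\<exists>u\<in>P. \<exists>w\<in>insert x A - P. adj u w" using ab AB(1) by blast
  qed simp
  have cardA: "card (insert x A) = card A + 1" using fA sub by (subst card_insert_disjoint) auto
  have "\<not> bad (insert x A)"
  proof
    assume b: "bad (insert x A)"
    have "card (insert x A) < card S" using sub AB x fS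
      by (intro psubset_card_mono) auto
    then have "card A = 3 \<or> card A = 8" using smaller_bad_D[OF S(2) b] nine_D(2)[of "insert x A"] cardA by auto
    then have A3: "card A mod 5 = 3" by auto
    obtain c b where c: "c \<in> B" "b \<in> S - B" "adj c b"
      using conn_edge[OF cS, of B] AB x by blast
    then have bx: "b = x" using no adj_sym AB by blast
    have cx: "c \<in> nbhd {x}" using c bx adj_sym by (auto simp: in_nbhd_single)
    let ?X = "S - {x, c}"
    \<comment> \<open>A bad component of \<open>?X\<close> that \<open>x\<close> does not touch has
      no outside neighbour but \<open>c\<close>, so it would be a bad component of
      \<open>S - {c}\<close>; the removal of a single vertex leaves none.\<close>
    have untouched: "{C \<in> bad_comps ?X. C \<inter> nbhd {x} = {}} = {}"
    proof (rule ccontr)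
      assume "\<not> ?thesis"
      then obtain C where C: "C \<in> comps ?X" "bad C" "C \<inter> nbhd {x} = {}" unfolding bad_comps_def by auto
      have "\<not> adj a b" if "a \<in> C" "b \<in> S - {c} - C" for a b
      proof
        assume "adj a b"
        then have "b \<noteq> x" using that(1) C(3) adj_sym[of a x] in_nbhd_single[of a x] by blast
        then show False using that comps_D(3)[OF C(1), of a b] \<open>adj a b\<close> by blast
      qed
      then have "C \<in> comps (S - {c})" using comps_D(1,2)[OF C(1)] unfolding comps_def by auto
      then have "C \<in> bad_comps (S - {c})" using C(2) unfolding bad_comps_def by simp
      then show False using cut_vertex_comps(1)[OF S, of c] c AB by auto
    qed
    have cA2: "comps A \<subseteq> comps ?X - bad_comps ?X"
    proof -
      have "comps A \<subseteq> comps ?X" by (rule comps_closed) (use AB no c in auto)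
      moreover have "\<not> bad C" if "C \<in> comps A" for C
        using that cA cut_vertex_comps(1)[OF S x] unfolding bad_comps_def by auto
      ultimately show ?thesis unfolding bad_comps_def by auto
    qed
    have "3 \<le> (\<Sum>C\<in>comps A. card C mod 5)" using card_mod_comps[OF fA] A3 by simp
    also have "\<dots> \<le> (\<Sum>C\<in>comps ?X - bad_comps ?X. card C mod 5)"
      by (rule sum_mono2[OF _ cA2]) (use comps_finite fS in auto)
    finally have 3: "3 \<le> (\<Sum>C\<in>comps ?X - bad_comps ?X. card C mod 5)" .
    have "c \<noteq> x" "c \<in> S" using c sub by auto
    then have "card {x, c} + 4 * card {C \<in> bad_comps ?X. C \<inter> nbhd {x} \<noteq> {}} +
       (\<Sum>C\<in>comps ?X - bad_comps ?X. card C mod 5) + 1 \<le> 5 * card {x} + card {C \<in> bad_comps ?X. C \<inter> nbhd {x} = {}}"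
      using x cx by (intro bad_count[OF S]) (auto simp: in_nbhd_single)
    \<comment> \<open>Two removed vertices, the residue 3 and the \<open>+ 1\<close> add up to 6,
      against a budget of 5.\<close>
    then show False using 3 \<open>c \<noteq> x\<close> unfolding untouched by simp
  qed
  then have "iso_num (insert x A) \<le> card (insert x A) div 5" using good_bound[OF conn] fA by simp
  also have "\<dots> = (card A + 1) div 5" using cardA by simp
  \<comment> \<open>The residue is at most 3, so adding \<open>x\<close> does not reach the next
    multiple of 5.\<close>
  also have "\<dots> = card A div 5" using m3 by presburger
  finally show "5 * iso_num (insert x A) \<le> card A" by simp
qed

text \<open>Each side together with \<open>x\<close> is isolated at a fifth of the side without
  \<open>x\<close>. So \<open>x\<close> comes for free, and the total is at most a fifth of
  \<open>card S - 1\<close>.\<close>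

lemma no_cut_vertex:
  assumes S: "bad S" "smaller_bad (card S)" and x: "x \<in> S"
  shows "conn (S - {x})"
proof (rule ccontr)
  assume "\<not> conn (S - {x})"
  moreover have "S - {x} \<noteq> {}" using bad_card[OF S(1)] by (auto simp: subset_singleton_iff)
  ultimately obtain A where A: "A \<subseteq> S - {x}" "A \<noteq> {}" "A \<noteq> S - {x}"
    "\<And>a b. a \<in> A \<Longrightarrow> b \<in> S - {x} - A \<Longrightarrow> \<not> adj a b"
    unfolding conn_def by blast
  define B where "B = S - {x} - A"
  have AB: "A \<union> B = S - {x}" "A \<inter> B = {}" "B \<noteq> {}" using A B_def by auto
  have no: "\<And>a b. a \<in> A \<Longrightarrow> b \<in> B \<Longrightarrow> \<not> adj a b" using A(4) B_def by auto
  have no': "\<And>a b. a \<in> B \<Longrightarrow> b \<in> A \<Longrightarrow> \<not> adj a b" using no adj_sym by blast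
  have fS: "finite S" using bad_fin[OF S(1)] .
  have fAB: "finite A" "finite B" using AB(1) fS finite_subset[of _ S] by auto
  have a: "5 * iso_num (insert x A) \<le> card A" by (rule no_cut_vertex_aux(1)[OF S x AB(1,2) A(2) AB(3) no])
  have b: "5 * iso_num (insert x B) \<le> card B"
    by (rule no_cut_vertex_aux(1)[OF S x _ _ AB(3) A(2) no']) (use AB in auto)
  have "S = insert x (A \<union> B)" using AB(1) x by auto
  then have "iso_num S \<le> iso_num (insert x A) + iso_num (insert x B)" using iso_num_cut[OF fAB no AB(2), of x] by simp
  then have "5 * iso_num S \<le> card A + card B" using a b by simp
  also have "\<dots> = card (S - {x})" using card_Un_disjoint[OF fAB AB(2)] AB(1) by simp
  also have "\<dots> \<le> card S" using card_mono[OF fS] by auto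
  finally show False using S(1) unfolding bad_def by simp
qed

section \<open>Maximum degree three\<close>

text \<open>There are at most four candidates, so a 4-cycle uses all of them, including
  \<open>y\<close>.\<close>

lemma has_C4_two_nbrs:
  assumes "has_C4 A" "A \<subseteq> insert y E" "finite E" "card E \<le> 3"
  obtains p q where "p \<in> E" "q \<in> E" "p \<noteq> q" "adj y p" "adj y q"
proof -
  have f: "finite A" using assms finite_subset by blast
  have 4: "4 \<le> card A" using has_C4_card[OF assms(1) f] .
  have "card A \<le> card (insert y E)" using card_mono[OF _ assms(2)] assms(3) by simp
  also have "\<dots> \<le> Suc (card E)" by (rule card_insert_le_m1) (use card_insert_le in auto) 
  finally have A4: "card A = 4" using 4 assms(4) by simp
  have "y \<in> A"
  proof (rule ccontr)
    assume "y \<notin> A"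
    then have "A \<subseteq> E" using assms(2) by blast
    from card_mono[OF assms(3) this] show False using A4 assms(4) by simp
  qed
  then obtain p q z where "A = {y, p, q, z}" "distinct [y, p, q, z]" "adj y p" "adj y q"
    using has_C4_opposite[OF assms(1) A4] by metis
  then show ?thesis using that[of p q] assms(2) by auto
qed

lemma card3: "finite {p, q, r}" "card {p, q, r} \<le> 3"
  by (simp_all add: card_insert_if)

lemma nbrs_eq: "X \<subseteq> nbrs S a \<Longrightarrow> finite S \<Longrightarrow> deg S a \<le> card X \<Longrightarrow> nbrs S a = X"
  using card_seteq[of "nbrs S a" X] unfolding nbrs_def by auto

lemma nbrs_finite: "finite S \<Longrightarrow> finite (nbrs S a)"
  unfolding nbrs_def by auto

lemma nbrs_mono: "A \<subseteq> B \<Longrightarrow> nbrs A v \<subseteq> nbrs B v"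
  unfolding nbrs_def by auto

lemma deg_mono: "A \<subseteq> B \<Longrightarrow> finite B \<Longrightarrow> deg A v \<le> deg B v"
  by (rule card_mono[OF nbrs_finite nbrs_mono])

text \<open>The first removal yields a bad component \<open>H\<close> of order 4. The second one
  removes \<open>H\<close> with a vertex \<open>u\<close> attached to it and leaves a connected
  rest, which therefore has order 4 as well. Then \<open>S\<close> has nine vertices and is isolated
  by \<open>u\<close> alone.\<close>

lemma subcubic:
  assumes S: "bad S" "smaller_bad (card S)" and deg: "\<And>u. u \<in> S \<Longrightarrow> deg S u \<le> 3"
  shows "card S = 4"
proof (rule ccontr)
  assume n4: "card S \<noteq> 4"
  have fS: "finite S" and cS: "conn S" using S unfolding bad_def by auto
  have no9: "\<not> nine C" if "C \<subseteq> S" for C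
  proof
    assume 9: "nine C"
    obtain y where "y \<in> C" using nine_D(2)[OF 9] by fastforce
    then obtain v where "v \<in> C" "deg C v = 4" using nine_D(5)[OF 9] by blast
    then show False using deg[of v] deg_mono[OF that fS, of v] that by auto
  qed
  \<comment> \<open>In degree 3, two known neighbours leave room for one more; this supplies the
    condition on undominated vertices.\<close>
  have le1: "p = q" if "{f, g, p, q} \<subseteq> nbrs S e" "e \<in> S" "f \<noteq> g" "p \<notin> {f, g}" "q \<notin> {f, g}" for e f g p q
  proof (rule ccontr)
    assume "p \<noteq> q"
    then have "card {f, g, p, q} = 4" using that by auto
    then show False using card_mono[OF nbrs_finite[OF fS] that(1)] deg[OF that(2)] by simp
  qed
  obtain a0 b0 c0 d0 where q0: "{a0, b0, c0, d0} \<subseteq> S" "distinct [a0, b0, c0, d0]"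
     "adj a0 b0" "adj b0 c0" "adj c0 d0" "adj d0 a0"
    using bad_C4[OF S(1)] unfolding has_C4_def by blast
  have "{a0, b0, c0, d0} \<noteq> S" using n4 q0(2) by auto
  then obtain e a' where e: "e \<in> {a0, b0, c0, d0}" "a' \<in> S - {a0, b0, c0, d0}" "adj e a'"
    using conn_edge[OF cS q0(1)] by blast
  obtain a b c d where Q: "{a, b, c, d} \<subseteq> S" "distinct [a, b, c, d]"
     "adj a b" "adj b c" "adj c d" "adj d a" and a': "a' \<in> S" "a' \<notin> {a, b, c, d}" "adj a a'"
  proof -
    consider "e = a0" | "e = b0" | "e = c0" | "e = d0" using e by blast
    then show ?thesis
    proof cases
      case 1 show ?thesis by (rule that[of a0 b0 c0 d0]) (use q0 e 1 in auto)
    next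
      case 2 show ?thesis by (rule that[of b0 c0 d0 a0]) (use q0 e 2 in auto)
    next
      case 3 show ?thesis by (rule that[of c0 d0 a0 b0]) (use q0 e 3 in auto)
    next
      case 4 show ?thesis by (rule that[of d0 a0 b0 c0]) (use q0 e 4 in auto)
    qed
  qed
  have Na: "nbrs S a = {b, d, a'}"
    by (rule nbrs_eq) (use Q a' fS deg[of a] adj_sym in \<open>auto simp: nbrs_def\<close>)
  let ?Y = "{a, b, c, d, a'}"
  have YS: "?Y \<subseteq> S" using Q a' by auto
  have nba: "a \<in> nbhd {a}" "b \<in> nbhd {a}" "d \<in> nbhd {a}" "a' \<in> nbhd {a}"
    using Q a' adj_sym by (auto simp: in_nbhd_single)
  have "card ?Y = 5" using Q a' by auto
  \<comment> \<open>Only \<open>c\<close> may be undominated in \<open>?Y\<close>, and its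
    neighbours \<open>b\<close> and \<open>d\<close> are dominated.\<close>
  then have "\<exists>H\<in>comps (S - ?Y). bad H \<and> H \<inter> nbhd {a} = {}"
  proof (intro bad_comp_exists[OF S YS, of "{a}"])
    fix z p q assume *: "z \<in> ?Y - nbhd {a}" "p \<in> S - nbhd {a}" "q \<in> S - nbhd {a}" "adj z p" "adj z q"
    then have "z = c" using nba by auto
    then have "{b, d, p, q} \<subseteq> nbrs S c" using * Q adj_sym unfolding nbrs_def by auto
    then show "p = q" by (rule le1) (use Q * nba in auto)
  qed auto
  then obtain H where H: "H \<in> comps (S - ?Y)" "bad H" by blast
  have HS: "H \<subseteq> S" "H \<inter> ?Y = {}" using comps_D(1)[OF H(1)] by auto
  have "card H < card S" using HS YS fS by (intro psubset_card_mono) auto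
  then have H4: "card H = 4" using smaller_bad_D[OF S(2) H(2)] no9[OF HS(1)] by blast
  \<comment> \<open>\<open>a'\<close> is no cut vertex, so \<open>H\<close> is attached to
    \<open>?Y\<close> at some other vertex. That vertex is not \<open>a\<close>, whose neighbours
    all lie in \<open>?Y\<close>.\<close>
  have "H \<subseteq> S - {a'}" "H \<noteq> S - {a'}" using HS Q(1) a'(2) by auto
  then obtain h u where h: "h \<in> H" "u \<in> S - {a'} - H" "adj h u"
    using conn_edge[OF no_cut_vertex[OF S a'(1)], of H] comps_D(4)[OF H(1)] by blast
  have uY: "u \<in> ?Y" using comps_D(3)[OF H(1) h(1), of u] h by blast
  have "u \<noteq> a"
  proof
    assume "u = a"
    then have "h \<in> nbrs S a" using h HS adj_sym unfolding nbrs_def by auto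
    then show False using Na h HS by auto
  qed
  then have u: "u \<in> {b, c, d}" using uY h by auto
  obtain p q z where pqz: "H = {h, p, q, z}" "distinct [h, p, q, z]" "adj h p" "adj h q" "adj z p" "adj z q"
    using has_C4_opposite[OF bad_C4[OF H(2)] H4 h(1)] by metis
  let ?Y' = "insert u H"
  have nbh: "h \<in> nbhd {h}" "p \<in> nbhd {h}" "q \<in> nbhd {h}" "u \<in> nbhd {h}"
    using pqz h by (auto simp: in_nbhd_single)
  have "card ?Y' = 5" using H4 h HS finite_subset[OF HS(1) fS] by auto
  then have "\<exists>K\<in>comps (S - ?Y'). bad K \<and> K \<inter> nbhd {h} = {}"
  proof (intro bad_comp_exists[OF S, of ?Y' "{h}"])
    fix z' p' q' assume *: "z' \<in> ?Y' - nbhd {h}" "p' \<in> S - nbhd {h}" "q' \<in> S - nbhd {h}" "adj z' p'" "adj z' q'"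
    then have z: "z' = z" using nbh pqz by auto
    then have "{p, q, p', q'} \<subseteq> nbrs S z" using * pqz HS unfolding nbrs_def by auto
    then show "p' = q'" by (rule le1) (use pqz HS * nbh in auto)
  qed (use h HS in auto)
  then obtain K where K: "K \<in> comps (S - ?Y')" "bad K" by blast
  have aX: "a \<in> S - ?Y'" using u Q HS by auto
  \<comment> \<open>What remains of \<open>?Y\<close> hangs together with \<open>a\<close>: the
    vertex \<open>c\<close>, unless removed itself, is reached through \<open>b\<close> or
    \<open>d\<close>. A set cut off from \<open>a\<close> would have an edge into \<open>H\<close>,
    because \<open>u\<close> is no cut vertex; but \<open>H\<close> has no neighbours outside
    \<open>?Y\<close>.\<close>
  have conn: "conn (S - ?Y')"
  proof (rule conn_pivot[OF aX])
    fix P assume P: "P \<subseteq> S - ?Y'" "P \<noteq> {}" "a \<notin> P"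
    show "\<exists>s\<in>P. \<exists>t\<in>S - ?Y' - P. adj s t"
    proof (rule ccontr)
      assume "\<not> ?thesis"
      then have cl: "t \<in> P" if "s \<in> P" "t \<in> S - ?Y'" "adj s t \<or> adj t s" for s t using that adj_sym by blast
      have out: "t \<notin> P" if "s \<notin> P" "s \<in> S - ?Y'" "adj s t \<or> adj t s" for s t using that cl by blast
      have "b \<notin> P" "d \<notin> P" "a' \<notin> P" using out[OF P(3) aX] Q a' by auto
      moreover have "c \<notin> P"
      proof (cases "u = b")
        case True
        then have "d \<in> S - ?Y'" using Q HS by auto
        then show ?thesis using out[OF \<open>d \<notin> P\<close>] Q by blast
      next
        case False
        then have "b \<in> S - ?Y'" using Q HS by auto
        then show ?thesis using out[OF \<open>b \<notin> P\<close>] Q by blast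
      qed
      ultimately have PY: "P \<subseteq> S - ?Y" using P by auto
      have uS: "u \<in> S" using h by blast
      obtain s t where st: "s \<in> P" "t \<in> S - {u} - P" "adj s t"
        using conn_edge[OF no_cut_vertex[OF S uS], of P] P aX by blast
      have "t \<in> H" using cl[of s t] st by blast
      then have "s \<in> H" using comps_D(3)[OF H(1), of t s] st PY adj_sym by blast
      then show False using st P by blast
    qed
  qed
  have KS: "K = S - ?Y'" using comps_conn[OF conn K(1)] .
  have "card K < card S" using KS h fS by (intro psubset_card_mono) auto
  then have K4: "card K = 4" using smaller_bad_D[OF S(2) K(2)] no9[of K] KS by auto
  \<comment> \<open>The 4-cycle rotated to start at \<open>u\<close>; \<open>e\<close> is opposite
    to \<open>u\<close>.\<close>
  obtain e f g where efg: "{a, b, c, d} = {u, e, f, g}" "distinct [u, e, f, g]" "adj e f" "adj e g" "adj u f" "adj u g"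
  proof -
    consider "u = b" | "u = c" | "u = d" using u by blast
    then show ?thesis
    proof cases
      case 1 show ?thesis by (rule that[of d a c]) (use Q 1 adj_sym in auto)
    next
      case 2 show ?thesis by (rule that[of a b d]) (use Q 2 adj_sym in auto)
    next
      case 3 show ?thesis by (rule that[of b a c]) (use Q 3 adj_sym in auto)
    qed
  qed
  have Y: "?Y = {u, e, f, g, a'}" using efg(1) by auto
  have a'n: "a' \<notin> {u, e, f, g}" using a'(2) unfolding efg(1) .
  have "{e, f, g, a'} \<subseteq> K" using KS Y YS HS efg(2) a'n by auto
  moreover have "card {e, f, g, a'} = 4" using efg(2) a'n by auto
  moreover have "finite K" using bad_fin[OF K(2)] .
  ultimately have Keq: "K = {e, f, g, a'}" using K4 card_seteq[of K "{e, f, g, a'}"] by simp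
  have Seq: "S = {u, e, f, g, a'} \<union> H" using KS Keq h HS by auto
  obtain k1 k2 where k: "k1 \<in> {e, f, g}" "k2 \<in> {e, f, g}" "k1 \<noteq> k2" "adj a' k1" "adj a' k2"
  proof -
    have "K \<subseteq> insert a' {e, f, g}" using Keq by auto
    from has_C4_two_nbrs[OF bad_C4[OF K(2)] this card3] show ?thesis using that by blast
  qed
  \<comment> \<open>At most \<open>e\<close>, \<open>a'\<close>, \<open>p\<close>, \<open>q\<close>,
    \<open>z\<close> survive. The neighbours \<open>f\<close> and \<open>g\<close> of
    \<open>e\<close> are dominated, so \<open>e\<close> drops out. A cycle on the other four would
    give \<open>a'\<close> two neighbours in \<open>H\<close> in addition to \<open>k1\<close> and
    \<open>k2\<close>.\<close>
  have "\<not> has_C4 (S - nbhd {u})"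
  proof
    assume c: "has_C4 (S - nbhd {u})"
    have nbu: "u \<in> nbhd {u}" "f \<in> nbhd {u}" "g \<in> nbhd {u}" "h \<in> nbhd {u}"
      using efg h adj_sym by (auto simp: in_nbhd_single)
    have c': "has_C4 (S - nbhd {u} - {e})"
    proof (rule has_C4_drop[OF c])
      fix e' s t assume "e' \<in> {e}" and *: "s \<in> S - nbhd {u}" "t \<in> S - nbhd {u}" "adj e' s" "adj e' t"
      then have e: "e' = e" by simp
      then have "{f, g, s, t} \<subseteq> nbrs S e" using * efg Seq unfolding nbrs_def by auto
      then show "s = t" by (rule le1) (use efg Seq * e nbu in auto)
    qed
    have "S - nbhd {u} - {e} \<subseteq> insert a' {p, q, z}" using Seq pqz(1) nbu by auto
    from has_C4_two_nbrs[OF c' this card3] obtain h1 h2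
      where hh: "h1 \<in> {p, q, z}" "h2 \<in> {p, q, z}" "h1 \<noteq> h2" "adj a' h1" "adj a' h2" .
    then have "{k1, k2, h1, h2} \<subseteq> nbrs S a'" using k Seq pqz(1) unfolding nbrs_def by auto
    then have "h1 = h2"
      by (rule le1) (use k hh a' pqz HS Y in auto)
    then show False using hh by simp
  qed
  then have "iso_num S \<le> 1" using iso_num_le[of "{u}" S] by simp
  moreover have "card S = 9"
  proof -
    have "{u, e, f, g, a'} \<inter> H = {}" using HS(2) Y by auto
    then have "card S = card {u, e, f, g, a'} + card H"
      unfolding Seq using bad_fin[OF H(2)] by (intro card_Un_disjoint) auto
    then show ?thesis using H4 efg(2) a'n by auto
  qed
  ultimately show False using S(1) unfolding bad_def by simp
qed

section \<open>Maximum degree at least four\<close>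

definition max_deg :: "'a set \<Rightarrow> 'a \<Rightarrow> bool" where
  "max_deg S v \<longleftrightarrow> bad S \<and> smaller_bad (card S) \<and> v \<in> S \<and> (\<forall>u\<in>S. deg S u \<le> deg S v) \<and> 4 \<le> deg S v"

definition links :: "'a set \<Rightarrow> 'a \<Rightarrow> 'a set \<Rightarrow> 'a set" where
  "links S v C = {x \<in> nbrs S v. \<exists>h\<in>C. adj x h}"

lemma max_deg_D: assumes "max_deg S v"
  shows "bad S" "smaller_bad (card S)" "v \<in> S" "u \<in> S \<Longrightarrow> deg S u \<le> deg S v" "4 \<le> deg S v" "finite S"
  using assms unfolding max_deg_def bad_def by auto

lemma comp_nbhd_D:
  assumes "C \<in> comps (S - nbhd {v})"
  shows "C \<subseteq> S" "v \<notin> C" "C \<inter> nbrs S v = {}"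
    "h \<in> C \<Longrightarrow> s \<in> S \<Longrightarrow> adj h s \<Longrightarrow> s \<notin> C \<Longrightarrow> s \<in> nbrs S v"
proof -
  show *: "C \<subseteq> S" "v \<notin> C" "C \<inter> nbrs S v = {}"
    using comps_D(1)[OF assms] unfolding diff_nbhd by auto
  assume h: "h \<in> C" "s \<in> S" "adj h s" "s \<notin> C"
  then have "s \<notin> S - nbhd {v}" using comps_D(3)[OF assms] by blast
  moreover have "s \<noteq> v"
  proof
    assume "s = v"
    then have "h \<in> nbrs S v" using h * adj_sym unfolding nbrs_def by auto
    then show False using * h by auto
  qed
  ultimately show "s \<in> nbrs S v" using h unfolding nbrs_def by (auto simp: in_nbhd_single)
qed

text \<open>A neighbour of \<open>C\<close> outside \<open>C\<close> is always a neighbour of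
  \<open>v\<close>. If \<open>x\<close> is outside \<open>C\<close>, another one exists because
  \<open>x\<close> is no cut vertex; if \<open>x\<close> is in \<open>C\<close>, any link differs
  from it.\<close>

lemma linked:
  assumes "max_deg S v" "C \<in> comps (S - nbhd {v})" "x \<in> S" "x \<noteq> v"
  shows "\<exists>x'\<in>links S v C. x' \<noteq> x"
proof (cases "x \<in> C")
  case True
  have "C \<noteq> S" using comp_nbhd_D(2)[OF assms(2)] max_deg_D(3)[OF assms(1)] by blast
  then obtain h s where "h \<in> C" "s \<in> S - C" "adj h s"
    using conn_edge[OF bad_conn[OF max_deg_D(1)[OF assms(1)]] comp_nbhd_D(1)[OF assms(2)]]
      comps_D(4)[OF assms(2)] by blast
  then have "s \<in> links S v C" "s \<noteq> x" using comp_nbhd_D(4)[OF assms(2), of h s] True adj_sym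
    unfolding links_def by auto
  then show ?thesis by blast
next
  case False
  then have "C \<subseteq> S - {x}" using comp_nbhd_D(1)[OF assms(2)] by blast
  moreover have "C \<noteq> S - {x}" using comp_nbhd_D(2)[OF assms(2)] max_deg_D(3)[OF assms(1)] assms(4) by blast
  ultimately obtain h s where "h \<in> C" "s \<in> S - {x} - C" "adj h s"
    using conn_edge[OF no_cut_vertex[OF max_deg_D(1,2)[OF assms(1)] assms(3)], of C]
      comps_D(4)[OF assms(2)] by blast
  then have "s \<in> links S v C" "s \<noteq> x" using comp_nbhd_D(4)[OF assms(2), of h s] adj_sym
    unfolding links_def by auto
  then show ?thesis by blast
qed

text \<open>With k the degree of \<open>v\<close> and b the number of bad components, removing the
  closed neighbourhood and dominating with \<open>v\<close> gives
  \<open>k + 1 + 1 <= 5 + b\<close>.\<close>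

lemma deg_le_bad_comps:
  assumes t: "max_deg S v" shows "deg S v \<le> card (bad_comps (S - nbhd {v})) + 3"
proof -
  have e: "S - S \<inter> nbhd {v} = S - nbhd {v}" by auto
  have "{C \<in> bad_comps (S - nbhd {v}). C \<inter> nbhd {v} \<noteq> {}} = {}" "{C \<in> bad_comps (S - nbhd {v}). C \<inter> nbhd {v} = {}} = bad_comps (S - nbhd {v})"
    using comps_D(1) unfolding bad_comps_def by fastforce+
  moreover have "card (S \<inter> nbhd {v}) + 4 * card {C \<in> bad_comps (S - S \<inter> nbhd {v}). C \<inter> nbhd {v} \<noteq> {}} +
     (\<Sum>C\<in>comps (S - S \<inter> nbhd {v}) - bad_comps (S - S \<inter> nbhd {v}). card C mod 5) + 1
     \<le> 5 * card {v} + card {C \<in> bad_comps (S - S \<inter> nbhd {v}). C \<inter> nbhd {v} = {}}"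
    by (rule bad_count[OF max_deg_D(1,2)[OF t]]) (use max_deg_D(3)[OF t] in \<open>auto simp: in_nbhd_single\<close>)
  ultimately show ?thesis using card_nbhd[OF max_deg_D(6,3)[OF t]] unfolding e by simp
qed

text \<open>Adding \<open>X\<close> to \<open>v\<close> touches exactly the bad components linked to
  \<open>X\<close>. Each of them turns a loss of 1 into a saving of 4, whence the factor 5.\<close>

lemma cover_bad_comps:
  assumes t: "max_deg S v" and X: "X \<subseteq> nbrs S v"
  shows "deg S v + 2 + 5 * card {C \<in> bad_comps (S - nbhd {v}). X \<inter> links S v C \<noteq> {}}
    \<le> 5 + 5 * card X + card (bad_comps (S - nbhd {v}))"
proof -
  let ?B = "bad_comps (S - nbhd {v})" and ?D = "insert v X"
  have fX: "finite X" using finite_subset[OF X nbrs_finite[OF max_deg_D(6)[OF t]]] .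
  have fB: "finite ?B" using bad_comps_finite max_deg_D(6)[OF t] by simp
  have e: "S - S \<inter> nbhd {v} = S - nbhd {v}" by auto
  have touch: "C \<inter> nbhd ?D \<noteq> {} \<longleftrightarrow> X \<inter> links S v C \<noteq> {}" if "C \<in> ?B" for C
  proof -
    note C = bad_comps_comps[OF that]
    have "C \<inter> nbhd ?D = C \<inter> nbhd X" using comps_D(1)[OF C] nbhd_insert[of v X] by auto
    also have "\<dots> = {h \<in> C. \<exists>x\<in>X. adj x h}" using comp_nbhd_D(3)[OF C] X unfolding nbhd_def by auto
    finally show ?thesis using X unfolding links_def by auto
  qed
  then have 1: "{C \<in> ?B. C \<inter> nbhd ?D \<noteq> {}} = {C \<in> ?B. X \<inter> links S v C \<noteq> {}}" by auto
  have "card ?B = card ({C \<in> ?B. C \<inter> nbhd ?D \<noteq> {}} \<union> {C \<in> ?B. C \<inter> nbhd ?D = {}})"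
    by (rule arg_cong[of _ _ card]) auto
  also have "\<dots> = card {C \<in> ?B. C \<inter> nbhd ?D \<noteq> {}} + card {C \<in> ?B. C \<inter> nbhd ?D = {}}"
    using fB by (intro card_Un_disjoint) auto
  finally have 2: "card ?B = card {C \<in> ?B. C \<inter> nbhd ?D \<noteq> {}} + card {C \<in> ?B. C \<inter> nbhd ?D = {}}" .
  have "card (S \<inter> nbhd {v}) + 4 * card {C \<in> bad_comps (S - S \<inter> nbhd {v}). C \<inter> nbhd ?D \<noteq> {}} +
     (\<Sum>C\<in>comps (S - S \<inter> nbhd {v}) - bad_comps (S - S \<inter> nbhd {v}). card C mod 5) + 1
     \<le> 5 * card ?D + card {C \<in> bad_comps (S - S \<inter> nbhd {v}). C \<inter> nbhd ?D = {}}"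
    by (rule bad_count[OF max_deg_D(1,2)[OF t]]) (use max_deg_D(3)[OF t] fX nbhd_insert[of v X] in \<open>auto simp: in_nbhd_single\<close>)
  moreover have "card ?D \<le> Suc (card X)" by (rule card_insert_le_m1) simp_all
  ultimately show ?thesis using card_nbhd[OF max_deg_D(6,3)[OF t]] 1 2 unfolding e by simp
qed

text \<open>Let k be the degree of \<open>v\<close> and b the number of bad components. The
  neighbours of \<open>v\<close> other than \<open>x\<close> still touch all bad components, which
  gives \<open>b <= k - 1\<close>. If \<open>x\<close> alone touches m of them, then
  \<open>5 * m <= 8 + b - k <= 7\<close>, so m is at most 1.\<close>

lemma links_unique:
  assumes t: "max_deg S v" and C: "C1 \<in> bad_comps (S - nbhd {v})" "C2 \<in> bad_comps (S - nbhd {v})"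
    and x: "x \<in> links S v C1" "x \<in> links S v C2"
  shows "C1 = C2"
proof (rule ccontr)
  assume ne: "C1 \<noteq> C2"
  let ?B = "bad_comps (S - nbhd {v})"
  have fB: "finite ?B" using bad_comps_finite max_deg_D(6)[OF t] by simp
  have xN: "x \<in> nbrs S v" using x unfolding links_def by simp
  then have xS: "x \<in> S" "x \<noteq> v" using adj_irrefl unfolding nbrs_def by auto
  have "{C \<in> ?B. (nbrs S v - {x}) \<inter> links S v C \<noteq> {}} = ?B"
    using linked[OF t bad_comps_comps xS] unfolding links_def by fastforce
  then have "deg S v + 2 + 5 * card ?B \<le> 5 + 5 * card (nbrs S v - {x}) + card ?B"
    using cover_bad_comps[OF t, of "nbrs S v - {x}"] by simp
  moreover have "card (nbrs S v - {x}) = deg S v - 1" using xN by simp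
  moreover have "deg S v + 2 + 5 * card {C \<in> ?B. {x} \<inter> links S v C \<noteq> {}} \<le> 5 + 5 * card {x} + card ?B"
    using cover_bad_comps[OF t, of "{x}"] xN by simp
  moreover have "card {C1, C2} \<le> card {C \<in> ?B. {x} \<inter> links S v C \<noteq> {}}"
    using fB C x by (intro card_mono) auto
  moreover have "card {C1, C2} = 2" using ne by simp
  moreover have "4 \<le> deg S v" using max_deg_D(5)[OF t] .
  ultimately show False by simp
qed

text \<open>The link sets of the bad components are disjoint subsets of the neighbours of
  \<open>v\<close>, and each has at least two elements.\<close>

lemma card_links:
  assumes t: "max_deg S v" and H: "H \<in> bad_comps (S - nbhd {v})"
  shows "card (links S v H) + 2 * card (bad_comps (S - nbhd {v})) \<le> deg S v + 2"
proof -
  let ?B = "bad_comps (S - nbhd {v})"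
  have fB: "finite ?B" using bad_comps_finite max_deg_D(6)[OF t] by simp
  have fN: "finite (nbrs S v)" using nbrs_finite[OF max_deg_D(6)[OF t]] .
  have fL: "finite (links S v C)" for C using fN unfolding links_def by simp
  have two: "2 \<le> card (links S v C)" if C: "C \<in> ?B" for C
  proof -
    have "nbrs S v \<noteq> {}" using max_deg_D(5)[OF t] by auto
    then obtain x0 where "x0 \<in> S" "x0 \<noteq> v" using adj_irrefl unfolding nbrs_def by blast
    then obtain x1 where x1: "x1 \<in> links S v C" using linked[OF t bad_comps_comps[OF C]] by blast
    then have "x1 \<in> S" "x1 \<noteq> v" using adj_irrefl unfolding links_def nbrs_def by auto
    then obtain x2 where x2: "x2 \<in> links S v C" "x2 \<noteq> x1" using linked[OF t bad_comps_comps[OF C]] by blast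
    have "card {x1, x2} \<le> card (links S v C)" using fL x1 x2 by (intro card_mono) auto
    then show ?thesis using x2 by simp
  qed
  have "(\<Sum>C\<in>?B. card (links S v C)) = card (\<Union>C\<in>?B. links S v C)"
    using fB fL links_unique[OF t] by (subst card_UN_disjoint) auto
  also have "\<dots> \<le> deg S v" using fN by (intro card_mono) (auto simp: links_def)
  finally have "(\<Sum>C\<in>?B. card (links S v C)) \<le> deg S v" .
  moreover have "(\<Sum>C\<in>?B. card (links S v C)) = card (links S v H) + (\<Sum>C\<in>?B - {H}. card (links S v C))"
    using fB H by (simp add: sum.remove)
  moreover have "(\<Sum>C\<in>?B - {H}. 2) \<le> (\<Sum>C\<in>?B - {H}. card (links S v C))"
    by (rule sum_mono) (use two in auto)
  moreover have "card ?B = Suc (card (?B - {H}))" using fB H by (metis card.remove)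
  ultimately show ?thesis by simp
qed

lemma other_bad_comp:
  assumes "max_deg S v" "H \<in> bad_comps (S - nbhd {v})" "5 \<le> deg S v"
  obtains H2 where "H2 \<in> bad_comps (S - nbhd {v})" "H2 \<noteq> H"
proof -
  have "\<not> bad_comps (S - nbhd {v}) \<subseteq> {H}"
  proof
    assume "bad_comps (S - nbhd {v}) \<subseteq> {H}"
    then have "card (bad_comps (S - nbhd {v})) \<le> 1" using card_mono[of "{H}"] by fastforce
    then show False using deg_le_bad_comps[OF assms(1)] assms(3) by simp
  qed
  then show ?thesis using that by blast
qed

section \<open>Bad components of order 4\<close>

lemma conn_remove_comp:
  assumes t: "max_deg S v" and H: "H \<in> comps (S - nbhd {v})" and x: "x \<in> nbrs S v"
  shows "conn (S - insert x H)"
proof -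
  have xS: "x \<in> S" "x \<noteq> v" using x adj_irrefl unfolding nbrs_def by auto
  have vX: "v \<in> S - insert x H" using comp_nbhd_D(2)[OF H] xS max_deg_D(3)[OF t] by blast
  show ?thesis
  proof (rule conn_pivot[OF vX], rule ccontr)
    fix P assume P: "P \<subseteq> S - insert x H" "P \<noteq> {}" "v \<notin> P"
      and no: "\<not> (\<exists>u\<in>P. \<exists>w\<in>S - insert x H - P. adj u w)"
    have PN: "P \<inter> nbhd {v} = {}"
    proof (rule ccontr)
      assume "P \<inter> nbhd {v} \<noteq> {}"
      then obtain u where "u \<in> P" "adj v u" using P(3) by (auto simp: in_nbhd_single)
      then show False using no vX P(3) adj_sym[of v u] by blast
    qed
    \<comment> \<open>Since \<open>x\<close> is no cut vertex, the part cut off from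
      \<open>v\<close> would have an edge into \<open>H\<close>; but it avoids the closed
      neighbourhood of \<open>v\<close>, where \<open>H\<close> is a full component.\<close>
    have "P \<subseteq> S - {x}" "P \<noteq> S - {x}" using P vX by auto
    then obtain s u where su: "s \<in> P" "u \<in> S - {x} - P" "adj s u"
      using conn_edge[OF no_cut_vertex[OF max_deg_D(1,2)[OF t] xS(1)]] P(2) by blast
    then have "u \<in> H" using no by blast
    then have "s \<in> H" using comps_D(3)[OF H, of u s] su P(1) PN adj_sym by blast
    then show False using P su by blast
  qed
qed

text \<open>\<open>insert x H\<close> has five vertices and is handled by \<open>y\<close> alone, so
  the connected rest \<open>?K\<close> is bad. If \<open>?K\<close> has order 9, then either a
  second link \<open>x'\<close> of \<open>H\<close> gets a larger degree than \<open>v\<close>, or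
  two vertices isolate the 14 vertices of \<open>S\<close>.\<close>

lemma four_comp_link:
  assumes t: "max_deg S v" and H: "H \<in> bad_comps (S - nbhd {v})" "card H = 4"
    and y: "y \<in> H" "x \<in> nbrs S v" "adj x y"
    and one: "\<And>z p q. z \<in> insert x H - nbhd {y} \<Longrightarrow> p \<in> S - nbhd {y} \<Longrightarrow> q \<in> S - nbhd {y} \<Longrightarrow> adj z p \<Longrightarrow> adj z q \<Longrightarrow> p = q"
  shows "card S = 9"
proof (rule ccontr)
  assume n9: "card S \<noteq> 9"
  note Hc = bad_comps_comps[OF H(1)] and S = max_deg_D(1,2)[OF t]
  have fS: "finite S" using max_deg_D(6)[OF t] .
  have HS: "H \<subseteq> S" "H \<inter> nbrs S v = {}" "v \<notin> H" using comp_nbhd_D[OF Hc] by auto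
  have fH: "finite H" using bad_fin[OF bad_comps_bad[OF H(1)]] .
  have xS: "x \<in> S" "x \<notin> H" "x \<noteq> v" using y HS adj_irrefl unfolding nbrs_def by auto
  have c5: "card (insert x H) = 5" using H fH xS by simp
  let ?K = "S - insert x H"
  have "\<exists>C\<in>comps ?K. bad C \<and> C \<inter> nbhd {y} = {}"
    by (rule bad_comp_exists[OF S]) (use HS xS c5 one in auto)
  then have bK: "bad ?K" using comps_conn[OF conn_remove_comp[OF t Hc y(2)]] by blast
  have cK: "card ?K + 5 = card S"
    using card_Diff_subset[of "insert x H" S] fH HS xS c5 card_mono[OF fS, of "insert x H"] by simp
  then have K9: "nine ?K" using smaller_bad_D[OF S(2) bK] n9 by linarith
  obtain x' where x': "x' \<in> links S v H" "x' \<noteq> x" using linked[OF t Hc xS(1,3)] by blast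
  then obtain h where h: "h \<in> H" "adj x' h" and x'N: "x' \<in> nbrs S v" unfolding links_def by blast
  have x'S: "x' \<in> S" "adj v x'" using x'N unfolding nbrs_def by auto
  have K: "v \<in> ?K" "x' \<in> ?K" using HS xS x' x'N x'S max_deg_D(3)[OF t] by auto
  have "nbrs ?K v = nbrs S v - {x}" using HS(2) unfolding nbrs_def by auto
  then have k: "deg ?K v = deg S v - 1" using y(2) by simp
  have *: "deg ?K v = 3 \<Longrightarrow> deg ?K x' = 4"
    "deg ?K v = 4 \<Longrightarrow> nbrs ?K x' \<subseteq> nbhd {v} \<Longrightarrow> deg ?K x' = 4 \<and> (\<exists>w\<in>?K. \<forall>s\<in>?K - {v, x'} - nbhd {w}.
          (\<exists>u\<in>?K. adj s u \<and> u \<notin> nbhd {v}) \<and> (\<forall>t\<in>?K - {v, x'} - nbhd {w}. \<not> adj s t))"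
    using K9 K x'S unfolding nine_def by blast+
  have "3 \<le> deg ?K v" "deg ?K v \<le> 4" using nine_D(3,4)[OF K9 K(1)] by auto
  then consider "deg ?K v = 3" | "deg ?K v = 4" by linarith
  then show False
  proof cases
    \<comment> \<open>Here \<open>v\<close> has degree 4 in \<open>S\<close>, while
      \<open>x'\<close> has four neighbours in \<open>?K\<close> and one more in
      \<open>H\<close>.\<close>
    case 1
    have "insert h (nbrs ?K x') \<subseteq> nbrs S x'" using h HS unfolding nbrs_def by auto
    then have "card (insert h (nbrs ?K x')) \<le> deg S x'" by (rule card_mono[OF nbrs_finite[OF fS]])
    moreover have "h \<notin> nbrs ?K x'" "finite (nbrs ?K x')" using h fS unfolding nbrs_def by auto
    ultimately have "5 \<le> deg S x'" using *(1)[OF 1] by simp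
    then show False using max_deg_D(4)[OF t x'S(1)] k 1 by linarith
  next
    case 2
    then have "5 \<le> deg S v" using k by simp
    then obtain H2 where H2: "H2 \<in> bad_comps (S - nbhd {v})" "H2 \<noteq> H" using other_bad_comp[OF t H(1)] by blast
    have "H2 \<inter> H = {}" using comps_disj[OF bad_comps_comps[OF H2(1)] Hc] H2(2) by blast
    then have sub: "H2 \<subseteq> ?K - nbhd {v}"
      using comps_D(1)[OF bad_comps_comps[OF H2(1)]] y(2) unfolding nbrs_def by (auto simp: in_nbhd_single)
    have fK: "finite ?K" using fS by simp
    have "card (?K - nbhd {v}) = 4" using card_diff_nbhd[OF fK K(1)] nine_D(2)[OF K9] 2 by simp
    then have "H2 = ?K - nbhd {v}" using card_seteq[OF _ sub] fK bad_card[OF bad_comps_bad[OF H2(1)]] by simp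
    then have H2K: "u \<in> H2" if "u \<in> ?K" "u \<notin> nbhd {v}" for u using that by blast
    have no: "\<not> adj s u" if "s \<in> nbrs S v" "u \<in> ?K" "u \<notin> nbhd {v}" "adj s h'" "h' \<in> H" for s u h'
    proof
      assume "adj s u"
      then have "s \<in> links S v H2" "s \<in> links S v H" using H2K that unfolding links_def by blast+
      then show False using links_unique[OF t H2(1) H(1)] H2(2) by blast
    qed
    have "nbrs ?K x' \<subseteq> nbhd {v}" using no[OF x'N _ _ h(2,1)] unfolding nbrs_def by blast
    then obtain w where w: "deg ?K x' = 4" "\<And>s. s \<in> ?K - {v, x'} - nbhd {w} \<Longrightarrow>
        (\<exists>u\<in>?K. adj s u \<and> u \<notin> nbhd {v}) \<and> (\<forall>t\<in>?K - {v, x'} - nbhd {w}. \<not> adj s t)"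
      using *(2)[OF 2] by blast
    \<comment> \<open>The vertex \<open>w\<close> comes from \<open>nine\<close>: \<open>?M\<close>
      is independent, and each of its vertices has a neighbour in \<open>H2\<close> and hence none
      in \<open>H\<close>. So a vertex of \<open>?M\<close> has no surviving neighbour but
      \<open>x'\<close> and drops out. Then \<open>x'\<close> drops out, as four of its at most five
      neighbours are in \<open>?K\<close>. Three vertices of \<open>H\<close> are left.\<close>
    let ?A = "S - nbhd {x, w}" and ?M = "?K - {v, x'} - nbhd {w}"
    have "x \<in> nbhd {x, w}" "v \<in> nbhd {x, w}" "y \<in> nbhd {x, w}" "nbhd {w} \<subseteq> nbhd {x, w}"
      using y adj_sym unfolding nbhd_def nbrs_def by auto
    then have A: "?A \<subseteq> (H - {y}) \<union> insert x' ?M" by blast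
    have noH: "\<not> adj s h'" if s: "s \<in> ?M" and h': "h' \<in> H" for s h'
    proof
      assume a: "adj s h'"
      obtain u where u: "u \<in> ?K" "adj s u" "u \<notin> nbhd {v}" using w(2)[OF s] by blast
      have "s \<in> nbrs S v" using comp_nbhd_D(4)[OF Hc h', of s] a s adj_sym by blast
      then show False using no[OF _ u(1,3) a h'] u(2) by blast
    qed
    have "\<not> has_C4 ?A"
    proof
      assume C: "has_C4 ?A"
      have 1: "has_C4 (?A - ?M)"
      proof (rule has_C4_drop[OF C])
        fix s p q assume *: "s \<in> ?M" "p \<in> ?A" "q \<in> ?A" "adj s p" "adj s q"
        have "p \<notin> ?M" "q \<notin> ?M" using w(2)[OF *(1)] *(4,5) by blast+
        moreover have "p \<notin> H" "q \<notin> H" using noH[OF *(1)] *(4,5) by blast+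
        ultimately show "p = q" using A *(2,3) by blast
      qed
      have "has_C4 (?A - ?M - {x'})"
      proof (rule has_C4_drop[OF 1])
        fix s p q assume *: "s \<in> {x'}" "p \<in> ?A - ?M" "q \<in> ?A - ?M" "adj s p" "adj s q"
        then have s: "s = x'" by simp
        have pq: "p \<in> H" "q \<in> H" using A * s adj_irrefl by blast+
        show "p = q"
        proof (rule ccontr)
          assume "p \<noteq> q"
          have "{p, q} \<union> nbrs ?K x' \<subseteq> nbrs S x'" using pq * s HS unfolding nbrs_def by auto
          then have "card ({p, q} \<union> nbrs ?K x') \<le> deg S x'" by (rule card_mono[OF nbrs_finite[OF fS]])
          moreover have "card ({p, q} \<union> nbrs ?K x') = card {p, q} + deg ?K x'"
            using pq nbrs_finite[OF fK] by (intro card_Un_disjoint) (auto simp: nbrs_def)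
          ultimately have "6 \<le> deg S x'" using w(1) \<open>p \<noteq> q\<close> by simp
          then show False using max_deg_D(4)[OF t x'S(1)] k 2 by linarith
        qed
      qed
      moreover have "?A - ?M - {x'} \<subseteq> H - {y}" using A by blast
      ultimately have "has_C4 (H - {y})" by (rule has_C4_mono)
      then show False using has_C4_card[of "H - {y}"] fH H(2) y(1) by simp
    qed
    then have "iso_num S \<le> card {x, w}" by (intro iso_num_le) auto
    also have "\<dots> \<le> 2" by (simp add: card_insert_if)
    finally show False using S(1) cK nine_D(2)[OF K9] unfolding bad_def by simp
  qed
qed

text \<open>\<open>y\<close> dominates \<open>p\<close>, \<open>q\<close> and \<open>x\<close>. If
  it dominated \<open>z\<close> too, or if \<open>z\<close> had at most one undominated neighbour
  among those of \<open>v\<close>, then \<open>four_comp_link\<close> would apply.\<close>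

lemma opposite_links:
  assumes t: "max_deg S v" and H: "H \<in> bad_comps (S - nbhd {v})" "H = {y, p, q, z}" "distinct [y, p, q, z]"
    and a: "adj y p" "adj y q" "adj z p" "adj z q"
    and x: "x \<in> nbrs S v" "adj x y" and n9: "card S \<noteq> 9"
  shows "\<exists>x1 x2. x1 \<noteq> x2 \<and> x1 \<in> nbrs S v \<and> x2 \<in> nbrs S v \<and> \<not> adj y x1 \<and> \<not> adj y x2 \<and> adj z x1 \<and> adj z x2 \<and> \<not> adj y z"
proof (rule ccontr)
  assume no: "\<not> ?thesis"
  note Hc = bad_comps_comps[OF H(1)]
  have nbhd: "y \<in> nbhd {y}" "p \<in> nbhd {y}" "q \<in> nbhd {y}" "x \<in> nbhd {y}"
    using a x adj_sym by (auto simp: in_nbhd_single)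
  have "card S = 9"
  proof (rule four_comp_link[OF t H(1) _ _ x])
    show "card H = 4" "y \<in> H" using H by auto
    fix z' x1 x2 assume *: "z' \<in> insert x H - nbhd {y}" "x1 \<in> S - nbhd {y}" "x2 \<in> S - nbhd {y}" "adj z' x1" "adj z' x2"
    then have z': "z' = z" using nbhd H(2) by auto
    have "x1 \<notin> H" "x2 \<notin> H" using * nbhd z' adj_irrefl unfolding H(2) by auto
    then have "x1 \<in> nbrs S v" "x2 \<in> nbrs S v" using comp_nbhd_D(4)[OF Hc, of z] * z' H(2) by auto
    then show "x1 = x2" using no * z' by (auto simp: in_nbhd_single)
  qed
  then show False using n9 by simp
qed

text \<open>\<open>y\<close> has maximum degree too, so some bad component \<open>B\<close> avoids
  its closed neighbourhood. \<open>B\<close> contains \<open>v\<close>, for otherwise it would be a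
  bad component besides \<open>H\<close> for \<open>v\<close>. Inside \<open>B\<close> at most the
  neighbours \<open>x3\<close> and \<open>x4\<close> of \<open>v\<close> remain, too few for order
  9, so \<open>B\<close> has order 4.\<close>

lemma opposite_comp:
  assumes t: "max_deg S v" and H: "H \<in> bad_comps (S - nbhd {v})" "H = {y, p, q, z}" "distinct [y, p, q, z]"
    and b1: "bad_comps (S - nbhd {v}) = {H}"
    and Nv: "nbrs S v = {x1, x2, x3, x4}" "distinct [x1, x2, x3, x4]" "deg S v = 4"
    and Ny: "nbrs S y = {p, q, x1, x2}" and z: "adj z x3" "adj z x4"
  shows "{v, z, x3, x4} \<in> comps (S - nbhd {y})"
proof -
  note Hc = bad_comps_comps[OF H(1)] and S = max_deg_D(1,2)[OF t]
  have fS: "finite S" using max_deg_D(6)[OF t] .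
  have HS: "H \<subseteq> S" "H \<inter> nbrs S v = {}" "v \<notin> H" using comp_nbhd_D[OF Hc] by auto
  have yS: "y \<in> S" using HS H(2) by auto
  have "p \<in> H" "q \<in> H" "y \<in> H" "z \<in> H" using H(2) by auto
  note mem = this
  have "x1 \<notin> H" "x2 \<notin> H" "x3 \<notin> H" "x4 \<notin> H" using HS(2) Nv(1) by auto
  then have dist: "distinct [y, p, q, z, v, x1, x2, x3, x4]"
    using H(3) Nv(1,2) HS(3) mem adj_irrefl unfolding nbrs_def by auto
  have xS: "x3 \<in> S" "x4 \<in> S" "adj v x3" "adj v x4" using Nv(1) unfolding nbrs_def by blast+
  have "deg S y = 4" unfolding Ny using dist by auto
  then have ty: "max_deg S y" using t yS Nv(3) unfolding max_deg_def by auto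
  have nby: "S - nbhd {y} = S - {y, p, q, x1, x2}" unfolding diff_nbhd Ny by auto
  obtain B where B: "B \<in> bad_comps (S - nbhd {y})"
    using deg_le_bad_comps[OF ty] \<open>deg S y = 4\<close> by fastforce
  note Bc = bad_comps_comps[OF B]
  have in': "v \<in> S - nbhd {y}" "z \<in> S - nbhd {y}" "x3 \<in> S - nbhd {y}" "x4 \<in> S - nbhd {y}"
    unfolding nby using dist xS max_deg_D(3)[OF t] mem HS by auto
  have vB: "v \<in> B"
  proof (rule ccontr)
    assume v: "v \<notin> B"
    have out: "s \<notin> B" if "r \<notin> B" "r \<in> S - nbhd {y}" "adj r s" for r s
      using comps_D(3)[OF Bc, of s r] that adj_sym by blast
    have x3: "x3 \<notin> B" and x4: "x4 \<notin> B" using out[OF v in'(1)] xS by auto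
    have "z \<notin> B" using out[OF x3 in'(3)] z adj_sym by blast
    have B1: "B \<subseteq> S - {y, p, q, x1, x2}" using comps_D(1)[OF Bc] unfolding nby .
    then have sub: "B \<subseteq> S - nbhd {v}" "B \<inter> H = {}" unfolding diff_nbhd Nv(1) H(2) using v x3 x4 \<open>z \<notin> B\<close> by auto
    have "\<not> adj a b" if "a \<in> B" "b \<in> S - nbhd {v} - B" for a b
    proof
      assume ab: "adj a b"
      show False
      proof (cases "b \<in> H")
        case True
        then show False using comps_D(3)[OF Hc, of b a] ab adj_sym that sub by blast
      next
        case False
        have "b \<in> S - insert v (nbrs S v)" using that(2) unfolding diff_nbhd by blast
          with False have "b \<in> S - nbhd {y}" unfolding nby Nv(1) H(2) by auto
        then show False using comps_D(3)[OF Bc, of a b] that ab by blast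
      qed
    qed
    then have "B \<in> bad_comps (S - nbhd {v})" using comps_D(2)[OF Bc] sub bad_comps_bad[OF B] unfolding bad_comps_def comps_def by blast
    then show False using b1 sub(2) mem by blast
  qed
  have "B \<subseteq> S - {y}" using comps_D(1)[OF Bc] by (auto simp: in_nbhd_single)
  then have "card B < card S" using fS yS by (intro psubset_card_mono) auto
  moreover have "\<not> nine B"
  proof
    assume "nine B"
    then have "3 \<le> deg B v" using nine_D(3) vB by blast
    moreover have "nbrs B v \<subseteq> {x3, x4}"
    proof
      fix s assume "s \<in> nbrs B v"
      then have "s \<in> B" "s \<in> nbrs S v" using comps_D(1)[OF Bc] unfolding nbrs_def by auto
      then show "s \<in> {x3, x4}" using comps_D(1)[OF Bc] unfolding nby Nv(1) by auto
    qed
    then have "deg B v \<le> card {x3, x4}" by (intro card_mono) auto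
    moreover have "card {x3, x4} \<le> 2" by (simp add: card_insert_if)
    ultimately show False by linarith
  qed
  ultimately have B4: "card B = 4" using smaller_bad_D[OF S(2) bad_comps_bad[OF B]] by blast
  have "x3 \<in> B" "x4 \<in> B" using comps_D(3)[OF Bc vB] in' xS by auto
  moreover from this have "z \<in> B" using comps_D(3)[OF Bc, of x3 z] in' z adj_sym by blast
  ultimately have "{v, z, x3, x4} \<subseteq> B" using vB by blast
  moreover have "card {v, z, x3, x4} = 4" using dist by auto
  ultimately have "{v, z, x3, x4} = B" using B4 bad_fin[OF bad_comps_bad[OF B]] by (intro card_seteq) auto
  then show ?thesis using Bc by simp
qed

text \<open>The opposite vertices \<open>y\<close> and \<open>z\<close> of \<open>H\<close> have two
  links each, all distinct. With k the degree of \<open>v\<close> and b the number of bad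
  components, \<open>card_links\<close> and \<open>deg_le_bad_comps\<close> give
  \<open>2 * b + 2 <= k <= b + 3\<close>, so b is 1 and k is 4.\<close>

lemma four_comp:
  assumes t: "max_deg S v" and H: "H \<in> bad_comps (S - nbhd {v})" "card H = 4"
  shows "card S = 9"
proof (rule ccontr)
  assume n9: "card S \<noteq> 9"
  note Hc = bad_comps_comps[OF H(1)] and S = max_deg_D(1,2)[OF t]
  have fS: "finite S" using max_deg_D(6)[OF t] .
  have HS: "H \<subseteq> S" "H \<inter> nbrs S v = {}" "v \<notin> H" using comp_nbhd_D[OF Hc] by auto
  have "nbrs S v \<noteq> {}" using max_deg_D(5)[OF t] by auto
  then obtain x0 where "x0 \<in> S" "x0 \<noteq> v" using adj_irrefl unfolding nbrs_def by blast
  then obtain x y where x: "x \<in> nbrs S v" "adj x y" "y \<in> H"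
    using linked[OF t Hc] unfolding links_def by blast
  obtain p q z where pqz: "H = {y, p, q, z}" "distinct [y, p, q, z]" "adj y p" "adj y q" "adj z p" "adj z q"
    using has_C4_opposite[OF bad_C4[OF bad_comps_bad[OF H(1)]] H(2) x(3)] by metis
  obtain x3 x4 where x34: "x3 \<noteq> x4" "x3 \<in> nbrs S v" "x4 \<in> nbrs S v" "\<not> adj y x3" "\<not> adj y x4" "adj z x3" "adj z x4" "\<not> adj y z"
    using opposite_links[OF t H(1) pqz x(1,2) n9] by blast
  have pqz': "H = {z, p, q, y}" "distinct [z, p, q, y]" using pqz by auto
  obtain x1 x2 where x12: "x1 \<noteq> x2" "x1 \<in> nbrs S v" "x2 \<in> nbrs S v" "\<not> adj z x1" "\<not> adj z x2" "adj y x1" "adj y x2" "\<not> adj z y"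
    using opposite_links[OF t H(1) pqz' pqz(5,6,3,4) x34(2) _ n9] x34(6) adj_sym by blast
  have d4: "distinct [x1, x2, x3, x4]" using x12 x34 by auto
  have "{x1, x2, x3, x4} \<subseteq> links S v H" using x12 x34 pqz(1) adj_sym unfolding links_def by auto
  then have "card {x1, x2, x3, x4} \<le> card (links S v H)"
    using nbrs_finite[OF fS] by (intro card_mono) (auto simp: links_def)
  moreover have c4: "card {x1, x2, x3, x4} = 4" using d4 by auto
  ultimately have "4 + 2 * card (bad_comps (S - nbhd {v})) \<le> deg S v + 2" using card_links[OF t H(1)] by simp
  then have b: "card (bad_comps (S - nbhd {v})) = 1" "deg S v = 4" using deg_le_bad_comps[OF t] max_deg_D(5)[OF t] by linarith+
  then have b1: "bad_comps (S - nbhd {v}) = {H}" using H(1) by (auto simp: card_1_singleton_iff)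
  have "{x1, x2, x3, x4} \<subseteq> nbrs S v" using x12 x34 by auto
  then have Nv: "nbrs S v = {x1, x2, x3, x4}" using nbrs_eq[OF _ fS] c4 b(2) by simp
  have xH: "x1 \<notin> H" "x2 \<notin> H" "x3 \<notin> H" "x4 \<notin> H" using HS(2) Nv by auto
  have xS: "x1 \<in> S" "x2 \<in> S" "x3 \<in> S" "x4 \<in> S" using x12 x34 unfolding nbrs_def by auto
  have Ny: "nbrs S y = {p, q, x1, x2}"
  proof (rule nbrs_eq[OF _ fS])
    show "{p, q, x1, x2} \<subseteq> nbrs S y" using pqz x12 xS HS unfolding nbrs_def by auto
    have "card {p, q, x1, x2} = 4" using pqz(1,2) xH d4 by auto
    then show "deg S y \<le> card {p, q, x1, x2}" using max_deg_D(4)[OF t, of y] b(2) pqz(1) HS(1) by auto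
  qed
  have Nz: "nbrs S z = {p, q, x3, x4}"
  proof (rule nbrs_eq[OF _ fS])
    show "{p, q, x3, x4} \<subseteq> nbrs S z" using pqz x34 xS HS unfolding nbrs_def by auto
    have "card {p, q, x3, x4} = 4" using pqz(1,2) xH d4 by auto
    then show "deg S z \<le> card {p, q, x3, x4}" using max_deg_D(4)[OF t, of z] b(2) pqz(1) HS(1) by auto
  qed
  have K1: "{v, z, x3, x4} \<in> comps (S - nbhd {y})"
    by (rule opposite_comp[OF t H(1) pqz(1,2) b1 Nv d4 b(2) Ny x34(6,7)])
  have Nv': "nbrs S v = {x3, x4, x1, x2}" and d4': "distinct [x3, x4, x1, x2]" using Nv d4 by auto
  have K2: "{v, y, x1, x2} \<in> comps (S - nbhd {z})"
    by (rule opposite_comp[OF t H(1) pqz' b1 Nv' d4' b(2) Nz x12(6,7)])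
  \<comment> \<open>The vertices not yet accounted for. They could be attached only at a link, but
    by \<open>K1\<close> and \<open>K2\<close> the links have no neighbours among them.\<close>
  define R where "R = S - (H \<union> insert v (nbrs S v))"
  have "R = {}"
  proof (rule ccontr)
    assume "R \<noteq> {}"
    then obtain s u where su: "s \<in> R" "u \<in> S - R" "adj s u"
      using conn_edge[OF bad_conn[OF S(1)], of R] max_deg_D(3)[OF t] unfolding R_def by blast
    have s: "s \<in> S" "s \<notin> H" "s \<noteq> v" "s \<notin> nbrs S v" using su(1) unfolding R_def by auto
    have "u \<noteq> v" using s su(3) adj_sym unfolding nbrs_def by auto
    moreover have "u \<notin> H" using comp_nbhd_D(4)[OF Hc, of u s] s su(3) adj_sym by blast
    moreover have "u \<notin> {x3, x4}"
    proof
      assume u: "u \<in> {x3, x4}"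
      have "s \<in> S - nbhd {y}" using s pqz(1) unfolding diff_nbhd Ny Nv by auto
      then have "s \<in> {v, z, x3, x4}" using comps_D(3)[OF K1, of u s] u su(3) adj_sym by blast
      then show False using s Nv pqz(1) by auto
    qed
    moreover have "u \<notin> {x1, x2}"
    proof
      assume u: "u \<in> {x1, x2}"
      have "s \<in> S - nbhd {z}" using s pqz(1) unfolding diff_nbhd Nz Nv by auto
      then have "s \<in> {v, y, x1, x2}" using comps_D(3)[OF K2, of u s] u su(3) adj_sym by blast
      then show False using s Nv pqz(1) by auto
    qed
    ultimately show False using su(2) Nv unfolding R_def by auto
  qed
  then have Seq: "S = H \<union> insert v (nbrs S v)" using HS max_deg_D(3)[OF t] unfolding R_def nbrs_def by auto
  have "card (insert v (nbrs S v)) = 5" using b(2) nbrs_finite[OF fS] adj_irrefl by (simp add: nbrs_def)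
  moreover have "card (H \<union> insert v (nbrs S v)) = card H + card (insert v (nbrs S v))"
    using HS fS finite_subset[OF HS(1)] nbrs_finite[OF fS] by (intro card_Un_disjoint) auto
  ultimately show False using Seq H(2) n9 by simp
qed

section \<open>Bad components of order 9\<close>

lemma conn_C4: assumes "has_C4 A" "card A = 4" shows "conn A"
proof -
  obtain y where y: "y \<in> A" using assms(2) by fastforce
  obtain p q z where *: "A = {y, p, q, z}" "adj y p" "adj y q" "adj z p" "adj z q"
    using has_C4_opposite[OF assms y] by metis
  show ?thesis
  proof (rule conn_pivot[OF y])
    fix P assume P: "P \<subseteq> A" "P \<noteq> {}" "y \<notin> P"
    show "\<exists>u\<in>P. \<exists>w\<in>A - P. adj u w"
    proof (cases "p \<in> P")
      case True
      then show ?thesis using * y P adj_sym by blast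
    next
      case False
      then have "q \<in> P \<or> z \<in> P" using P * by blast
      then show ?thesis using * y P False adj_sym by blast
    qed
  qed
qed

lemma bad_four: assumes "has_C4 A" "card A = 4" shows "bad A"
proof -
  have f: "finite A" using assms(2) by (simp add: card_ge_0_finite)
  obtain D where D: "finite D" "card D = iso_num A" "\<not> has_C4 (A - nbhd D)" using iso_num_obtain[OF f] .
  have "iso_num A \<noteq> 0"
  proof
    assume "iso_num A = 0"
    then have "nbhd D = {}" using D unfolding nbhd_def by simp
    then show False using D assms(1) by simp
  qed
  then show ?thesis using assms(2) f conn_C4[OF assms] unfolding bad_def by simp
qed

text \<open>The links of the other bad components are not links of \<open>H\<close>, so they survive
  outside \<open>Y\<close>. If \<open>C\<close> contains \<open>v\<close>, it swallows another bad
  component and has at least ten vertices, too many for a smaller bad graph. If not, it avoids all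
  surviving neighbours of \<open>v\<close>; outside \<open>H\<close> it would then be a bad
  component of \<open>S - nbhd {v}\<close> that contains its own link.\<close>

lemma bad_comp_in_nine:
  assumes t: "max_deg S v" "5 \<le> deg S v" and all9: "\<And>C. C \<in> bad_comps (S - nbhd {v}) \<Longrightarrow> nine C"
    and H: "H \<in> bad_comps (S - nbhd {v})"
    and Y: "Y \<subseteq> S" "Y \<noteq> {}" "Y \<subseteq> H \<union> links S v H" and C: "C \<in> comps (S - Y)" "bad C"
  shows "C \<subseteq> H"
proof -
  note Hc = bad_comps_comps[OF H] and S = max_deg_D(1,2)[OF t(1)]
  have fS: "finite S" using max_deg_D(6)[OF t(1)] .
  have HS: "H \<subseteq> S" "H \<inter> nbrs S v = {}" "v \<notin> H" using comp_nbhd_D[OF Hc] by auto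
  have lN: "links S v X \<subseteq> nbrs S v" for X unfolding links_def by auto
  have far: "\<exists>x'\<in>nbrs S v. x' \<in> S - Y \<and> (\<exists>h\<in>X. adj x' h)" if X: "X \<in> bad_comps (S - nbhd {v})" "X \<noteq> H" for X
  proof -
    have "nbrs S v \<noteq> {}" using max_deg_D(5)[OF t(1)] by auto
    then obtain x0 where "x0 \<in> S" "x0 \<noteq> v" using adj_irrefl unfolding nbrs_def by blast
    then obtain x' where x': "x' \<in> links S v X" using linked[OF t(1) bad_comps_comps[OF X(1)]] by blast
    then have "x' \<notin> links S v H" using links_unique[OF t(1) X(1) H] X(2) by blast
    moreover have "x' \<notin> H" "x' \<in> S" using x' lN HS unfolding nbrs_def by auto
    ultimately show ?thesis using x' Y(3) unfolding links_def by blast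
  qed
  have vY: "v \<in> S - Y" using HS(3) Y(3) lN max_deg_D(3)[OF t(1)] adj_irrefl unfolding nbrs_def by blast
  show ?thesis
  proof (cases "v \<in> C")
    case True
    obtain H2 where H2: "H2 \<in> bad_comps (S - nbhd {v})" "H2 \<noteq> H" using other_bad_comp[OF t(1) H t(2)] .
    note H2c = bad_comps_comps[OF H2(1)]
    obtain x' h where x': "x' \<in> nbrs S v" "x' \<in> S - Y" "h \<in> H2" "adj x' h" using far[OF H2] by blast
    have "H2 \<inter> H = {}" using comps_disj[OF H2c Hc] H2(2) by blast
    then have H2Y: "H2 \<subseteq> S - Y" using comp_nbhd_D(1,3)[OF H2c] Y(3) lN by blast
    have "x' \<in> C" using comps_D(3)[OF C(1) True] x' unfolding nbrs_def by blast
    then have "h \<in> C" using comps_D(3)[OF C(1), of x' h] x' H2Y by blast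
    then have "H2 \<subseteq> C" using comps_sub[OF comps_D(2)[OF H2c] H2Y C(1)] x'(3) by blast
    then have "insert v H2 \<subseteq> C" using True by blast
    then have "card (insert v H2) \<le> card C" using bad_fin[OF C(2)] by (intro card_mono)
    moreover have "card (insert v H2) = 10"
      using nine_D(1,2)[OF all9[OF H2(1)]] comp_nbhd_D(2)[OF H2c] by simp
    moreover have "card C < card S" using comps_D(1)[OF C(1)] Y(1,2) fS by (intro psubset_card_mono) auto
    ultimately show ?thesis using smaller_bad_D[OF S(2) C(2)] nine_D(2)[of C] by fastforce
  next
    case False
    have CN: "x' \<notin> C" if "x' \<in> nbrs S v" "x' \<in> S - Y" for x'
      using comps_D(3)[OF C(1), of x' v] that False vY adj_sym unfolding nbrs_def by blast
    have C1: "C \<subseteq> S - Y" using comps_D(1)[OF C(1)] .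
    have Cv: "C \<subseteq> S - nbhd {v}"
    proof
      fix s assume "s \<in> C"
      then show "s \<in> S - nbhd {v}" using CN[of s] C1 False unfolding diff_nbhd by blast
    qed
    show ?thesis
    proof (cases "C \<inter> H = {}")
      case False
      then show ?thesis using comps_sub[OF comps_D(2)[OF C(1)] Cv Hc] by blast
    next
      case True
      have "\<not> adj a b" if "a \<in> C" "b \<in> S - nbhd {v} - C" for a b
      proof
        assume ab: "adj a b"
        show False
        proof (cases "b \<in> H")
          assume "b \<in> H"
          then show False using comps_D(3)[OF Hc, of b a] ab adj_sym that Cv True by blast
        next
          assume "b \<notin> H"
          then have "b \<in> S - Y" using that(2) Y(3) lN unfolding diff_nbhd by blast
          then show False using comps_D(3)[OF C(1), of a b] that ab by blast
        qed
      qed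
      then have "C \<in> bad_comps (S - nbhd {v})" using comps_D(2)[OF C(1)] Cv C(2) unfolding bad_comps_def comps_def by blast
      moreover have "C \<noteq> H" using True comps_D(4)[OF C(1)] by blast
      ultimately obtain x' h where x': "x' \<in> nbrs S v" "x' \<in> S - Y" "h \<in> C" "adj x' h" using far by blast
      then have "x' \<in> C" using comps_D(3)[OF C(1), of h x'] adj_sym by blast
      then show ?thesis using CN x' by blast
    qed
  qed
qed

text \<open>Otherwise all bad components have order 9. The contradiction depends on the degree of
  \<open>v\<close> and on the degree within \<open>H\<close> of a vertex \<open>y\<close> at which
  \<open>H\<close> is attached.\<close>

lemma max_deg_card:
  assumes t: "max_deg S v" shows "card S = 9"
proof (rule ccontr)
  assume n9: "card S \<noteq> 9"
  note S = max_deg_D(1,2)[OF t]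
  have fS: "finite S" using max_deg_D(6)[OF t] .
  have all9: "nine C" if "C \<in> bad_comps (S - nbhd {v})" for C
  proof -
    have "v \<notin> C" "C \<subseteq> S" using comp_nbhd_D[OF bad_comps_comps[OF that]] by auto
    then have "card C < card S" using max_deg_D(3)[OF t] fS by (intro psubset_card_mono) auto
    then show ?thesis using smaller_bad_D[OF S(2) bad_comps_bad[OF that]] four_comp[OF t that] n9 by blast
  qed
  have "bad_comps (S - nbhd {v}) \<noteq> {}" using deg_le_bad_comps[OF t] max_deg_D(5)[OF t] by auto
  then obtain H where H: "H \<in> bad_comps (S - nbhd {v})" by blast
  note Hc = bad_comps_comps[OF H] and H9 = all9[OF H]
  have HS: "H \<subseteq> S" "H \<inter> nbrs S v = {}" "v \<notin> H" using comp_nbhd_D[OF Hc] by auto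
  have fH: "finite H" and cH: "card H = 9" using nine_D[OF H9] by auto
  have "nbrs S v \<noteq> {}" using max_deg_D(5)[OF t] by auto
  then obtain x0 where "x0 \<in> S" "x0 \<noteq> v" using adj_irrefl unfolding nbrs_def by blast
  then obtain x y where x: "x \<in> links S v H" "x \<in> nbrs S v" "adj x y" "y \<in> H"
    using linked[OF t Hc] unfolding links_def by blast
  have xH: "x \<notin> H" "x \<in> S" using HS x(2) unfolding nbrs_def by auto
  have out: "s \<in> nbrs S v" if "h \<in> H" "s \<in> S" "adj h s" "s \<notin> H" for h s using comp_nbhd_D(4)[OF Hc] that by blast
  have degy: "deg H y + 1 \<le> deg S y"
  proof -
    have "insert x (nbrs H y) \<subseteq> nbrs S y" using x HS xH adj_sym unfolding nbrs_def by auto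
    then have "card (insert x (nbrs H y)) \<le> deg S y" using card_mono[OF nbrs_finite[OF fS]] by blast
    moreover have "x \<notin> nbrs H y" "finite (nbrs H y)" using xH nbrs_finite[OF fH] unfolding nbrs_def by auto
    ultimately show ?thesis by simp
  qed
  have y34: "deg H y = 3 \<or> deg H y = 4" using nine_D(3,4)[OF H9 x(4)] by linarith
  have yS: "y \<in> S" using x HS by auto
  show False
  proof (cases "deg S v = 4")
    case True
    then have "deg H y = 3" using y34 degy max_deg_D(4)[OF t yS] by linarith
    then obtain u where u: "u \<in> H" "deg H u = 4" "\<And>w. w \<in> H - nbhd {u} \<Longrightarrow> deg H w = 4"
      using nine_hub[OF H9 x(4)] by blast
    \<comment> \<open>The maximum degree is 4, so a vertex with four neighbours in \<open>H\<close>
      has none outside \<open>H\<close>.\<close>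
    have full: "nbrs S w = nbrs H w" if "w \<in> H" "deg H w = 4" for w
    proof (rule nbrs_eq[OF nbrs_mono[OF HS(1)] fS])
      show "deg S w \<le> deg H w" using max_deg_D(4)[OF t, of w] that True HS by auto
    qed
    \<comment> \<open>\<open>u\<close> is another vertex of maximum degree, and \<open>?T\<close>
      becomes a bad component of order 4 for it, which \<open>four_comp\<close> excludes.\<close>
    let ?T = "H - nbhd {u}"
    have cT: "card ?T = 4" using card_diff_nbhd[OF fH u(1)] u(2) cH by simp
    have C4: "has_C4 ?T"
    proof (rule ccontr)
      assume "\<not> has_C4 ?T"
      then have "iso_num H \<le> 1" using iso_num_le[of "{u}" H] by simp
      then show False using bad_comps_bad[OF H] cH unfolding bad_def by simp
    qed
    have "\<not> adj a b" if "a \<in> ?T" "b \<in> S - nbhd {u} - ?T" for a b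
    proof
      assume "adj a b"
      then have "b \<in> nbrs H a" using full[of a] u(3)[of a] that unfolding nbrs_def by auto
      then show False using that unfolding nbrs_def by auto
    qed
    then have "?T \<in> comps (S - nbhd {u})" using conn_C4[OF C4 cT] HS unfolding comps_def by blast
    then have T: "?T \<in> bad_comps (S - nbhd {u})" using bad_four[OF C4 cT] unfolding bad_comps_def by simp
    have "deg S u = 4" using full[OF u(1,2)] u(2) by simp
    then have "max_deg S u" using t True u(1) HS unfolding max_deg_def by auto
    then show False using four_comp[OF _ T cT] n9 by blast
  next
    case False
    then have k5: "5 \<le> deg S v" using max_deg_D(5)[OF t] by simp
    have inH: "C \<subseteq> H - Y" if "Y \<subseteq> S" "Y \<noteq> {}" "Y \<subseteq> H \<union> links S v H" "C \<in> comps (S - Y)" "bad C" for C Y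
      using bad_comp_in_nine[OF t k5 all9 H that] comps_D(1)[OF that(4)] by blast
    from y34 show False
    proof
      assume y4: "deg H y = 4"
      \<comment> \<open>Six removed vertices against one dominating vertex: the count demands two
        untouched bad components, but \<open>H - nbhd {y}\<close> has only four vertices, room for
        one.\<close>
      let ?Y = "insert x (H \<inter> nbhd {y})"
      have Y: "?Y \<subseteq> S" "?Y \<noteq> {}" "?Y \<subseteq> H \<union> links S v H" using xH HS x by auto
      have cY: "card ?Y = 6" using card_nbhd[OF fH x(4)] y4 fH xH by simp
      have "card ?Y + 4 * card {C \<in> bad_comps (S - ?Y). C \<inter> nbhd {y} \<noteq> {}} +
         (\<Sum>C\<in>comps (S - ?Y) - bad_comps (S - ?Y). card C mod 5) + 1
         \<le> 5 * card {y} + card {C \<in> bad_comps (S - ?Y). C \<inter> nbhd {y} = {}}"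
        by (rule bad_count[OF S Y(1,2)]) (use x adj_sym in \<open>auto simp: in_nbhd_single\<close>)
      then have "2 \<le> card {C \<in> bad_comps (S - ?Y). C \<inter> nbhd {y} = {}}" using cY by simp
      moreover have "C = H - nbhd {y}" if "C \<in> bad_comps (S - ?Y)" for C
      proof -
        have "C \<subseteq> H - ?Y" using inH[OF Y bad_comps_comps[OF that] bad_comps_bad[OF that]] .
        then have "C \<subseteq> H - nbhd {y}" by auto
        moreover have "card (H - nbhd {y}) = 4" using card_diff_nbhd[OF fH x(4)] y4 cH by simp
        ultimately show ?thesis using bad_card[OF bad_comps_bad[OF that]] fH by (intro card_seteq) auto
      qed
      then have "{C \<in> bad_comps (S - ?Y). C \<inter> nbhd {y} = {}} \<subseteq> {H - nbhd {y}}" by blast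
      then have "card {C \<in> bad_comps (S - ?Y). C \<inter> nbhd {y} = {}} \<le> 1" using card_mono[of "{H - nbhd {y}}"] by fastforce
      ultimately show False by simp
    next
      assume y3: "deg H y = 3"
      then obtain y' w where y': "y' \<in> H" "w \<in> H" "y' \<noteq> y" "nbrs H y' = nbrs H y" "H - {y, y'} \<subseteq> nbrs H y \<union> nbhd {w}"
        using nine_twin[OF H9 x(4)] by blast
      show False
      proof (cases "\<exists>x1 x2. x1 \<noteq> x2 \<and> x1 \<in> nbrs S v \<and> x2 \<in> nbrs S v \<and> adj y' x1 \<and> adj y' x2")
        case True
        then obtain x1 x2 where x12: "x1 \<noteq> x2" "x1 \<in> nbrs S v" "x2 \<in> nbrs S v" "adj y' x1" "adj y' x2" by blast
        \<comment> \<open>Ten vertices, all dominated by the twin \<open>y'\<close> of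
          \<open>y\<close> and by \<open>w\<close>; a leftover bad component would have to fit into
          \<open>{y}\<close>.\<close>
        let ?Y = "(H - {y}) \<union> {x1, x2}"
        have xx: "x1 \<notin> H" "x2 \<notin> H" "x1 \<in> S" "x2 \<in> S" using x12 HS unfolding nbrs_def by auto
        have "x1 \<in> links S v H" "x2 \<in> links S v H"
          using x12 y'(1) adj_sym[of y' x1] adj_sym[of y' x2] unfolding links_def by blast+
        then have Y: "?Y \<subseteq> S" "?Y \<noteq> {}" "?Y \<subseteq> H \<union> links S v H" using xx HS by auto
        have "card ?Y = card (H - {y}) + card {x1, x2}" using fH xx by (intro card_Un_disjoint) auto
        then have cY: "card ?Y = 10" using fH x(4) cH x12(1) by simp
        have "?Y \<subseteq> nbhd {y', w}"
        proof
          fix s assume "s \<in> ?Y"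
          then consider "s = y'" | "s \<in> nbrs H y \<union> nbhd {w}" | "s = x1" | "s = x2" using y'(5) by blast
          then show "s \<in> nbhd {y', w}"
            using y'(4) x12 unfolding nbhd_def nbrs_def by cases auto
        qed
        moreover have "5 * card {y', w} \<le> card ?Y" using cY by (simp add: card_insert_if)
        ultimately obtain C where C: "C \<in> comps (S - ?Y)" "bad C"
          using bad_comp_exists[OF S Y(1), of "{y', w}"] by blast
        have "C \<subseteq> {y}" using inH[OF Y C] by blast
        then have "card C \<le> 1" using card_mono[of "{y}"] by fastforce
        then show False using bad_card[OF C(2)] by simp
      next
        case False
        \<comment> \<open>Ten vertices, of which \<open>y\<close> and \<open>w\<close> may miss only
          \<open>y'\<close>. Its neighbours in \<open>H\<close> are those of its twin
          \<open>y\<close> and hence dominated, and it has at most one neighbour outside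
          \<open>H\<close>.\<close>
        let ?Y = "insert x H"
        have Y: "?Y \<subseteq> S" "?Y \<noteq> {}" "?Y \<subseteq> H \<union> links S v H" using xH HS x by auto
        have cY: "card ?Y = 10" using fH xH cH by simp
        have "\<exists>C\<in>comps (S - ?Y). bad C \<and> C \<inter> nbhd {y, w} = {}"
        proof (rule bad_comp_exists[OF S Y(1)])
          show "5 * card {y, w} \<le> card ?Y" using cY by (simp add: card_insert_if)
          fix s p q assume *: "s \<in> ?Y - nbhd {y, w}" "p \<in> S - nbhd {y, w}" "q \<in> S - nbhd {y, w}" "adj s p" "adj s q"
          have "x \<in> nbhd {y, w}" "y \<in> nbhd {y, w}" "nbrs H y \<union> nbhd {w} \<subseteq> nbhd {y, w}"
            using x adj_sym unfolding nbhd_def nbrs_def by auto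
          then have s: "s = y'" using *(1) y'(5) by blast
          have "p \<notin> H" "q \<notin> H" using * s y'(4) unfolding nbhd_def nbrs_def by blast+
          then have "p \<in> nbrs S v" "q \<in> nbrs S v" using out[OF y'(1)] * s by auto
          then show "p = q" using False * s by blast
        qed auto
        then obtain C where C: "C \<in> comps (S - ?Y)" "bad C" by blast
        then have "C = {}" using inH[OF Y C] by blast
        then show False using comps_D(4)[OF C(1)] by blast
      qed
    qed
  qed
qed

theorem minimal_bad:
  assumes S: "bad S" "smaller_bad (card S)" "card S \<noteq> 4"
  shows "card S = 9 \<and> (\<exists>v\<in>S. deg S v = 4)"
proof -
  have fS: "finite S" using bad_fin[OF S(1)] .
  obtain v where v: "v \<in> S" "\<And>u. u \<in> S \<Longrightarrow> deg S u \<le> deg S v"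
  proof -
    have ne: "S \<noteq> {}" using bad_card[OF S(1)] by auto
    have "Max (deg S ` S) \<in> deg S ` S" using fS ne by (intro Max_in) auto
    then obtain v where "v \<in> S" "deg S v = Max (deg S ` S)" by auto
    then show ?thesis using that[of v] fS by auto
  qed
  have "4 \<le> deg S v"
  proof (rule ccontr)
    assume "\<not> ?thesis"
    then have "deg S u \<le> 3" if "u \<in> S" for u using v(2)[OF that] by simp
    then show False using subcubic[OF S(1,2)] S(3) by blast
  qed
  then have t: "max_deg S v" using S v unfolding max_deg_def by blast
  have 9: "card S = 9" using max_deg_card[OF t] .
  \<comment> \<open>One vertex cannot isolate a bad graph of order 9, so at least four vertices lie
    outside the closed neighbourhood; this caps the degree at 4.\<close>
  have "has_C4 (S - nbhd {v})"
  proof (rule ccontr)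
    assume "\<not> ?thesis"
    then have "iso_num S \<le> 1" using iso_num_le[of "{v}" S] by simp
    then show False using S(1) 9 unfolding bad_def by simp
  qed
  then have "4 \<le> card (S - nbhd {v})" using has_C4_card fS by blast
  then have "deg S v \<le> 4" using card_diff_nbhd[OF fS v(1)] 9 by simp
  then show ?thesis using 9 v \<open>4 \<le> deg S v\<close> by auto
qed

end

section \<open>Bad graphs on nine vertices\<close>

text \<open>Label the nine vertices 0, ..., 8 such that 0 has the neighbours 1, ..., 4 and 5, 6, 7, 8 is
  a 4-cycle. A certificate is a search tree over the remaining 24 pairs: T holds the edges
  known to be present, M those not yet excluded. A branch is closed when some vertex u has no
  4-cycle of M outside the closed neighbourhood of u in T, when the rows of 1, ..., 4 are not
  in decreasing lexicographic order (which may be assumed by sorting), when the graph is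
  disconnected, or when it is decided and isomorphic to an exceptional graph.\<close>
datatype cert = Disc | Branch cert cert | NoC4 nat | Unsorted nat | Exc nat "nat list"

section \<open>The certificate and its checker\<close>

definition adj_mat :: "nat list list \<Rightarrow> bool list list" where
  "adj_mat xss = map (\<lambda>xs. map (\<lambda>j. j \<in> set xs) [0..<9]) xss"

text \<open>The graphs \<open>G1g\<close> to \<open>G6g\<close> in this order, with all labels
  lowered by one.\<close>

definition exc_mats :: "bool list list list" where
  "exc_mats = [adj_mat [[1,2,7,8], [0,2,3,8], [0,1,3,4], [1,2,4,5], [2,3,5,6], [3,4,6,7], [4,5,7,8], [0,5,6,8], [0,1,6,7]],
    adj_mat [[1,5,6,8], [0,2,7,8], [1,3,6,7], [2,4,6,8], [3,5,7,8], [0,4,6,7], [0,2,3,5], [1,2,4,5], [0,1,3,4]],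
    adj_mat [[1,5,6,8], [0,2,7,8], [1,3,7,8], [2,4,6,8], [3,5,6,7], [0,4,6,7], [0,3,4,5], [1,2,4,5], [0,1,2,3]],
    adj_mat [[1,2,3,4], [0,2,5,6], [0,1,5,6], [0,4,7,8], [0,3,7,8], [1,2,6,8], [1,2,5,7], [3,4,6,8], [3,4,5,7]],
    adj_mat [[1,2,3,4], [0,5,6], [0,5,6], [0,4,7,8], [0,3,7,8], [1,2,6,8], [1,2,5,7], [3,4,6,8], [3,4,5,7]],
    adj_mat [[1,2,3,4], [0,5,6], [0,5,6], [0,7,8], [0,7,8], [1,2,6,8], [1,2,5,7], [3,4,6,8], [3,4,5,7]]]"

fun no_common :: "bool list \<Rightarrow> bool list \<Rightarrow> bool list \<Rightarrow> bool" where
  "no_common (b#bs) (x#xs) (y#ys) \<longleftrightarrow> \<not> (b \<and> x \<and> y) \<and> no_common bs xs ys"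
| "no_common _ _ _ \<longleftrightarrow> True"

fun le1_common :: "bool list \<Rightarrow> bool list \<Rightarrow> bool list \<Rightarrow> bool" where
  "le1_common (b#bs) (x#xs) (y#ys) \<longleftrightarrow> (if b \<and> x \<and> y then no_common bs xs ys else le1_common bs xs ys)"
| "le1_common _ _ _ \<longleftrightarrow> True"

text \<open>A 4-cycle is a pair of vertices with two common neighbours. \<open>R\<close> masks the
  rows as well as the columns; a masked row becomes \<open>[]\<close>, for which
  \<open>le1_common\<close> holds trivially.\<close>

definition C4_free :: "bool list \<Rightarrow> bool list list \<Rightarrow> bool" where
  "C4_free R M \<longleftrightarrow> sorted_wrt (le1_common R) (map2 (\<lambda>b r. if b then r else []) R M)"

definition set_entry :: "bool \<Rightarrow> nat \<Rightarrow> nat \<Rightarrow> bool list list \<Rightarrow> bool list list" where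
  "set_entry c i j M = (let M' = M[i := (M!i)[j := c]] in M'[j := (M'!j)[i := c]])"

text \<open>Each row is given by its known and by its possible entries. The test succeeds only if
  both rows are decided up to the first difference and the first row is smaller there, so it is
  valid for every completion.\<close>

fun lex_less :: "bool list \<Rightarrow> bool list \<Rightarrow> bool list \<Rightarrow> bool list \<Rightarrow> bool" where
  "lex_less (t#ts) (m#ms) (t'#ts') (m'#ms') \<longleftrightarrow>
     t = m \<and> t' = m' \<and> (if t then t' \<and> lex_less ts ms ts' ms' else t' \<or> lex_less ts ms ts' ms')"
| "lex_less _ _ _ _ \<longleftrightarrow> False"

text \<open>The pair \<open>T\<close>, \<open>M\<close> stands for all graphs between them.
  \<open>NoC4\<close> takes the neighbours of \<open>u\<close> from \<open>T\<close> and the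
  candidate cycles from \<open>M\<close>, the extremes that cover every graph in between.\<close>

fun check_cert :: "(nat \<times> nat) list \<Rightarrow> bool list list \<Rightarrow> bool list list \<Rightarrow> cert \<Rightarrow> bool" where
  "check_cert ((i, j)#es) T M (Branch c d) \<longleftrightarrow> check_cert es (set_entry True i j T) M c \<and> check_cert es T (set_entry False i j M) d"
| "check_cert es T M (NoC4 u) \<longleftrightarrow> u < 9 \<and> C4_free (map Not ((T!u)[u := True])) M"
| "check_cert es T M (Unsorted i) \<longleftrightarrow> i \<in> {1, 2, 3} \<and>
     lex_less (drop 5 (T!i)) (drop 5 (M!i)) (drop 5 (T!Suc i)) (drop 5 (M!Suc i))"
| "check_cert es T M (Exc g q) \<longleftrightarrow> g < 6 \<and> length q = 9 \<and> distinct q \<and> list_all (\<lambda>x. x < 9) q \<and> T = M \<and>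
     exc_mats!g = map (\<lambda>i. let r = T!i in map (\<lambda>j. r!j) q) q"
| "check_cert es T M Disc \<longleftrightarrow> list_all (\<lambda>r. True \<notin> set (drop 5 r)) (take 4 (drop 1 M))"
| "check_cert _ _ _ _ \<longleftrightarrow> False"

definition T0 where "T0 = adj_mat [[1,2,3,4], [0], [0], [0], [0], [6,8], [5,7], [6,8], [5,7]]"
definition M0 where "M0 = adj_mat [[1,2,3,4], [0,2,3,4,5,6,7,8], [0,1,3,4,5,6,7,8],
    [0,1,2,4,5,6,7,8], [0,1,2,3,5,6,7,8], [1,2,3,4,6,7,8], [1,2,3,4,5,7,8], [1,2,3,4,5,6,8],
    [1,2,3,4,5,6,7]]"
text \<open>The pairs between 1, ..., 4 and the 4-cycle come first, column by column, so that the
  rows become comparable from their leading entries and \<open>Unsorted\<close> can close branches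
  early.\<close>

definition es0 :: "(nat \<times> nat) list" where
    "es0 = [(1, 5), (2, 5), (3, 5), (4, 5), (1, 6), (2, 6), (3, 6), (4, 6), (1, 7), (2, 7), (3, 7),
    (4, 7), (1, 8), (2, 8), (3, 8), (4, 8), (1, 2), (1, 3), (1, 4), (2, 3), (2, 4), (3, 4), (5, 7), (6,
    8)]"

text \<open>Nothing about the origin of this tree has to be trusted, since
  \<open>check_cert0\<close> evaluates the checker on it.\<close>

definition cert0 where "cert0 =
Branch (Branch (Branch (NoC4 5) (Branch (Unsorted 3) (Branch (Branch (Branch (NoC4 6) (Branch (Unsorted 3) (Branch (Branch (NoC4 7) (Branch (NoC4 7) (NoC4 5))) (Branch
(Unsorted 1) (Branch (Branch (Branch (Branch (NoC4 8) (Branch (NoC4 8) (NoC4 6))) (Branch (Unsorted 1) (Branch (Branch (Branch (Branch (NoC4 1) (Branch (NoC4 1) (Branch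
(NoC4 2) (Branch (NoC4 2) (Branch (Branch (NoC4 5) (Branch (NoC4 6) (Exc 3 [0,1,2,3,4,5,6,7,8]))) (Branch (NoC4 5) (Branch (NoC4 6) (Exc 4
[0,3,4,1,2,7,8,5,6])))))))) (Branch (NoC4 1) (Branch (NoC4 1) (Branch (NoC4 2) (Branch (NoC4 2) (Branch (Branch (NoC4 5) (Branch (NoC4 6)
(Exc 4 [0,1,2,3,4,5,6,7,8]))) (Branch (NoC4 5) (Branch (NoC4 6) (Exc 5 [0,1,2,3,4,5,6,7,8]))))))))) (NoC4 6)) (NoC4
6)))) (NoC4 5)) (NoC4 5)))))) (Branch (Branch (NoC4 6) (Branch (Branch (NoC4 7) (Branch (NoC4 7) (NoC4 5))) (Branch (Branch (NoC4 7) (NoC4 5))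
(Branch (Branch (Branch (Branch (NoC4 8) (NoC4 6)) (Branch (Branch (NoC4 8) (Branch (Branch (Branch (NoC4 1) (Branch (NoC4 1) (Branch (NoC4 2) (Branch (NoC4 2)
(Branch (Branch (NoC4 5) (Branch (NoC4 6) (Exc 2 [0,1,5,8,7,3,4,6,2]))) (NoC4 1)))))) (Branch (Branch (NoC4 1) (Branch (NoC4 3) (Branch (Branch
(NoC4 3) (Branch (NoC4 5) (Branch (NoC4 6) (Exc 2 [0,1,6,7,8,2,4,5,3])))) (NoC4 1)))) (Branch (Branch (Branch (NoC4 2) (Branch (NoC4 3)
(Branch (NoC4 5) (Branch (NoC4 6) (Exc 1 [0,1,6,7,8,2,3,5,4]))))) (NoC4 1)) (Branch (NoC4 2) (NoC4 4))))) (NoC4 6))) (NoC4 6)))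
(NoC4 5)) (NoC4 5))))) (Branch (Unsorted 3) (Branch (Branch (NoC4 7) (Branch (NoC4 7) (NoC4 5))) (Branch (Branch (NoC4 7) (NoC4 5)) (Branch (Branch (Branch
(Branch (NoC4 8) (Branch (NoC4 8) (Branch (Unsorted 3) (Branch (NoC4 1) (Branch (NoC4 1) (Branch (NoC4 1) (Branch (Branch (Branch (Branch (NoC4 5) (Branch (Exc 3
[7,3,4,6,8,0,2,5,1]) (Exc 4 [7,6,8,3,4,5,1,0,2]))) (Branch (NoC4 5) (Branch (Exc 4 [7,3,4,6,8,0,2,5,1]) (Exc 5
[7,3,4,6,8,0,2,5,1])))) (NoC4 1)) (NoC4 1)))))))) (Branch (Branch (NoC4 8) (Branch (Unsorted 3) (Branch (NoC4 1) (Branch (Branch (NoC4 1)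
(Branch (NoC4 2) (Branch (Branch (Branch (NoC4 5) (Branch (Exc 2 [1,0,4,7,8,5,6,2,3]) (NoC4 3))) (NoC4 6)) (NoC4 1)))) (Branch (Branch (Branch
(NoC4 2) (Branch (Branch (NoC4 5) (Branch (Exc 2 [1,0,3,7,8,5,6,2,4]) (NoC4 3))) (NoC4 6))) (NoC4 1)) (NoC4 2)))))) (Branch (Branch
(NoC4 8) (Branch (Branch (NoC4 1) (Branch (NoC4 1) (Branch (NoC4 2) (Branch (Branch (Branch (NoC4 5) (Branch (Exc 0 [0,2,1,5,6,8,7,3,4]) (NoC4
2))) (NoC4 1)) (NoC4 6))))) (Branch (NoC4 1) (Branch (NoC4 1) (NoC4 3))))) (Branch (Unsorted 3) (Branch (NoC4 1) (Branch (NoC4 1) (Branch (NoC4 1)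
(NoC4 2)))))))) (NoC4 5)) (NoC4 5))))))) (Branch (Unsorted 1) (Branch (Branch (Branch (Branch (NoC4 7) (Branch (NoC4 7) (NoC4 5))) (Branch (Unsorted 1)
(Branch (Branch (Branch (Branch (Branch (NoC4 8) (Branch (Unsorted 3) (Branch (Branch (NoC4 1) (Branch (NoC4 1) (Branch (NoC4 2) (Branch (NoC4 2) (Branch (Branch (NoC4 5)
(Branch (NoC4 6) (Exc 3 [0,1,2,3,4,5,8,7,6]))) (Branch (NoC4 5) (Branch (NoC4 6) (Exc 4 [0,3,4,1,2,7,6,5,8])))))))) (Branch
(NoC4 1) (Branch (NoC4 1) (Branch (NoC4 2) (Branch (NoC4 2) (Branch (Branch (NoC4 5) (Branch (NoC4 6) (Exc 4 [0,1,2,3,4,5,8,7,6]))) (Branch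
(NoC4 5) (Branch (NoC4 6) (Exc 5 [0,1,2,3,4,5,8,7,6]))))))))))) (NoC4 6)) (NoC4 6)) (NoC4 5)) (NoC4 5)))) (Branch (Branch (NoC4
7) (Branch (NoC4 7) (NoC4 5))) (Branch (Unsorted 1) (Branch (Branch (Branch (Branch (NoC4 8) (Branch (NoC4 8) (Branch (NoC4 8) (Branch (Branch (NoC4 1) (Branch
(NoC4 1) (Branch (NoC4 2) (Branch (Branch (Branch (NoC4 5) (Branch (Exc 0 [0,2,1,5,8,6,7,3,4]) (NoC4 2))) (NoC4 1)) (NoC4 6))))) (Branch
(NoC4 1) (Branch (NoC4 1) (NoC4 3))))))) (Branch (Unsorted 1) (Branch (Branch (NoC4 8) (Branch (Branch (NoC4 3) (Branch (Branch (NoC4 3) (Branch (Branch (NoC4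
3) (Branch (NoC4 5) (Branch (Exc 3 [5,1,2,6,8,0,4,7,3]) (Exc 4 [5,6,8,1,2,7,3,0,4])))) (NoC4 3))) (NoC4 3))) (Branch (NoC4
3) (Branch (Branch (NoC4 3) (Branch (Branch (NoC4 3) (Branch (NoC4 5) (Branch (Exc 4 [5,1,2,6,8,0,4,7,3]) (Exc 5
[5,1,2,6,8,0,4,7,3])))) (NoC4 3))) (NoC4 3))))) (Branch (Branch (Branch (Branch (NoC4 1) (Branch (NoC4 3) (Branch (Branch (NoC4 3) (Branch (NoC4
5) (Branch (Exc 2 [4,0,1,5,6,7,8,3,2]) (NoC4 1)))) (NoC4 3)))) (Branch (Branch (Branch (NoC4 2) (Branch (NoC4 3) (Branch (NoC4 5) (Branch
(Exc 2 [3,0,1,5,8,7,6,4,2]) (NoC4 1))))) (NoC4 4)) (Branch (NoC4 3) (NoC4 4)))) (Branch (Branch (NoC4 1) (NoC4 6)) (NoC4 8)))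
(Branch (Branch (NoC4 1) (Branch (Branch (NoC4 2) (NoC4 4)) (NoC4 3))) (Branch (NoC4 3) (Branch (Branch (NoC4 3) (NoC4 4)) (NoC4 3)))))))) (NoC4
5)) (NoC4 5))))) (Branch (Unsorted 3) (Branch (Branch (NoC4 7) (Branch (NoC4 7) (NoC4 5))) (Branch (Unsorted 1) (Branch (Branch (Branch (Branch (NoC4 8) (Branch
(NoC4 8) (Branch (Unsorted 3) (Branch (NoC4 1) (Branch (NoC4 1) (Branch (NoC4 1) (NoC4 2))))))) (Branch (Unsorted 1) (Branch (Branch (NoC4 8) (Branch (Branch
(NoC4 1) (Branch (Branch (NoC4 2) (NoC4 4)) (NoC4 3))) (Branch (NoC4 3) (Branch (Branch (NoC4 3) (NoC4 4)) (NoC4 3))))) (Branch (Unsorted 3) (Branch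
(NoC4 1) (Branch (NoC4 1) (NoC4 2))))))) (NoC4 5)) (NoC4 5)))))))))) (Branch (Unsorted 2) (Branch (Unsorted 3) (Branch (Branch (Branch (NoC4 6) (Branch
(Unsorted 3) (Branch (Branch (NoC4 7) (Branch (NoC4 7) (Branch (Unsorted 3) (Branch (NoC4 1) (Branch (NoC4 2) (Branch (Branch (Branch (NoC4 1) (Branch (NoC4 1) (Branch
(NoC4 1) (Branch (Branch (Branch (Branch (Branch (NoC4 6) (Exc 3 [8,3,4,5,7,0,2,6,1])) (Branch (NoC4 6) (Exc 4
[8,5,7,3,4,6,1,0,2]))) (Branch (Branch (NoC4 6) (Exc 4 [8,3,4,5,7,0,2,6,1])) (Branch (NoC4 6) (Exc 5
[8,3,4,5,7,0,2,6,1])))) (NoC4 1)) (NoC4 1))))) (NoC4 1)) (NoC4 1))))))) (Branch (Branch (NoC4 7) (Branch (Unsorted 3) (Branch (NoC4 1)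
(Branch (NoC4 2) (Branch (Branch (Branch (NoC4 1) (Branch (Branch (NoC4 1) (Branch (NoC4 2) (Branch (Branch (Branch (Branch (NoC4 6) (Exc 2
[1,0,4,8,7,6,5,2,3])) (NoC4 3)) (NoC4 5)) (NoC4 1)))) (Branch (Branch (Branch (NoC4 2) (Branch (Branch (Branch (NoC4 6) (Exc 2
[1,0,3,8,7,6,5,2,4])) (NoC4 3)) (NoC4 5))) (NoC4 1)) (NoC4 2)))) (NoC4 6)) (NoC4 6)))))) (Branch (Branch (NoC4 7) (Branch (NoC4
1) (Branch (Branch (NoC4 8) (NoC4 6)) (Branch (Branch (Branch (Branch (NoC4 1) (Branch (NoC4 1) (Branch (NoC4 2) (Branch (Branch (Branch (Branch (NoC4 6) (Exc 0
[0,2,1,6,5,7,8,3,4])) (NoC4 2)) (NoC4 1)) (NoC4 5))))) (Branch (NoC4 1) (Branch (NoC4 1) (NoC4 3)))) (NoC4 6)) (NoC4 6)))))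
(Branch (Unsorted 3) (Branch (NoC4 1) (Branch (NoC4 2) (Branch (Branch (Branch (NoC4 1) (Branch (NoC4 1) (Branch (NoC4 1) (NoC4 2)))) (NoC4 6)) (NoC4
6)))))))))) (Branch (Unsorted 2) (Branch (Unsorted 3) (Branch (Branch (NoC4 7) (Branch (Unsorted 2) (Branch (Unsorted 3) (Branch (NoC4 1) (Branch (Branch (NoC4 8) (Branch
(Unsorted 3) (NoC4 1))) (Branch (Unsorted 2) (NoC4 1))))))) (Branch (Branch (NoC4 7) (Branch (Unsorted 3) (Branch (NoC4 1) (Branch (NoC4 2) (Branch (Branch (NoC4
8) (Branch (NoC4 1) (Branch (NoC4 1) (Branch (Branch (Branch (Branch (Branch (Branch (Exc 3 [1,0,4,5,6,2,3,8,7]) (NoC4 2)) (NoC4 3)) (NoC4 7))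
(NoC4 8)) (NoC4 1)) (NoC4 7))))) (Branch (Unsorted 3) (NoC4 1))))))) (Branch (Unsorted 2) (Branch (Unsorted 3) (Branch (NoC4 1) (Branch (Branch (NoC4 8)
(Branch (Unsorted 3) (NoC4 1))) (Branch (Unsorted 2) (NoC4 1))))))))))) (Branch (Branch (Branch (NoC4 6) (Branch (Branch (NoC4 7) (Branch (Unsorted 2) (Branch (NoC4
7) (Branch (Branch (NoC4 8) (Branch (Unsorted 2) (Branch (Branch (NoC4 1) (Branch (NoC4 1) (Branch (NoC4 1) (Branch (Branch (Branch (Branch (Branch (NoC4 6) (Exc 3
[6,2,3,5,7,0,4,8,1])) (Branch (NoC4 6) (Exc 4 [6,5,7,2,3,8,1,0,4]))) (NoC4 1)) (NoC4 1)) (Branch (Branch (Branch (Branch (NoC4 6)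
(Exc 4 [6,2,3,5,7,0,4,8,1])) (Branch (NoC4 6) (Exc 5 [6,2,3,5,7,0,4,8,1]))) (NoC4 1)) (NoC4 1)))))) (NoC4 6))))
(NoC4 6))))) (Branch (Branch (NoC4 7) (Branch (NoC4 7) (Branch (Branch (NoC4 2) (Branch (NoC4 8) (Branch (Branch (NoC4 1) (Branch (NoC4 1) (Branch (Branch (Branch
(NoC4 2) (Branch (Branch (Branch (NoC4 6) (Exc 0 [0,4,1,8,5,7,6,2,3])) (NoC4 3)) (NoC4 5))) (NoC4 1)) (NoC4 2)))) (NoC4 6))))
(NoC4 6)))) (Branch (Unsorted 2) (Branch (Branch (Branch (NoC4 8) (Branch (Unsorted 2) (Branch (Branch (Branch (NoC4 1) (Branch (NoC4 1) (Branch (Branch (NoC4 2) (Branch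
(Branch (Branch (NoC4 6) (Exc 2 [1,0,3,6,7,8,5,4,2])) (NoC4 2)) (NoC4 1))) (NoC4 7)))) (Branch (Branch (NoC4 1) (Branch (Branch (Branch (NoC4
3) (Branch (Branch (NoC4 6) (Exc 2 [1,0,2,6,7,8,5,4,3])) (NoC4 2))) (NoC4 1)) (NoC4 7))) (NoC4 4))) (NoC4 6)))) (NoC4 6))
(Branch (Branch (NoC4 8) (Branch (Unsorted 2) (Branch (Branch (NoC4 1) (Branch (NoC4 1) (NoC4 4))) (NoC4 6)))) (NoC4 6))))))) (Branch (Unsorted 3) (Branch
(Branch (NoC4 7) (Branch (NoC4 7) (Branch (Unsorted 3) (Branch (NoC4 1) (Branch (NoC4 2) (Branch (Branch (NoC4 8) (Branch (NoC4 1) (Branch (NoC4 1) (Branch (Branch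
(Branch (Branch (Branch (Branch (Exc 3 [1,0,4,5,7,2,3,8,6]) (NoC4 1)) (Branch (Exc 4 [1,5,7,0,4,8,6,2,3]) (NoC4 1))) (NoC4 6))
(NoC4 8)) (NoC4 1)) (NoC4 6))))) (Branch (Unsorted 3) (NoC4 1)))))))) (Branch (Branch (NoC4 7) (Branch (Unsorted 3) (Branch (NoC4 1) (Branch (NoC4 2)
(Branch (Branch (NoC4 8) (Branch (NoC4 2) (Branch (Branch (Branch (NoC4 2) (Branch (Branch (Branch (Branch (Exc 3 [2,0,4,6,7,1,3,8,5]) (NoC4 1)) (NoC4
3)) (NoC4 5)) (NoC4 5))) (NoC4 8)) (NoC4 2)))) (Branch (Unsorted 3) (NoC4 2))))))) (Branch (Branch (NoC4 7) (Branch (Branch (NoC4 8) (Branch (NoC4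
8) (Branch (NoC4 8) (Branch (NoC4 1) (Branch (NoC4 1) (Branch (Branch (Branch (Branch (Branch (Branch (Exc 3 [1,0,4,5,8,2,3,7,6]) (NoC4 3)) (NoC4
2)) (NoC4 6)) (NoC4 7)) (NoC4 1)) (NoC4 6))))))) (Branch (Branch (NoC4 8) (Branch (NoC4 8) (Branch (NoC4 2) (Branch (Branch (Branch (NoC4 2) (Branch
(Branch (Branch (Branch (Exc 3 [2,0,4,6,8,1,3,7,5]) (Exc 4 [2,6,8,0,4,7,5,1,3])) (NoC4 2)) (NoC4 5)) (NoC4 5))) (NoC4 7))
(NoC4 2))))) (Branch (Branch (NoC4 8) (Branch (Branch (NoC4 1) (Branch (Branch (NoC4 2) (Branch (Branch (Branch (Branch (Exc 3 [3,0,4,7,8,1,2,6,5])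
(NoC4 1)) (NoC4 2)) (NoC4 5)) (NoC4 5))) (NoC4 6))) (NoC4 3))) (Branch (Branch (Branch (NoC4 1) (Branch (NoC4 1) (NoC4 6))) (Branch (Branch
(NoC4 1) (NoC4 7)) (NoC4 8))) (Branch (NoC4 1) (NoC4 3))))))) (Branch (Unsorted 3) (Branch (NoC4 1) (Branch (NoC4 2) (Branch (Branch (NoC4 8) (Branch
(NoC4 1) (NoC4 3))) (Branch (Unsorted 3) (NoC4 1))))))))))) (Branch (Unsorted 2) (Branch (Unsorted 3) (Branch (Branch (NoC4 7) (Branch (Unsorted 2) (Branch (Unsorted
3) (Branch (NoC4 1) (Branch (Branch (NoC4 8) (Branch (Unsorted 3) (NoC4 1))) (Branch (Unsorted 2) (NoC4 1))))))) (Branch (Branch (NoC4 7) (Branch (Unsorted 3)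
(Branch (NoC4 1) (Branch (NoC4 2) (Branch (Branch (NoC4 8) (Branch (NoC4 1) (NoC4 3))) (Branch (Unsorted 3) (NoC4 1))))))) (Branch (Unsorted 2) (Branch (Unsorted
3) (Branch (NoC4 1) (Branch (NoC4 2) (Branch (Unsorted 2) (NoC4 1))))))))))))))) (Branch (Unsorted 1) (Branch (Unsorted 2) (Branch (Unsorted 3) (Branch (Branch
(Branch (NoC4 6) (Branch (Unsorted 3) (Branch (Branch (NoC4 7) (Branch (NoC4 7) (Branch (Unsorted 3) (Branch (NoC4 1) (Branch (NoC4 2) (Branch (Branch (Branch (NoC4 1)
(Branch (NoC4 1) (Branch (NoC4 1) (NoC4 2)))) (NoC4 6)) (NoC4 6))))))) (Branch (Unsorted 1) (Branch (Branch (NoC4 7) (Branch (NoC4 1) (Branch (Unsorted 1)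
(Branch (Branch (Branch (Branch (NoC4 1) (Branch (Branch (NoC4 2) (NoC4 4)) (NoC4 3))) (Branch (NoC4 3) (Branch (Branch (NoC4 3) (NoC4 4)) (NoC4 3))))
(NoC4 6)) (NoC4 6))))) (Branch (Unsorted 3) (Branch (NoC4 1) (Branch (Unsorted 1) (Branch (Branch (Branch (NoC4 1) (Branch (NoC4 1) (NoC4 2))) (NoC4 6))
(NoC4 6)))))))))) (Branch (Unsorted 2) (Branch (Unsorted 3) (Branch (Branch (NoC4 7) (Branch (Unsorted 2) (Branch (Unsorted 3) (Branch (NoC4 1) (Branch (Branch (NoC4 8)
(Branch (Unsorted 3) (NoC4 1))) (Branch (Unsorted 2) (NoC4 1))))))) (Branch (Branch (NoC4 7) (Branch (Unsorted 3) (Branch (NoC4 1) (Branch (NoC4 2) (Branch (Branch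
(NoC4 8) (Branch (NoC4 1) (NoC4 3))) (Branch (Unsorted 3) (NoC4 1))))))) (Branch (Unsorted 2) (Branch (Unsorted 3) (Branch (NoC4 1) (Branch (NoC4 2) (Branch
(Unsorted 2) (NoC4 1))))))))))) (Branch (Unsorted 1) (Branch (Unsorted 2) (Branch (Unsorted 3) (Branch (Branch (NoC4 7) (Branch (Unsorted 2) (Branch (Unsorted 3) (Branch
(NoC4 1) (Branch (NoC4 2) (Branch (Unsorted 2) (NoC4 1))))))) (Branch (Unsorted 1) (Branch (Unsorted 2) (Branch (Unsorted 3) (Branch (NoC4 1) (Branch (Unsorted 1) (Branch
(Unsorted 2) (Branch (Unsorted 3) (Disc))))))))))))))))"

lemma check_cert0: "check_cert es0 T0 M0 cert0"
  by code_simp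

section \<open>Soundness of the checker\<close>

lemma all_less_9: "(\<forall>i<9. P i) \<longleftrightarrow> P 0 \<and> P 1 \<and> P 2 \<and> P 3 \<and> P 4 \<and> P 5 \<and> P 6 \<and> P 7 \<and> P (8::nat)"
  by (simp add: numeral_eq_Suc All_less_Suc conj_ac)

lemma no_common_D: "no_common b x y \<Longrightarrow> i < length b \<Longrightarrow> i < length x \<Longrightarrow> i < length y \<Longrightarrow> \<not> (b!i \<and> x!i \<and> y!i)"
  by (induction b x y arbitrary: i rule: no_common.induct) (auto simp: less_Suc_eq_0_disj)

lemma le1_common_D: "le1_common b x y \<Longrightarrow> i < j \<Longrightarrow> j < length b \<Longrightarrow> j < length x \<Longrightarrow> j < length y \<Longrightarrow>
    \<not> (b!i \<and> x!i \<and> y!i \<and> b!j \<and> x!j \<and> y!j)"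
proof (induction b x y arbitrary: i j rule: le1_common.induct)
  case (1 b bs x xs y ys)
  obtain j' where j: "j = Suc j'" using 1(3) by (cases j) auto
  show ?case
  proof (cases i)
    case 0
    then show ?thesis using 1 j no_common_D[of bs xs ys j'] by (auto split: if_splits)
  next
    case (Suc i')
    then show ?thesis using 1 j no_common_D[of bs xs ys j'] by (auto split: if_splits)
  qed
qed auto

definition square :: "bool list list \<Rightarrow> bool" where
  "square M \<longleftrightarrow> length M = 9 \<and> (\<forall>i<9. length (M!i) = 9)"

lemma set_entry_nth: assumes "square M" "i < 9" "j < 9" "k < 9" "l < 9"
  shows "set_entry c i j M ! k ! l = (if (k = i \<and> l = j) \<or> (k = j \<and> l = i) then c else M!k!l)"
  using assms unfolding square_def set_entry_def Let_def by (auto simp: nth_list_update)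

lemma set_entry_square: "square M \<Longrightarrow> i < 9 \<Longrightarrow> j < 9 \<Longrightarrow> square (set_entry c i j M)"
  unfolding square_def set_entry_def Let_def by (auto simp: nth_list_update)

text \<open>The first entry is the most significant bit, so for rows of equal length the numerical
  order is the lexicographic one.\<close>

fun bits_val :: "bool list \<Rightarrow> nat" where
  "bits_val [] = 0"
| "bits_val (b#bs) = (if b then 2 ^ length bs else 0) + bits_val bs"

lemma bits_val_less: "bits_val bs < 2 ^ length bs"
  by (induction bs) auto

lemma lex_less_bits_val:
  "lex_less t m t' m' \<Longrightarrow> list_all2 (\<longrightarrow>) t r \<Longrightarrow> list_all2 (\<longrightarrow>) r m \<Longrightarrow> list_all2 (\<longrightarrow>) t' r' \<Longrightarrow>
    list_all2 (\<longrightarrow>) r' m' \<Longrightarrow> length r = length r' \<Longrightarrow> bits_val r < bits_val r'"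
proof (induction t m t' m' arbitrary: r r' rule: lex_less.induct)
  case (1 t ts m ms t' ts' m' ms')
  obtain b bs where r: "r = b # bs" using 1(4) by (cases r) auto
  obtain b' bs' where r': "r' = b' # bs'" using 1(6) by (cases r') auto
  have e: "b = t" "b' = t'" "t = m" "t' = m'" using 1(3-7) r r' by auto
  have l: "length bs = length bs'" using 1(8) r r' by simp
  have smaller_bad: "bits_val bs < bits_val bs'" if "lex_less ts ms ts' ms'"
    using 1 r r' e l that by (cases t) auto
  show ?case using 1(3) e r r' l smaller_bad bits_val_less[of bs] by (auto split: if_splits)
qed auto

definition row_key :: "(nat \<Rightarrow> nat \<Rightarrow> bool) \<Rightarrow> nat \<Rightarrow> nat" where
  "row_key a i = bits_val (map (a i) [5..<9])"

text \<open>At each branch the proof follows the actual value of \<open>a i j\<close>. The leaves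
  \<open>NoC4\<close>, \<open>Unsorted\<close> and \<open>Disc\<close> contradict \<open>C4\<close>,
  \<open>srt\<close> and \<open>con\<close>, so the path ends in an \<open>Exc\<close> leaf.\<close>

lemma check_cert_sound:
  assumes sym: "\<And>i j. a i j \<longleftrightarrow> a j i"
    and C4: "\<And>u. u < 9 \<Longrightarrow> \<exists>w x y z. {w, x, y, z} \<subseteq> {..<9} \<and> distinct [w, x, y, z] \<and>
       a w x \<and> a x y \<and> a y z \<and> a z w \<and> (\<forall>s\<in>{w, x, y, z}. s \<noteq> u \<and> \<not> a u s)"
    and srt: "\<And>i. i \<in> {1, 2, 3} \<Longrightarrow> row_key a (Suc i) \<le> row_key a i"
    and con: "\<exists>i\<in>{1..4}. \<exists>j\<in>{5..8}. a i j"
  shows "check_cert es T M c \<Longrightarrow> \<forall>(i, j)\<in>set es. i < 9 \<and> j < 9 \<Longrightarrow> square T \<Longrightarrow> square M \<Longrightarrow>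
     (\<And>i j. i < 9 \<Longrightarrow> j < 9 \<Longrightarrow> (T!i!j \<longrightarrow> a i j) \<and> (a i j \<longrightarrow> M!i!j)) \<Longrightarrow>
     \<exists>g q. g < 6 \<and> length q = 9 \<and> distinct q \<and> set q \<subseteq> {..<9} \<and>
       (\<forall>i<9. \<forall>j<9. a (q!i) (q!j) \<longleftrightarrow> exc_mats!g!i!j)"
proof (induction es T M c rule: check_cert.induct)
  case (1 i j es T M c d)
  have ij: "i < 9" "j < 9" and es: "\<forall>(i, j)\<in>set es. i < 9 \<and> j < 9" using 1(4) by auto
  show ?case
  proof (cases "a i j")
    case True
    show ?thesis
      by (rule 1(1)) (use True 1(3-7) ij es sym in \<open>auto simp: set_entry_nth set_entry_square\<close>)
  next
    case False
    show ?thesis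
      by (rule 1(2)) (use False 1(3-7) ij es sym in \<open>auto simp: set_entry_nth set_entry_square\<close>)
  qed
next
  case (2 es T M u)
  have u: "u < 9" and n: "C4_free (map Not ((T!u)[u := True])) M" using 2(1) by auto
  obtain w x y z where *: "{w, x, y, z} \<subseteq> {..<9}" "distinct [w, x, y, z]"
       "a w x" "a x y" "a y z" "a z w" "\<forall>s\<in>{w, x, y, z}. s \<noteq> u \<and> \<not> a u s"
    using C4[OF u] by blast
  let ?R = "map Not ((T!u)[u := True])"
  have lR: "length ?R = 9" and lM: "length M = 9" using 2(3,4) u unfolding square_def by auto
  have lr: "length (M!i) = 9" if "i < 9" for i using that 2(4) unfolding square_def by auto
  have R: "?R!s" if "s \<in> {w, x, y, z}" for s
    using that * 2(5)[of u s] u 2(3) unfolding square_def by (auto simp: nth_list_update)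
  have Ma: "M!i!j" if "a i j" "i < 9" "j < 9" for i j using 2(5) that by blast
  have pair: "le1_common ?R (M!i) (M!j)" if "i < j" "i \<in> {w, x, y, z}" "j \<in> {w, x, y, z}" for i j
  proof -
    have "i < 9" "j < 9" using that *(1) by auto
    then have "le1_common ?R (map2 (\<lambda>b r. if b then r else []) ?R M ! i) (map2 (\<lambda>b r. if b then r else []) ?R M ! j)"
      using n that(1) lR lM unfolding C4_free_def sorted_wrt_iff_nth_less by simp
    then show ?thesis using R[OF that(2)] R[OF that(3)] \<open>i < 9\<close> \<open>j < 9\<close> lR lM by simp
  qed
  have no: False if "i < j" "k < l" "i \<in> {w, x, y, z}" "j \<in> {w, x, y, z}" "k \<in> {w, x, y, z}" "l \<in> {w, x, y, z}"
     "a i k" "a i l" "a j k" "a j l" for i j k l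
  proof -
    have "i < 9" "j < 9" "k < 9" "l < 9" using that *(1) by auto
    moreover from this have "M!i!k" "M!i!l" "M!j!k" "M!j!l" using Ma that(7-10) by blast+
    ultimately show False
      using le1_common_D[OF pair[OF that(1,3,4)] that(2)] R[OF that(5)] R[OF that(6)] lR lr by simp
  qed
  \<comment> \<open>\<open>no\<close> wants increasing indices, so the two pairs of opposite
    vertices are put in order.\<close>
  have "w < y \<or> y < w" "x < z \<or> z < x" using *(2) by auto
  then have False
    using no[of w y x z] no[of w y z x] no[of y w x z] no[of y w z x] *(3-6) sym[of x w] sym[of y x] sym[of z y] sym[of w z]
    by auto
  then show ?case ..
next
  case (3 es T M i)
  have i: "i \<in> {1, 2, 3}" and o: "lex_less (drop 5 (T!i)) (drop 5 (M!i)) (drop 5 (T!Suc i)) (drop 5 (M!Suc i))"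
    using 3(1) by auto
  have all2: "list_all2 (\<longrightarrow>) (drop 5 (T!k)) (map (a k) [5..<9])" "list_all2 (\<longrightarrow>) (map (a k) [5..<9]) (drop 5 (M!k))"
    if "k < 9" for k
    using that 3(3-5) unfolding square_def by (auto simp: list_all2_conv_all_nth simp del: upt_rec_numeral)
  have "row_key a i < row_key a (Suc i)"
    unfolding row_key_def by (rule lex_less_bits_val[OF o]) (use i all2 in auto)
  then show ?case using srt[OF i] by simp
next
  case (4 es T M g q)
  have g: "g < 6" "length q = 9" "distinct q" "set q \<subseteq> {..<9}" "T = M"
    "exc_mats!g = map (\<lambda>i. map (\<lambda>j. T!i!j) q) q"
    using 4(1) by (auto simp: list_all_iff)
  have "a (q!i) (q!j) \<longleftrightarrow> exc_mats!g!i!j" if "i < 9" "j < 9" for i j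
  proof -
    have "q!i < 9" "q!j < 9" using g(2,4) that nth_mem[of i q] nth_mem[of j q] by (metis lessThan_iff subsetD)+
    then show ?thesis using 4(5)[of "q!i" "q!j"] g that by auto
  qed
  then show ?case using g(1-4) by blast
next
  case (5 es T M)
  obtain i j where ij: "i \<in> {1..4}" "j \<in> {5..8}" "a i j" using con by blast
  have "M!i!j" using 5(5)[of i j] ij by auto
  have l: "length M = 9" "length (M!i) = 9" using 5(4) ij unfolding square_def by auto
  have "take 4 (drop 1 M) ! (i - 1) = M!i" using l ij by (cases i) auto
  moreover have "i - 1 < length (take 4 (drop 1 M))" using l ij by auto
  ultimately have "M!i \<in> set (take 4 (drop 1 M))" by (metis nth_mem)
  moreover have "drop 5 (M!i) ! (j - 5) = True" "j - 5 < length (drop 5 (M!i))" using l ij \<open>M!i!j\<close> by auto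
  then have "True \<in> set (drop 5 (M!i))" by (metis nth_mem)
  ultimately show ?case using 5(1) by (auto simp: list_all_iff)
qed auto

section \<open>Properties of the exceptional graphs\<close>

definition mat_deg :: "bool list list \<Rightarrow> nat \<Rightarrow> nat" where
  "mat_deg G i = length (filter (\<lambda>j. G!i!j) [0..<9])"

text \<open>An executable form of \<open>nine\<close> on matrices, with quantifiers over a list of
  the nine indices.\<close>

definition check_nine :: "bool list list \<Rightarrow> bool" where
  "check_nine G \<longleftrightarrow> (let V = [0..<9] in
    list_all (\<lambda>y. 3 \<le> mat_deg G y \<and> mat_deg G y \<le> 4 \<and> list_ex (\<lambda>v. v \<noteq> y \<and> \<not> G!v!y \<and> mat_deg G v = 4) V) V \<and>
    list_all (\<lambda>v. list_all (\<lambda>x. G!v!x \<longrightarrow> (mat_deg G v = 3 \<longrightarrow> mat_deg G x = 4) \<and>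
       (mat_deg G v = 4 \<and> list_all (\<lambda>u. G!x!u \<longrightarrow> u = v \<or> G!v!u) V \<longrightarrow>
         mat_deg G x = 4 \<and> list_ex (\<lambda>w. list_all (\<lambda>s. s = v \<or> s = x \<or> s = w \<or> G!w!s \<or>
           list_ex (\<lambda>u. G!s!u \<and> u \<noteq> v \<and> \<not> G!v!u) V \<and>
           list_all (\<lambda>t. t = v \<or> t = x \<or> t = w \<or> G!w!t \<or> \<not> G!s!t) V) V) V)) V) V \<and>
    list_all (\<lambda>y. mat_deg G y = 3 \<longrightarrow> list_ex (\<lambda>y'. list_ex (\<lambda>w. y' \<noteq> y \<and> list_all (\<lambda>s. G!y'!s = G!y!s) V \<and>
       list_all (\<lambda>s. s = y \<or> s = y' \<or> G!y!s \<or> s = w \<or> G!w!s) V) V) V) V \<and>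
    (list_ex (\<lambda>y. mat_deg G y = 3) V \<longrightarrow> list_ex (\<lambda>u. mat_deg G u = 4 \<and> list_all (\<lambda>t. t = u \<or> G!u!t \<or> mat_deg G t = 4) V) V))"

lemma check_nine_exc_mats: "list_all check_nine exc_mats"
  by code_simp

lemma square_T0_M0: "square T0" "square M0" "\<forall>(i, j)\<in>set es0. i < 9 \<and> j < 9"
    apply (simp add: square_def all_less_9 T0_def adj_mat_def)
   apply (simp add: square_def all_less_9 M0_def adj_mat_def)
  apply (simp add: es0_def)
  done

context adjacency begin

definition exceptional9 :: "'a set \<Rightarrow> bool" where
  "exceptional9 S \<longleftrightarrow> (\<exists>f g. g < 6 \<and> bij_betw f {..<9::nat} S \<and> (\<forall>i<9. \<forall>j<9. adj (f i) (f j) \<longleftrightarrow> exc_mats!g!i!j))"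

text \<open>All clauses of \<open>nine\<close> speak of adjacency only, so they carry over along the
  labelling from the evaluated test \<open>check_nine\<close>.\<close>

lemma exceptional9_nine: assumes "exceptional9 S" shows "nine S"
proof -
  obtain f g where g: "g < 6" and f: "bij_betw f {..<9::nat} S"
    and a: "\<And>i j. i < 9 \<Longrightarrow> j < 9 \<Longrightarrow> adj (f i) (f j) \<longleftrightarrow> exc_mats!g!i!j"
    using assms unfolding exceptional9_def by blast
  let ?G = "exc_mats!g"
  have lG: "length exc_mats = 6" by (simp add: exc_mats_def)
  have c: "check_nine ?G" using check_nine_exc_mats g lG by (simp add: list_all_length)
  have S: "S = f ` {..<9}" and inj: "inj_on f {..<9}" using f unfolding bij_betw_def by auto
  have ball: "(\<forall>y\<in>S. P y) \<longleftrightarrow> (\<forall>i<9. P (f i))" for P unfolding S by auto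
  have bex: "(\<exists>y\<in>S. P y) \<longleftrightarrow> (\<exists>i<9. P (f i))" for P unfolding S by auto
  have eq: "f i = f j \<longleftrightarrow> i = j" if "i < 9" "j < 9" for i j using inj that by (auto dest: inj_onD)
  have nbrs: "nbrs S (f i) = f ` {j. j < 9 \<and> ?G!i!j}" if "i < 9" for i
    unfolding nbrs_def S using a that by auto
  have deg: "deg S (f i) = mat_deg ?G i" if i: "i < 9" for i
  proof -
    have "deg S (f i) = card {j. j < 9 \<and> ?G!i!j}"
      unfolding nbrs[OF i] by (rule card_image) (rule inj_on_subset[OF inj], auto)
    also have "{j. j < 9 \<and> ?G!i!j} = set (filter (\<lambda>j. ?G!i!j) [0..<9])" by auto
    also have "card \<dots> = mat_deg ?G i" unfolding mat_deg_def by (rule distinct_card) simp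
    finally show ?thesis .
  qed
  have la: "list_all P [0..<9] \<longleftrightarrow> (\<forall>i<9. P i)" for P by (auto simp: list_all_iff)
  have le: "list_ex P [0..<9] \<longleftrightarrow> (\<exists>i<9. P i)" for P by (auto simp: list_ex_iff)
  note c' = c[unfolded check_nine_def Let_def la le]
  have c1: "\<forall>y<9. 3 \<le> mat_deg ?G y \<and> mat_deg ?G y \<le> 4" and c2: "\<forall>y<9. \<exists>v<9. v \<noteq> y \<and> \<not> ?G!v!y \<and> mat_deg ?G v = 4"
    using conjunct1[OF c'] by simp_all
  have c3: "\<forall>v<9. \<forall>x<9. ?G!v!x \<longrightarrow> (mat_deg ?G v = 3 \<longrightarrow> mat_deg ?G x = 4) \<and>
       (mat_deg ?G v = 4 \<and> (\<forall>u<9. ?G!x!u \<longrightarrow> u = v \<or> ?G!v!u) \<longrightarrow>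
         mat_deg ?G x = 4 \<and> (\<exists>w<9. \<forall>s<9. s = v \<or> s = x \<or> s = w \<or> ?G!w!s \<or>
           (\<exists>u<9. ?G!s!u \<and> u \<noteq> v \<and> \<not> ?G!v!u) \<and>
           (\<forall>t<9. t = v \<or> t = x \<or> t = w \<or> ?G!w!t \<or> \<not> ?G!s!t)))"
    by (rule conjunct1[OF conjunct2[OF c']])
  have c4: "\<forall>y<9. mat_deg ?G y = 3 \<longrightarrow> (\<exists>y'<9. \<exists>w<9. y' \<noteq> y \<and> (\<forall>s<9. ?G!y'!s = ?G!y!s) \<and>
       (\<forall>s<9. s = y \<or> s = y' \<or> ?G!y!s \<or> s = w \<or> ?G!w!s))"
    by (rule conjunct1[OF conjunct2[OF conjunct2[OF c']]])
  have c5: "(\<exists>y<9. mat_deg ?G y = 3) \<longrightarrow> (\<exists>u<9. mat_deg ?G u = 4 \<and> (\<forall>t<9. t = u \<or> ?G!u!t \<or> mat_deg ?G t = 4))"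
    by (rule conjunct2[OF conjunct2[OF conjunct2[OF c']]])
  have "finite S" "card S = 9" using S inj by (auto simp: card_image)
  moreover have "\<forall>y\<in>S. 3 \<le> deg S y \<and> deg S y \<le> 4" unfolding ball using c1 deg by simp
  moreover have "\<forall>y\<in>S. \<exists>v\<in>S. v \<noteq> y \<and> \<not> adj v y \<and> deg S v = 4"
    unfolding ball bex using c2 deg a eq by metis
  moreover have "\<forall>v\<in>S. \<forall>x\<in>S. adj v x \<longrightarrow> (deg S v = 3 \<longrightarrow> deg S x = 4) \<and>
       (deg S v = 4 \<and> nbrs S x \<subseteq> nbhd {v} \<longrightarrow> deg S x = 4 \<and> (\<exists>w\<in>S. \<forall>s\<in>S - {v, x} - nbhd {w}.
          (\<exists>u\<in>S. adj s u \<and> u \<notin> nbhd {v}) \<and> (\<forall>t\<in>S - {v, x} - nbhd {w}. \<not> adj s t)))"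
    unfolding ball
  proof (intro allI impI)
    fix v x :: nat assume vx: "v < 9" "x < 9" "adj (f v) (f x)"
    then have G: "?G!v!x" using a by simp
    have 1: "mat_deg ?G v = 3 \<longrightarrow> mat_deg ?G x = 4" using c3 vx G by blast
    have 2: "deg S (f x) = 4 \<and> (\<exists>w\<in>S. \<forall>s\<in>S - {f v, f x} - nbhd {w}.
          (\<exists>u\<in>S. adj s u \<and> u \<notin> nbhd {f v}) \<and> (\<forall>t\<in>S - {f v, f x} - nbhd {w}. \<not> adj s t))"
      if d: "deg S (f v) = 4" and n: "nbrs S (f x) \<subseteq> nbhd {f v}"
    proof -
      have "u = v \<or> ?G!v!u" if u: "u < 9" "?G!x!u" for u
      proof -
        have "f u \<in> nbrs S (f x)" unfolding nbrs[OF vx(2)] using u by auto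
        then show ?thesis using n eq a vx u by (auto simp: in_nbhd_single)
      qed
      moreover have "mat_deg ?G v = 4" using d deg vx by simp
      ultimately obtain w where w: "mat_deg ?G x = 4" "w < 9" "\<forall>s<9. s = v \<or> s = x \<or> s = w \<or> ?G!w!s \<or>
           (\<exists>u<9. ?G!s!u \<and> u \<noteq> v \<and> \<not> ?G!v!u) \<and>
           (\<forall>t<9. t = v \<or> t = x \<or> t = w \<or> ?G!w!t \<or> \<not> ?G!s!t)"
        using c3 vx(1,2) G by blast
      let ?M = "S - {f v, f x} - nbhd {f w}"
      have M: "\<exists>i<9. s = f i \<and> \<not> (i = v \<or> i = x \<or> i = w \<or> ?G!w!i)" if s: "s \<in> ?M" for s
      proof -
        obtain i where i: "i < 9" "s = f i" using s unfolding S by auto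
        then show ?thesis using s a w(2) by (intro exI[of _ i]) (auto simp: in_nbhd_single)
      qed
      have "(\<exists>u\<in>S. adj s u \<and> u \<notin> nbhd {f v}) \<and> (\<forall>t\<in>?M. \<not> adj s t)" if s: "s \<in> ?M" for s
      proof -
        obtain i where i: "i < 9" "s = f i" "\<not> (i = v \<or> i = x \<or> i = w \<or> ?G!w!i)" using M[OF s] by blast
        then obtain u where u: "u < 9" "?G!i!u" "u \<noteq> v" "\<not> ?G!v!u"
          and no: "\<forall>t<9. t = v \<or> t = x \<or> t = w \<or> ?G!w!t \<or> \<not> ?G!i!t" using w(3) by blast
        have "f u \<in> S" "adj s (f u)" "f u \<notin> nbhd {f v}"
          using u i a eq vx(1) unfolding S by (auto simp: in_nbhd_single)
        moreover have "\<not> adj s t" if "t \<in> ?M" for t using M[OF that] no a i(1,2) by blast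
        ultimately show ?thesis by blast
      qed
      moreover have "f w \<in> S" using w(2) unfolding S by auto
      ultimately show ?thesis using w(1) deg[OF vx(2)] by auto
    qed
    show "(deg S (f v) = 3 \<longrightarrow> deg S (f x) = 4) \<and>
      (deg S (f v) = 4 \<and> nbrs S (f x) \<subseteq> nbhd {f v} \<longrightarrow> deg S (f x) = 4 \<and> (\<exists>w\<in>S. \<forall>s\<in>S - {f v, f x} - nbhd {w}.
          (\<exists>u\<in>S. adj s u \<and> u \<notin> nbhd {f v}) \<and> (\<forall>t\<in>S - {f v, f x} - nbhd {w}. \<not> adj s t)))"
      using 1 2 deg vx by auto
  qed
  moreover have "\<forall>y\<in>S. deg S y = 3 \<longrightarrow> (\<exists>y'\<in>S. \<exists>w\<in>S. y' \<noteq> y \<and> nbrs S y' = nbrs S y \<and>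
       S - {y, y'} \<subseteq> nbrs S y \<union> nbhd {w})"
    unfolding ball bex
  proof (intro allI impI)
    fix y :: nat assume y: "y < 9" "deg S (f y) = 3"
    obtain y' w where yw: "y' < 9" "w < 9" "y' \<noteq> y" "\<forall>s<9. ?G!y'!s = ?G!y!s"
       "\<forall>s<9. s = y \<or> s = y' \<or> ?G!y!s \<or> s = w \<or> ?G!w!s"
      using c4 y deg by metis
    have "nbrs S (f y') = nbrs S (f y)" unfolding nbrs[OF yw(1)] nbrs[OF y(1)] using yw(4) by auto
    moreover have "S - {f y, f y'} \<subseteq> nbrs S (f y) \<union> nbhd {f w}"
    proof
      fix t assume t: "t \<in> S - {f y, f y'}"
      then obtain s where s: "s < 9" "t = f s" unfolding S by auto
      then have "?G!y!s \<or> s = w \<or> ?G!w!s" using yw(5) t by blast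
      then show "t \<in> nbrs S (f y) \<union> nbhd {f w}"
        using s a y yw t unfolding nbrs_def by (auto simp: in_nbhd_single)
    qed
    moreover have "f y' \<noteq> f y" using eq yw y by simp
    ultimately show "\<exists>y'<9. \<exists>w<9. f y' \<noteq> f y \<and> nbrs S (f y') = nbrs S (f y) \<and> S - {f y, f y'} \<subseteq> nbrs S (f y) \<union> nbhd {f w}"
      using yw by blast
  qed
  moreover have "(\<exists>y\<in>S. deg S y = 3) \<longrightarrow> (\<exists>u\<in>S. deg S u = 4 \<and> (\<forall>t\<in>S - nbhd {u}. deg S t = 4))"
  proof
    assume "\<exists>y\<in>S. deg S y = 3"
    then have "\<exists>y<9. mat_deg ?G y = 3" unfolding bex using deg by auto
    then obtain u where u: "u < 9" "mat_deg ?G u = 4" "\<forall>t<9. t = u \<or> ?G!u!t \<or> mat_deg ?G t = 4" using c5 by blast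
    have "deg S t = 4" if t: "t \<in> S - nbhd {f u}" for t
    proof -
      obtain s where s: "s < 9" "t = f s" using t unfolding S by auto
      then have "s \<noteq> u" "\<not> ?G!u!s" using t a u(1) by (auto simp: in_nbhd_single)
      then show ?thesis using u(3) s deg by auto
    qed
    then show "\<exists>u\<in>S. deg S u = 4 \<and> (\<forall>t\<in>S - nbhd {u}. deg S t = 4)" unfolding bex using u deg by auto
  qed
  ultimately show ?thesis unfolding nine_def by blast
qed

text \<open>A labelling is chosen that meets the hypotheses of \<open>check_cert_sound\<close>. The
  4-cycle avoiding each closed neighbourhood exists because no single vertex isolates a bad graph of
  order 9.\<close>

lemma bad9_exceptional9:
  assumes b: "bad S" and c9: "card S = 9" and v: "v \<in> S" "deg S v = 4"
  shows "exceptional9 S"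
proof -
  have fS: "finite S" using bad_fin[OF b] .
  have C4: "has_C4 (S - nbhd {u})" for u
  proof (rule ccontr)
    assume "\<not> ?thesis"
    then have "iso_num S \<le> 1" using iso_num_le[of "{u}" S] by simp
    then show False using b c9 unfolding bad_def by simp
  qed
  have c4: "card (S - nbhd {v}) = 4" using card_diff_nbhd[OF fS v(1)] c9 v(2) by simp
  then obtain y0 where "y0 \<in> S - nbhd {v}" by (metis all_not_in_conv card.empty zero_neq_numeral)
  \<comment> \<open>The cycle is \<open>h5 h6 h7 h8\<close>; \<open>has_C4_opposite\<close> puts the
    vertex opposite to the first one last.\<close>
  then obtain h5 h6 h8 h7 where H: "S - nbhd {v} = {h5, h6, h8, h7}" "distinct [h5, h6, h8, h7]"
    "adj h5 h6" "adj h5 h8" "adj h7 h6" "adj h7 h8"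
    using has_C4_opposite[OF C4 c4] by metis
  define k where "k x = bits_val (map (adj x) [h5, h6, h7, h8])" for x
  have k16: "k x < 16" for x using bits_val_less[of "map (adj x) [h5, h6, h7, h8]"] unfolding k_def by simp
  obtain xs0 where xs0: "set xs0 = nbrs S v" "distinct xs0"
    using finite_distinct_list[OF nbrs_finite[OF fS]] by blast
  \<comment> \<open>The keys are below 16, so sorting by \<open>16 - k x\<close> puts the larger
    keys first.\<close>
  define xs where "xs = sort_key (\<lambda>x. 16 - k x) xs0"
  have xs: "set xs = nbrs S v" "distinct xs" "sorted (map (\<lambda>x. 16 - k x) xs)" unfolding xs_def using xs0 by auto
  have "length xs = 4" using distinct_card[OF xs(2)] xs(1) v(2) by simp
  then obtain x1 x2 x3 x4 where X: "xs = [x1, x2, x3, x4]"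
    by (auto simp: numeral_eq_Suc length_Suc_conv)
  have nbrs: "nbrs S v = {x1, x2, x3, x4}" using xs(1) X by auto
  have ks: "k x2 \<le> k x1" "k x3 \<le> k x2" "k x4 \<le> k x3"
    using xs(3) k16[of x1] k16[of x2] k16[of x3] k16[of x4] unfolding X by auto
  define l where "l = [v, x1, x2, x3, x4, h5, h6, h7, h8]"
  define f where "f i = l ! i" for i
  define a where "a i j = adj (f i) (f j)" for i j
  have Nv: "adj v x1" "adj v x2" "adj v x3" "adj v x4" using nbrs unfolding nbrs_def by blast+
  have Sl: "set l = S"
  proof -
    have "S = insert v (nbrs S v) \<union> (S - nbhd {v})" using v(1) unfolding diff_nbhd nbrs_def by auto
    then show ?thesis unfolding l_def nbrs H(1) by auto
  qed
  have ll: "length l = 9" unfolding l_def by simp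
  \<comment> \<open>Nine entries that cover nine vertices cannot repeat.\<close>
  have dl: "distinct l" using Sl ll c9 by (simp add: card_distinct)
  have bij: "bij_betw f {..<9} S"
    unfolding f_def bij_betw_def using dl ll Sl by (auto simp: inj_on_nth set_conv_nth)
  have nvh: "\<not> adj v h5" "\<not> adj v h6" "\<not> adj v h7" "\<not> adj v h8"
    using H(1) in_nbhd_single[of _ v] by blast+
  have f: "f 0 = v" "f 1 = x1" "f 2 = x2" "f 3 = x3" "f 4 = x4" "f 5 = h5" "f 6 = h6" "f 7 = h7" "f 8 = h8"
    unfolding f_def l_def by simp_all
  have T0: "T0!i!j \<longrightarrow> a i j" "a i j \<longrightarrow> M0!i!j" if "i < 9" "j < 9" for i j
  proof -
    have Nv': "adj x1 v" "adj x2 v" "adj x3 v" "adj x4 v" using Nv adj_sym by blast+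
    have H': "adj h6 h5" "adj h8 h5" "adj h6 h7" "adj h8 h7" using H adj_sym by blast+
    have nvh': "\<not> adj h5 v" "\<not> adj h6 v" "\<not> adj h7 v" "\<not> adj h8 v" using nvh adj_sym by blast+
    have "\<forall>i<9. \<forall>j<9. (T0!i!j \<longrightarrow> a i j) \<and> (a i j \<longrightarrow> M0!i!j)"
      unfolding all_less_9 a_def f T0_def M0_def adj_mat_def
      using Nv Nv' H(3-) H' nvh nvh' adj_irrefl by (simp add: upt_rec)
    then show "T0!i!j \<longrightarrow> a i j" "a i j \<longrightarrow> M0!i!j" using that by blast+
  qed
  have row_key: "row_key a i = k (f i)" for i
  proof -
    have "[5..<9] = [5, 6, 7, 8::nat]" by (simp add: upt_rec)
    then show ?thesis unfolding row_key_def k_def a_def by (simp add: f)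
  qed
  have "\<exists>g q. g < 6 \<and> length q = 9 \<and> distinct q \<and> set q \<subseteq> {..<9} \<and>
       (\<forall>i<9. \<forall>j<9. a (q!i) (q!j) \<longleftrightarrow> exc_mats!g!i!j)"
  proof (rule check_cert_sound[OF _ _ _ _ check_cert0 square_T0_M0(3,1,2)])
    show "a i j \<longleftrightarrow> a j i" for i j unfolding a_def using adj_sym by blast
    show "(T0!i!j \<longrightarrow> a i j) \<and> (a i j \<longrightarrow> M0!i!j)" if "i < 9" "j < 9" for i j using T0 that by blast
    show "row_key a (Suc i) \<le> row_key a i" if "i \<in> {1, 2, 3}" for i
      using that ks unfolding row_key by (auto simp: f numeral_eq_Suc[symmetric] eval_nat_numeral(2,3)[symmetric] simp flip: One_nat_def)
    show "\<exists>i\<in>{1..4}. \<exists>j\<in>{5..8}. a i j"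
    proof -
      \<comment> \<open>By connectedness an edge leaves the 4-cycle; it cannot lead to
        \<open>v\<close>, so it leads to one of the neighbours of \<open>v\<close>.\<close>
      have "{h5, h6, h8, h7} \<subseteq> S" "{h5, h6, h8, h7} \<noteq> S" using H(1) v(1) by (auto simp: in_nbhd_single)
      then obtain s t where st: "s \<in> {h5, h6, h8, h7}" "t \<in> S - {h5, h6, h8, h7}" "adj s t"
        using conn_edge[OF bad_conn[OF b], of "{h5, h6, h8, h7}"] by blast
      have "t \<noteq> v" using st(1,3) nvh adj_sym by blast
      moreover have "t \<in> set l" using st(2) Sl by blast
      ultimately have t: "t \<in> {x1, x2, x3, x4}" using st(2) unfolding l_def by auto
      have "t \<in> f ` {1, 2, 3, 4}" using t unfolding image_insert f by simp
      then have "\<exists>i\<in>{1..4}. f i = t" by auto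
      moreover have "s \<in> f ` {5, 6, 7, 8}" using st(1) unfolding image_insert f by auto
      then have "\<exists>j\<in>{5..8}. f j = s" by auto
      ultimately show ?thesis using st(3) adj_sym unfolding a_def by metis
    qed
    fix u :: nat assume u: "u < 9"
    obtain w x y z where *: "{w, x, y, z} \<subseteq> S - nbhd {f u}" "distinct [w, x, y, z]"
       "adj w x" "adj x y" "adj y z" "adj z w"
      using C4[of "f u"] unfolding has_C4_def by blast
    have "\<exists>i<9. f i = s" if "s \<in> S" for s using bij that unfolding bij_betw_def by auto
    then obtain w' x' y' z' where i: "w' < 9" "x' < 9" "y' < 9" "z' < 9"
       "f w' = w" "f x' = x" "f y' = y" "f z' = z"
      using *(1) by (metis Diff_iff insert_subset)
    show "\<exists>w x y z. {w, x, y, z} \<subseteq> {..<9} \<and> distinct [w, x, y, z] \<and>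
       a w x \<and> a x y \<and> a y z \<and> a z w \<and> (\<forall>s\<in>{w, x, y, z}. s \<noteq> u \<and> \<not> a u s)"
      by (rule exI[of _ w'], rule exI[of _ x'], rule exI[of _ y'], rule exI[of _ z'])
        (use * i in \<open>auto simp: a_def in_nbhd_single\<close>)
  qed
  then obtain g q where q: "g < 6" "length q = 9" "distinct q" "set q \<subseteq> {..<9}"
       "\<forall>i<9. \<forall>j<9. a (q!i) (q!j) \<longleftrightarrow> exc_mats!g!i!j" by blast
  have "set q = {..<9}" using q(2-4) distinct_card[OF q(3)] by (intro card_subset_eq) auto
  then have "bij_betw (\<lambda>i. q!i) {..<9} {..<9}"
    using q(2,3) by (auto simp: bij_betw_def inj_on_nth set_conv_nth)
  then have "bij_betw (f \<circ> (\<lambda>i. q!i)) {..<9} S" using bij by (rule bij_betw_trans)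
  then show ?thesis unfolding exceptional9_def using q(1,5) unfolding a_def by (intro exI[of _ "f \<circ> (\<lambda>i. q!i)"] exI[of _ g]) simp
qed

text \<open>Induction on the order: the classification of the smaller bad graphs is what
  \<open>smaller_bad\<close> asks for.\<close>

theorem bad_classification: "bad S \<Longrightarrow> card S = 4 \<or> exceptional9 S"
proof (induction "card S" arbitrary: S rule: less_induct)
  case less
  have "smaller_bad (card S)" unfolding smaller_bad_def using less(1) exceptional9_nine by blast
  then show ?case using minimal_bad[OF less(2)] bad9_exceptional9[OF less(2)] by blast
qed

end

section \<open>The bound\<close>

text \<open>The labellings lead from the model graph into \<open>V\<close>, whereas
  \<open>graph_iso\<close> asks for the opposite direction.\<close>

lemma graph_isoI:
  assumes "bij_betw g A V" "\<And>i j. i \<in> A \<Longrightarrow> j \<in> A \<Longrightarrow> {g i, g j} \<in> E \<longleftrightarrow> {i, j} \<in> F"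
  shows "graph_iso (V, E) (A, F)"
  unfolding graph_iso_def fst_conv snd_conv
proof (intro exI conjI ballI)
  show "bij_betw (inv_into A g) V A" by (rule bij_betw_inv_into[OF assms(1)])
  fix u v assume uv: "u \<in> V" "v \<in> V"
  have "g (inv_into A g u) = u" "g (inv_into A g v) = v" "inv_into A g u \<in> A" "inv_into A g v \<in> A"
    using uv assms(1) by (auto simp: bij_betw_def f_inv_into_f inv_into_into)
  then show "{u, v} \<in> E \<longleftrightarrow> {inv_into A g u, inv_into A g v} \<in> F"
    using assms(2)[of "inv_into A g u" "inv_into A g v"] by simp
qed

section \<open>The exceptional graphs and their matrices\<close>

definition exc_graphs :: "(nat set \<times> nat set set) list" where
  "exc_graphs = [G1g, G2g, G3g, G4g, G5g, G6g]"

text \<open>The differences 1, 2, 7, 8 are closed under negation modulo 9, so the order of the two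
  ends is irrelevant.\<close>

lemma G1g_edge: "{k, l} \<in> snd G1g \<longleftrightarrow> k \<in> {1..9} \<and> l \<in> {1..9} \<and> (int l - int k) mod 9 \<in> {1, 2, 7, 8}"
proof -
  have *: "(int i - int j) mod 9 \<in> {1, 2, 7, 8} \<Longrightarrow> (int j - int i) mod 9 \<in> {1, 2, 7, 8}" for i j
  proof -
    assume "(int i - int j) mod 9 \<in> {1, 2, 7, 8}"
    moreover have "(int j - int i) mod 9 = (if (int i - int j) mod 9 = 0 then 0 else 9 - (int i - int j) mod 9)"
      using zmod_zminus1_eq_if[of "int i - int j" 9] by simp
    ultimately show ?thesis by auto
  qed
  show ?thesis (is "_ \<longleftrightarrow> ?R")
  proof
    assume "{k, l} \<in> snd G1g"
    then obtain i j where ij: "{k, l} = {i, j}" "i \<in> {1..9}" "j \<in> {1..9}"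
      "(int j - int i) mod 9 \<in> {1, 2, 7, 8}"
      unfolding G1g_def snd_conv by blast
    from ij(1) consider "k = i" "l = j" | "k = j" "l = i" by (auto simp: doubleton_eq_iff)
    then show ?R using ij(2-4) *[of j i] by cases auto
  next
    assume ?R
    then show "{k, l} \<in> snd G1g" unfolding G1g_def snd_conv by blast
  qed
qed

lemma mem_edges_of: "{k, l} \<in> edges_of xs \<longleftrightarrow> (k, l) \<in> set xs \<or> (l, k) \<in> set xs"
  unfolding edges_of_def by (auto simp: doubleton_eq_iff)

text \<open>The right-hand side can be evaluated. The subtracted list serves \<open>G5g\<close> and
  \<open>G6g\<close>, which arise from \<open>G4g\<close> by deleting edges; it is empty for the
  other graphs.\<close>

lemma all_edges_of:
  "(\<forall>i<9. \<forall>j<9. G!i!j \<longleftrightarrow> {Suc i, Suc j} \<in> edges_of xs - edges_of ys) \<longleftrightarrow>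
    list_all (\<lambda>i. list_all (\<lambda>j. G!i!j = (((Suc i, Suc j) \<in> set xs \<or> (Suc j, Suc i) \<in> set xs) \<and>
      \<not> ((Suc i, Suc j) \<in> set ys \<or> (Suc j, Suc i) \<in> set ys))) [0..<9]) [0..<9]"
  unfolding Diff_iff mem_edges_of by (auto simp: list_all_iff)

lemma exc_graphs_mats: "\<forall>g<6. \<forall>i<9. \<forall>j<9. exc_mats!g!i!j \<longleftrightarrow> {Suc i, Suc j} \<in> snd (exc_graphs!g)"
proof -
  have all6: "(\<forall>i<6. P i) \<longleftrightarrow> P 0 \<and> P 1 \<and> P 2 \<and> P 3 \<and> P 4 \<and> P (5::nat)" for P
    by (simp add: numeral_eq_Suc All_less_Suc conj_ac)
  have e0: "A = A - edges_of []" for A by (simp add: edges_of_def)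
  have e1: "{{2, 3}} = edges_of [(2, 3)]" "{{2, 3}, {4, 5}} = edges_of [(2, 3), (4, 5)]"
    by (simp_all add: edges_of_def)
  have 1: "\<forall>i<9. \<forall>j<9. exc_mats!0!i!j \<longleftrightarrow> {Suc i, Suc j} \<in> snd G1g"
    unfolding G1g_edge all_less_9 exc_mats_def adj_mat_def by simp
  have 2: "\<forall>i<9. \<forall>j<9. exc_mats!1!i!j \<longleftrightarrow> {Suc i, Suc j} \<in> snd G2g"
    unfolding G2g_def snd_conv by (subst e0, subst all_edges_of) code_simp
  have 3: "\<forall>i<9. \<forall>j<9. exc_mats!2!i!j \<longleftrightarrow> {Suc i, Suc j} \<in> snd G3g"
    unfolding G3g_def snd_conv by (subst e0, subst all_edges_of) code_simp
  have 4: "\<forall>i<9. \<forall>j<9. exc_mats!3!i!j \<longleftrightarrow> {Suc i, Suc j} \<in> snd G4g"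
    unfolding G4g_def G4_edges_def snd_conv by (subst e0, subst all_edges_of) code_simp
  have 5: "\<forall>i<9. \<forall>j<9. exc_mats!4!i!j \<longleftrightarrow> {Suc i, Suc j} \<in> snd G5g"
    unfolding G5g_def G4_edges_def snd_conv e1 all_edges_of by code_simp
  have 6: "\<forall>i<9. \<forall>j<9. exc_mats!5!i!j \<longleftrightarrow> {Suc i, Suc j} \<in> snd G6g"
    unfolding G6g_def G4_edges_def snd_conv e1 all_edges_of by code_simp
  show ?thesis unfolding all6 exc_graphs_def using 1 2 3 4 5 6 by simp
qed

lemma exc_graphs_fst: "g < 6 \<Longrightarrow> fst (exc_graphs!g) = {1..9}" and exc_graphs_family: "g < 6 \<Longrightarrow> exc_graphs!g \<in> set E4_family"
  by (auto simp: exc_graphs_def E4_family_def G1g_def G2g_def G3g_def G4g_def G5g_def G6g_def numeral_eq_Suc less_Suc_eq)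

section \<open>The isolation number as a minimum\<close>

lemma finite_isolating: "finite V \<Longrightarrow> finite {card D |D. C4_isolating V E D}"
  by (rule finite_subset[of _ "card ` Pow V"]) (auto simp: C4_isolating_def)

lemma iota_le: "finite V \<Longrightarrow> C4_isolating V E D \<Longrightarrow> iota_C4 V E \<le> card D"
  unfolding iota_C4_def by (rule Min_le[OF finite_isolating]) auto

lemma iota_ge:
  assumes "finite V" "\<And>D. C4_isolating V E D \<Longrightarrow> m \<le> card D" shows "m \<le> iota_C4 V E"
proof -
  have "V - cnbhd V E V = {}" unfolding cnbhd_def by auto
  then have "C4_isolating V E V" unfolding C4_isolating_def contains_C4_def by auto
  then have "{card D |D. C4_isolating V E D} \<noteq> {}" by auto
  then show ?thesis unfolding iota_C4_def using assms(2)
    by (subst Min_ge_iff[OF finite_isolating[OF assms(1)]]) auto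
qed

lemma iota_le_div5:
  fixes V :: "'a set"
  assumes V: "sgraph V E" and c: "connected_graph V E"
    and no: "\<forall>H\<in>set E4_family. \<not> graph_iso (V, E) H"
  shows "iota_C4 V E \<le> card V div 5"
proof -
  define adj where "adj u v \<longleftrightarrow> {u, v} \<in> E" for u v
  have fV: "finite V" using V unfolding sgraph_def by blast
  have inV: "u \<in> V \<and> v \<in> V" if "adj u v" for u v
    using V that unfolding sgraph_def adj_def by (metis doubleton_eq_iff)
  interpret adjacency adj
  proof
    show "adj u v \<Longrightarrow> adj v u" for u v unfolding adj_def by (simp add: insert_commute)
    show "\<not> adj u u" for u
    proof
      assume "adj u u"
      then obtain a b where "{u, u} = {a, b}" "a \<noteq> b" using V unfolding sgraph_def adj_def by blast
      then show False by (auto simp: doubleton_eq_iff)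
    qed
  qed
  have conn: "conn V" unfolding conn_def
  proof (intro conjI allI impI)
    show "V \<noteq> {}" using c unfolding connected_graph_def by blast
    fix A assume A: "A \<subseteq> V \<and> A \<noteq> {} \<and> A \<noteq> V"
    then obtain u v where uv: "u \<in> A" "v \<in> V - A" by blast
    then have "(u, v) \<in> {(x, y). {x, y} \<in> E}\<^sup>*" using c A unfolding connected_graph_def by blast
    \<comment> \<open>Along the path from \<open>u\<close>, either the current vertex is still in
      \<open>A\<close> or some edge has left \<open>A\<close>.\<close>
    then have "v \<in> A \<or> (\<exists>a\<in>A. \<exists>b\<in>V - A. adj a b)"
    proof (induction rule: rtrancl_induct)
      case base show ?case using uv by blast
    next
      case (step y z)
      then show ?case using inV[of y z] unfolding adj_def by blast
    qed
    then show "\<exists>a\<in>A. \<exists>b\<in>V - A. adj a b" using uv by blast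
  qed
  have "\<not> bad V"
  proof
    assume b: "bad V"
    from bad_classification[OF b] show False
    proof
      assume c4: "card V = 4"
      then obtain y where "y \<in> V" by (metis all_not_in_conv card.empty zero_neq_numeral)
      then obtain p q z where V4: "V = {y, p, q, z}" "distinct [y, p, q, z]"
        "adj y p" "adj y q" "adj z p" "adj z q"
        using has_C4_opposite[OF bad_C4[OF b] c4] by metis
      have e4: "{1..4} = {1, 2, 3, 4::nat}" by auto
      have iso: "graph_iso (V, E) ({1..4}, F)"
        if V: "V = set [a, b, c, d]" "distinct [a, b, c, d]" and
          F: "\<forall>i\<in>{1, 2, 3, 4}. \<forall>j\<in>{1, 2, 3, 4}. adj ([a, b, c, d]!(i - 1)) ([a, b, c, d]!(j - 1)) \<longleftrightarrow> {i, j} \<in> F"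
        for a b c d and F :: "nat set set"
      proof (rule graph_isoI)
        show "bij_betw (\<lambda>i. [a, b, c, d]!(i - 1)) {1..4} V"
          unfolding V e4 bij_betw_def using V(2) by (auto simp: inj_on_def)
      next
        fix i j :: nat assume "i \<in> {1..4}" "j \<in> {1..4}"
        then show "{[a, b, c, d]!(i - 1), [a, b, c, d]!(j - 1)} \<in> E \<longleftrightarrow> {i, j} \<in> F"
          using F unfolding e4 adj_def by blast
      qed
      have sym: "adj p y" "adj q y" "adj p z" "adj q z" using V4 adj_sym by blast+
      have dz: "adj z y \<longleftrightarrow> adj y z" "adj q p \<longleftrightarrow> adj p q" using adj_sym by blast+
      note facts = V4(3-6) sym adj_irrefl dz
      \<comment> \<open>The cycle is \<open>y p z q\<close>; its diagonals \<open>y z\<close> and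
        \<open>p q\<close> decide between the 4-cycle, the diamond and the complete graph.\<close>
      have "\<exists>H\<in>set E4_family. graph_iso (V, E) H"
      proof (cases "adj y z")
        case True
        show ?thesis
        proof (cases "adj p q")
          assume pq: "adj p q"
          have "graph_iso (V, E) K4g"
            unfolding K4g_def
          proof (rule iso[of y p z q])
            show "V = set [y, p, z, q]" "distinct [y, p, z, q]" using V4(1,2) by auto
          qed (use facts True pq in \<open>simp add: edges_of_def doubleton_eq_iff\<close>)
          then show ?thesis by (auto simp: E4_family_def)
        next
          assume pq: "\<not> adj p q"
          have "graph_iso (V, E) C4'g"
            unfolding C4'g_def
          proof (rule iso[of y p z q])
            show "V = set [y, p, z, q]" "distinct [y, p, z, q]" using V4(1,2) by auto
          qed (use facts True pq in \<open>simp add: edges_of_def doubleton_eq_iff\<close>)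
          then show ?thesis by (auto simp: E4_family_def)
        qed
      next
        case False
        show ?thesis
        proof (cases "adj p q")
          assume pq: "adj p q"
          \<comment> \<open>The chord of the diamond joins the first and the third label, so the
            labelling now starts at \<open>p\<close>.\<close>
          have "graph_iso (V, E) C4'g"
            unfolding C4'g_def
          proof (rule iso[of p y q z])
            show "V = set [p, y, q, z]" "distinct [p, y, q, z]" using V4(1,2) by auto
          qed (use facts False pq in \<open>simp add: edges_of_def doubleton_eq_iff\<close>)
          then show ?thesis by (auto simp: E4_family_def)
        next
          assume pq: "\<not> adj p q"
          have "graph_iso (V, E) C4g"
            unfolding C4g_def
          proof (rule iso[of y p z q])
            show "V = set [y, p, z, q]" "distinct [y, p, z, q]" using V4(1,2) by auto
          qed (use facts False pq in \<open>simp add: edges_of_def doubleton_eq_iff\<close>)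
          then show ?thesis by (auto simp: E4_family_def)
        qed
      qed
      then show False using no by blast
    next
      assume "exceptional9 V"
      then obtain f g where g: "g < 6" "bij_betw f {..<9} V" "\<forall>i<9. \<forall>j<9. adj (f i) (f j) \<longleftrightarrow> exc_mats!g!i!j"
        unfolding exceptional9_def by blast
      have "bij_betw (\<lambda>i. i - 1) {1..9} {..<9::nat}"
        by (rule bij_betw_byWitness[of _ Suc]) auto
      from bij_betw_trans[OF this g(2)]
      have "graph_iso (V, E) ({1..9}, snd (exc_graphs!g))"
      proof (rule graph_isoI)
        fix i j :: nat assume ij: "i \<in> {1..9}" "j \<in> {1..9}"
        then obtain i' j' where s: "i = Suc i'" "j = Suc j'" "i' < 9" "j' < 9"
          by (cases i; cases j) auto
        then show "{(f \<circ> (\<lambda>i. i - 1)) i, (f \<circ> (\<lambda>i. i - 1)) j} \<in> E \<longleftrightarrow> {i, j} \<in> snd (exc_graphs!g)"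
          using exc_graphs_mats g(1,3) unfolding adj_def by simp
      qed
      then have "graph_iso (V, E) (exc_graphs!g)" using exc_graphs_fst[OF g(1)] by (metis prod.collapse)
      then show False using no exc_graphs_family[OF g(1)] by blast
    qed
  qed
  then have iso_num: "iso_num V \<le> card V div 5" using good_bound[OF conn fV] by blast
  obtain D where D: "finite D" "card D = iso_num V" "\<not> has_C4 (V - nbhd D)" using iso_num_obtain[OF fV] .
  \<comment> \<open>Elements of \<open>D\<close> outside \<open>V\<close> have no neighbours and
    dominate nothing in \<open>V\<close>.\<close>
  have "V - cnbhd V E (D \<inter> V) = V - nbhd D"
    using inV unfolding cnbhd_def nbhd_def adj_def by blast
  then have "C4_isolating V E (D \<inter> V)"
    using D(3) unfolding C4_isolating_def contains_C4_def has_C4_def adj_def by auto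
  then have "iota_C4 V E \<le> card (D \<inter> V)" by (rule iota_le[OF fV])
  also have "\<dots> \<le> card D" by (rule card_mono[OF D(1)]) auto
  finally show ?thesis using D(2) iso_num by simp
qed

section \<open>The extremal graphs\<close>

text \<open>Edges join consecutive numbers, so both cycle neighbours of the largest vertex of a
  4-cycle would be its predecessor.\<close>

lemma iota_path: assumes "n \<le> 4" shows "iota_C4 (B_V n) (B_E n) = 0"
proof -
  have e: "a = b + 1 \<or> b = a + 1" if "{a, b} \<in> B_E n" for a b
    using that assms by (auto simp: B_E_def doubleton_eq_iff)
  have "\<not> contains_C4 S (B_E n)" for S
  proof
    assume "contains_C4 S (B_E n)"
    then obtain a b c d where *: "distinct [a, b, c, d]" "{a, b} \<in> B_E n" "{b, c} \<in> B_E n"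
      "{c, d} \<in> B_E n" "{d, a} \<in> B_E n" unfolding contains_C4_def by blast
    from *(1) e[OF *(2)] e[OF *(3)] e[OF *(4)] e[OF *(5)] show False by auto
  qed
  then have "C4_isolating (B_V n) (B_E n) {}" unfolding C4_isolating_def by simp
  then show ?thesis using iota_le[of "B_V n" "B_E n" "{}"] by (simp add: B_V_def)
qed

text \<open>The vertices 1, ..., a dominate everything. Conversely, all edges at the i-th copy of
  the 4-cycle stay within the block formed by it and the vertex i, so an isolating set meets each of
  these a disjoint blocks.\<close>

lemma iota_B: assumes n: "5 \<le> n" shows "iota_C4 (B_V n) (B_E n) = n div 5"
proof -
  define a where "a = n div 5"
  define b where "b = n - 4 * a"
  define s where "s i = b + 4 * (i - 1)" for i
  have a1: "1 \<le> a" and ab: "a \<le> b" and bn: "n = b + 4 * a" using n unfolding a_def b_def by auto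
  have BE: "B_E n = {{i, i + 1} |i. 1 \<le> i \<and> i \<le> a - 1} \<union> {{a, j} |j. a < j \<and> j \<le> b} \<union>
     (\<Union>i\<in>{1..a}. {{s i+1, s i+2}, {s i+2, s i+3}, {s i+3, s i+4}, {s i+4, s i+1}} \<union> {{i, u} |u. u \<in> {s i+1..s i+4}})"
    using n unfolding B_E_def Let_def a_def b_def s_def by simp
  \<comment> \<open>The number of the block of \<open>u\<close>. The vertices from a + 1 to b get
    numbers above a and count for no block.\<close>
  define blk where "blk u = (if u \<le> b then u else (u - b - 1) div 4 + 1)" for u
  have blk: "blk u = i" if h: "i \<in> {1..a}" "u \<in> {s i+1..s i+4}" for i u
  proof -
    obtain r where r: "u = s i + 1 + r" "r < 4" using h(2) that[of "u - (s i + 1)"] by auto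
    then have "u - b - 1 = 4 * (i - 1) + r" "\<not> u \<le> b" unfolding s_def by auto
    then show ?thesis using h(1) r(2) unfolding blk_def by simp
  qed
  have blk0: "blk i = i" if "i \<in> {1..a}" for i using that ab unfolding blk_def by auto
  have out: "u \<in> {s (blk u)+1..s (blk u)+4}" "blk u \<in> {1..a}" if "b < u" "u \<le> n" for u
  proof -
    define k where "k = (u - b - 1) div 4"
    have "4 * k \<le> u - b - 1" "u - b - 1 < 4 * k + 4" unfolding k_def by linarith+
    moreover have "blk u = k + 1" unfolding blk_def k_def using that by simp
    moreover from calculation have "k < a" using that bn by linarith
    ultimately show "u \<in> {s (blk u)+1..s (blk u)+4}" "blk u \<in> {1..a}" using that unfolding s_def by auto
  qed
  have fB: "finite (B_V n)" unfolding B_V_def by simp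
  have "C4_isolating (B_V n) (B_E n) {1..a}"
  proof -
    have "u \<in> cnbhd (B_V n) (B_E n) {1..a}" if u: "u \<in> B_V n" for u
    proof -
      consider "u \<le> a" | "a < u" "u \<le> b" | "b < u" by linarith
      then show ?thesis
      proof cases
        case 1 then show ?thesis using u unfolding cnbhd_def B_V_def by auto
      next
        case 2
        then have "{a, u} \<in> B_E n" unfolding BE by blast
        then show ?thesis using u a1 unfolding cnbhd_def by auto
      next
        case 3
        have "u \<le> n" using u unfolding B_V_def by simp
        note o = out[OF 3 this]
        have "{blk u, u} \<in> B_E n" unfolding BE using o by blast
        then show ?thesis using u o(2) unfolding cnbhd_def by blast
      qed
    qed
    then have "B_V n - cnbhd (B_V n) (B_E n) {1..a} = {}" by blast
    then show ?thesis using bn ab unfolding C4_isolating_def contains_C4_def B_V_def by auto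
  qed
  from iota_le[OF fB this] have le: "iota_C4 (B_V n) (B_E n) \<le> a" by simp
  have edge: "blk w = blk u" if "{w, u} \<in> B_E n" "b < u" for w u
  proof -
    from that ab obtain i where i: "i \<in> {1..a}" and
      e: "{w, u} \<in> {{s i+1, s i+2}, {s i+2, s i+3}, {s i+3, s i+4}, {s i+4, s i+1}} \<union> {{i, u} |u. u \<in> {s i+1..s i+4}}"
      unfolding BE by (auto simp: doubleton_eq_iff)
    have "u \<noteq> i" using i ab that(2) by auto
    then have "u \<in> {s i+1..s i+4}" "w = i \<or> w \<in> {s i+1..s i+4}" using e by (auto simp: doubleton_eq_iff)
    then show ?thesis using blk[OF i] blk0[OF i] by metis
  qed
  have "a \<le> iota_C4 (B_V n) (B_E n)"
  proof (rule iota_ge[OF fB])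
    fix D assume D: "C4_isolating (B_V n) (B_E n) D"
    then have fD: "finite D" using fB finite_subset unfolding C4_isolating_def by blast
    have "\<exists>w\<in>D. blk w = i" if i: "i \<in> {1..a}" for i
    proof (rule ccontr)
      assume no: "\<not> ?thesis"
      have "u \<in> B_V n - cnbhd (B_V n) (B_E n) D" if u: "u \<in> {s i+1..s i+4}" for u
      proof -
        have "b < u" "u \<le> n" using u i bn unfolding s_def by auto
        moreover have "u \<notin> D" using no blk[OF i u] by blast
        moreover have "\<not> (\<exists>w\<in>D. {w, u} \<in> B_E n)" using edge[OF _ \<open>b < u\<close>] blk[OF i u] no by metis
        ultimately show ?thesis unfolding B_V_def cnbhd_def by auto
      qed
      then have "s i + 1 \<in> B_V n - cnbhd (B_V n) (B_E n) D" "s i + 2 \<in> B_V n - cnbhd (B_V n) (B_E n) D"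
        "s i + 3 \<in> B_V n - cnbhd (B_V n) (B_E n) D" "s i + 4 \<in> B_V n - cnbhd (B_V n) (B_E n) D"
        by auto
      moreover have "{s i+1, s i+2} \<in> B_E n" "{s i+2, s i+3} \<in> B_E n" "{s i+3, s i+4} \<in> B_E n" "{s i+4, s i+1} \<in> B_E n"
        unfolding BE using i by blast+
      moreover have "distinct [s i+1, s i+2, s i+3, s i+4]" by simp
      ultimately have "contains_C4 (B_V n - cnbhd (B_V n) (B_E n) D) (B_E n)"
        unfolding contains_C4_def by blast
      then show False using D unfolding C4_isolating_def by blast
    qed
    then have "{1..a} \<subseteq> blk ` D" by force
    then have "card {1..a} \<le> card (blk ` D)" using fD by (intro card_mono) auto
    then show "a \<le> card D" using card_image_le[OF fD, of blk] by simp
  qed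
  then show ?thesis using le a_def by simp
qed

theorem theorem2:
  fixes V :: "'a set" and E :: "'a set set"
  shows "(sgraph V E \<and> connected_graph V E \<and> (\<forall>H\<in>set E4_family. \<not> graph_iso (V, E) H)
           \<longrightarrow> iota_C4 V E \<le> card V div 5)
         \<and> (\<forall>n::nat. iota_C4 (B_V n) (B_E n) = n div 5)"
proof (intro conjI impI allI)
  show "iota_C4 V E \<le> card V div 5"
    if "sgraph V E \<and> connected_graph V E \<and> (\<forall>H\<in>set E4_family. \<not> graph_iso (V, E) H)"
    using that iota_le_div5 by blast
  show "iota_C4 (B_V n) (B_E n) = n div 5" for n
    using iota_path[of n] iota_B[of n] by (cases "n \<le> 4") auto
qed

end
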